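(* Let $(e^{\boldsymbol u},e^{p},e^{\tilde p}) := (\boldsymbol u-\boldsymbol u_{h,\Lambda},\,p-p_{h,\Lambda},\,\tilde p-\tilde p_{h,\Lambda})\in\boldsymbol{\mathcal V}\times\mathcal W\times\mathcal W$ be the error in the stochastic Galerkin mixed finite element approximation $(\boldsymbol u_{h,\Lambda},p_{h,\Lambda},\tilde p_{h,\Lambda})\in \boldsymbol V_{h,\Lambda}\times W_{h,\Lambda}\times W_{h,\Lambda}$ of the weak solution $(\boldsymbol u,p,\tilde p)$. Assume that $\boldsymbol e_0^{\boldsymbol u},\ e_0^{\tilde p},\ \boldsymbol e_0^{\boldsymbol u,*},\ e_0^{\tilde p,*}$ are all nonzero, and let $\Theta\in[0,1)$ be a constant with $$|\boldsymbol e_0^{\boldsymbol u,*}|_{\bar a_0}\le|\boldsymbol e_0^{\boldsymbol u}|_{\bar a_0}\le\tfrac1{\sqrt{1-\Theta^2}}|\boldsymbol e_0^{\boldsymbol u,*}|_{\bar a_0},\qquad |e_0^{\tilde p,*}|_{\bar d_0}\le|e_0^{\tilde p}|_{\bar d_0}\le\tfrac1{\sqrt{1-\Theta^2}}|e_0^{\tilde p,*}|_{\bar d_0}$$ (such a constant exists). Then $$C_6\,\eta\le|||(e^{\boldsymbol u},e^{p},e^{\tilde p})|||\le\frac{C_7}{\sqrt{1-\gamma^2}\sqrt{1-\Theta^2}}\,\eta,$$ where $\eta=(\eta_1^2+\eta_2^2+\eta_3^2)^{1/2}$ is the total error estimate, $\gamma:=\max\{\gamma_1,\gamma_2\}\in[0,1)$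 with $\gamma_1,\gamma_2$ the CBS constants, $C_6:=\big(\sqrt3\,\max\{E_{\max}+\sqrt d,\;1+\sqrt d\}\big)^{-1}$, $C_7:=C_2/(C_1E_{\min})$, $C_1:=\frac12\min\{C_K,\frac{C_D^2}{E_{\max}^2},\frac1{E_{\max}^2}\}$ and $C_2:=\sqrt{2(E_{\max}^2+C_D^2+1)}/E_{\max}$.
   Context: **Data.** $d\in\{2,3\}$; $D\subset\mathbb R^d$ is a bounded Lipschitz polygon ($d=2$) or polyhedron ($d=3$) with $\partial D=\partial D_D\cup\partial D_N$, $\partial D_D\cap\partial D_N=\emptyset$, both parts nonempty. $\Gamma=\prod_{k=1}^\infty[-1,1]$ carries the product probability measure $\pi=\prod_k\pi_k$, each $\pi_k$ being the uniform probability measure on $[-1,1]$. The Young's modulus is $E(\boldsymbol x,\boldsymbol y)=e_0(\boldsymbol x)+\sum_{k=1}^\infty e_k(\boldsymbol x)y_k$, with $E\in L^\infty(D\times\Gamma)$, $0<E_{\min}\le E\le E_{\max}<\infty$ a.e. in $D\times\Gamma$, $0<e_0^{\min}\le e_0\le e_0^{\max}<\infty$ a.e. in $D$, and $\frac1{e_0^{\min}}\sum_{k\ge1}\|e_k\|_{L^\infty(D)}<1$. The Poisson ratio $\nu\in(0,1/2)$ is a fixed constant, $\alpha:=\frac1{1+\nu}$, $\beta:=\frac{\nu}{1-2\nu}$, and $\boldsymbol f\in (L^2(D))^d$. **Spaces.** $\boldsymbol H^1_{E_0}(D)=\{\boldsymbol v\in H^1(D;\mathbb R^d):\boldsymbol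 v|_{\partial D_D}=\boldsymbol 0\}$, $\boldsymbol{\mathcal V}=L^2_\pi(\Gamma,\boldsymbol H^1_{E_0}(D))$, $\mathcal W=L^2_\pi(\Gamma,L^2(D))$; $\|\cdot\|_{\mathcal W}$ is the norm of $\mathcal W$ and $\|\nabla\boldsymbol v\|_{\boldsymbol{\mathcal W}}:=\big(\int_\Gamma\int_D|\nabla\boldsymbol v|^2\,d\boldsymbol x\,d\pi\big)^{1/2}$. The norm on $\boldsymbol{\mathcal V}\times\mathcal W\times\mathcal W$ is $$|||(\boldsymbol v,q,\tilde q)|||^2:=\alpha\|\nabla\boldsymbol v\|^2_{\boldsymbol{\mathcal W}}+(\alpha^{-1}+(\alpha\beta)^{-1})\|q\|^2_{\mathcal W}+(\alpha\beta)^{-1}\|\tilde q\|^2_{\mathcal W}.$$ **Forms.** With $\boldsymbol\varepsilon(\boldsymbol v)=\frac12(\nabla\boldsymbol v+(\nabla\boldsymbol v)^\top)$: $a(\boldsymbol u,\boldsymbol v)=\alpha\int_\Gamma\int_D E\,\boldsymbol\varepsilon(\boldsymbol u):\boldsymbol\varepsilon(\boldsymbol v)$, $b(\boldsymbol v,p)=-\int_\Gamma\int_D p\,\nabla\cdot\boldsymbol v$, $c(p,q)=(\alpha\beta)^{-1}\int_\Gamma\int_D pq$, $d(p,q)=(\alpha\beta)^{-1}\int_\Gamma\int_D E\,pq$, $f(\boldsymbol v)=\int_\Gamma\int_D\boldsymbol f\cdot\boldsymbol v$ (integrals with respect to $d\boldsymbol x\,d\pi(\boldsymbol y)$). Also $\bar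 a_0(\boldsymbol u,\boldsymbol v):=\alpha\int_\Gamma\int_D\nabla\boldsymbol u:\nabla\boldsymbol v$, $\bar c(p,q):=(\alpha^{-1}+(\alpha\beta)^{-1})\int_\Gamma\int_D pq$, $\bar d_0(p,q):=(\alpha\beta)^{-1}\int_\Gamma\int_D pq$, with induced norms $|\cdot|_{\bar a_0}$, $|\cdot|_{\bar c}$, $|\cdot|_{\bar d_0}$ (square roots of the diagonal values). **Weak problem.** $(\boldsymbol u,p,\tilde p)\in\boldsymbol{\mathcal V}\times\mathcal W\times\mathcal W$ solves $a(\boldsymbol u,\boldsymbol v)+b(\boldsymbol v,p)=f(\boldsymbol v)$, $b(\boldsymbol u,q)-c(\tilde p,q)=0$, $-c(p,\tilde q)+d(\tilde p,\tilde q)=0$ for all $(\boldsymbol v,q,\tilde q)\in\boldsymbol{\mathcal V}\times\mathcal W\times\mathcal W$. **Constants.** $C_K\in(0,1]$ is the Korn constant, i.e. $\int_D\boldsymbol\varepsilon(\boldsymbol v):\boldsymbol\varepsilon(\boldsymbol v)\ge C_K\|\nabla\boldsymbol v\|_{L^2(D)}^2$ for $\boldsymbol v\in\boldsymbol H^1_{E_0}(D)$; $C_D>0$ is the inf-sup constant: $\sup_{0\ne\boldsymbol v\in\boldsymbol{\mathcal V}} b(\boldsymbol v,q)/\|\nabla\boldsymbol v\|_{\boldsymbol{\mathcal W}}\ge C_D\|q\|_{\mathcal W}$ for all $q\in\mathcal W$. **Discretisation.** $\boldsymbol V_h\subset\boldsymbol H^1_{E_0}(D)$ and $W_h\subset L^2(D)$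 are finite-dimensional (conforming finite element) spaces satisfying, with some $\gamma_h>0$, $\sup_{0\ne\boldsymbol v\in\boldsymbol V_h}\frac{\int_D q\,\nabla\cdot\boldsymbol v}{\|\nabla\boldsymbol v\|_{L^2(D)}}\ge\gamma_h\|q\|_{L^2(D)}$ for all $q\in W_h$. $\mathfrak I$ is the set of finitely supported sequences in $\mathbb N_0^{\mathbb N}$; $\psi_{\boldsymbol\alpha}(\boldsymbol y)=\prod_i\psi_{\alpha_i}(y_i)$, where $\psi_n$ is the univariate Legendre polynomial of degree $n$ on $[-1,1]$ normalised in $L^2$ for the uniform probability measure ($\psi_0=1$). For a finite $\Lambda\subset\mathfrak I$, $S_\Lambda=\mathrm{span}\{\psi_{\boldsymbol\alpha}:\boldsymbol\alpha\in\Lambda\}$, $\boldsymbol V_{h,\Lambda}=\boldsymbol V_h\otimes S_\Lambda$, $W_{h,\Lambda}=W_h\otimes S_\Lambda$. The approximation $(\boldsymbol u_{h,\Lambda},p_{h,\Lambda},\tilde p_{h,\Lambda})$ solves the three weak equations with trial and test functions restricted to $\boldsymbol V_{h,\Lambda}\times W_{h,\Lambda}\times W_{h,\Lambda}$. **Residuals.** $\mathcal R^{\boldsymbol u}(\boldsymbol v):=f(\boldsymbol v)-a(\boldsymbol u_{h,\Lambda},\boldsymbol v)-b(\boldsymbol v,p_{h,\Lambda})$ on $\boldsymbol{\mathcal V}$; $\mathcal R^{\tilde p}(\tilde q):=c(p_{h,\Lambda},\tilde q)-d(\tilde p_{h,\Lambda},\tilde q)$ on $\mathcal W$. **Enriched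 spaces and CBS constants.** $\boldsymbol V_h^*=\boldsymbol V_h\oplus\widetilde{\boldsymbol V}_h$, $W_h^*=W_h\oplus\widetilde W_h$ with finite-dimensional $\widetilde{\boldsymbol V}_h\subset\boldsymbol H^1_{E_0}(D)$, $\widetilde W_h\subset L^2(D)$, $\boldsymbol V_h\cap\widetilde{\boldsymbol V}_h=\{\boldsymbol0\}$, $W_h\cap\widetilde W_h=\{0\}$, the pair $\boldsymbol V_h^*,W_h^*$ being inf-sup stable in the same sense as $\boldsymbol V_h,W_h$. The CBS constants $\gamma_1,\gamma_2\in[0,1)$ satisfy $|\int_D\nabla\boldsymbol v:\nabla\widetilde{\boldsymbol v}|\le\gamma_1\|\nabla\boldsymbol v\|_{L^2(D)}\|\nabla\widetilde{\boldsymbol v}\|_{L^2(D)}$ for $\boldsymbol v\in\boldsymbol V_h$, $\widetilde{\boldsymbol v}\in\widetilde{\boldsymbol V}_h$, and $|\int_D q\,\tilde q|\le\gamma_2\|q\|_{L^2(D)}\|\tilde q\|_{L^2(D)}$ for $q\in W_h$, $\tilde q\in\widetilde W_h$. $\mathfrak Q\subset\mathfrak I$ is a finite index set with $\Lambda\cap\mathfrak Q=\emptyset$. Put $\widetilde{\boldsymbol V}_{h,\Lambda}=\widetilde{\boldsymbol V}_h\otimes S_\Lambda$, $\widetilde W_{h,\Lambda}=\widetilde W_h\otimes S_\Lambda$, $\boldsymbol V_{h,\mathfrak Q}=\boldsymbol V_h\otimes S_{\mathfrak Q}$, $W_{h,\mathfrak Q}=W_h\otimes S_{\mathfrak Q}$,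 and $\boldsymbol V^*_{h,\Lambda}:=\boldsymbol V_{h,\Lambda}\oplus\widetilde{\boldsymbol V}_{h,\Lambda}\oplus\boldsymbol V_{h,\mathfrak Q}$, $W^*_{h,\Lambda}:=W_{h,\Lambda}\oplus\widetilde W_{h,\Lambda}\oplus W_{h,\mathfrak Q}$. **Riesz representers and their projections.** $\boldsymbol e_0^{\boldsymbol u}\in\boldsymbol{\mathcal V}$ and $\boldsymbol e_0^{\boldsymbol u,*}\in\boldsymbol V^*_{h,\Lambda}$ solve $\bar a_0(\cdot,\boldsymbol v)=\mathcal R^{\boldsymbol u}(\boldsymbol v)$ for all $\boldsymbol v\in\boldsymbol{\mathcal V}$, respectively all $\boldsymbol v\in\boldsymbol V^*_{h,\Lambda}$; $e_0^{\tilde p}\in\mathcal W$ and $e_0^{\tilde p,*}\in W^*_{h,\Lambda}$ solve $\bar d_0(\cdot,\tilde q)=\mathcal R^{\tilde p}(\tilde q)$ for all $\tilde q\in\mathcal W$, respectively all $\tilde q\in W^*_{h,\Lambda}$. **Error estimates.** $\tilde{\boldsymbol e}^{\boldsymbol u}_{h,\Lambda}\in\widetilde{\boldsymbol V}_{h,\Lambda}$ and $\boldsymbol e^{\boldsymbol u}_{h,\mathfrak Q}\in\boldsymbol V_{h,\mathfrak Q}$ solve $\bar a_0(\cdot,\boldsymbol v)=\mathcal R^{\boldsymbol u}(\boldsymbol v)$ for all $\boldsymbol v$ in $\widetilde{\boldsymbol V}_{h,\Lambda}$, respectively $\boldsymbol V_{h,\mathfrak Q}$; $\tilde e^{\tilde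 p}_{h,\Lambda}\in\widetilde W_{h,\Lambda}$ and $e^{\tilde p}_{h,\mathfrak Q}\in W_{h,\mathfrak Q}$ solve $\bar d_0(\cdot,\tilde q)=\mathcal R^{\tilde p}(\tilde q)$ for all $\tilde q$ in $\widetilde W_{h,\Lambda}$, respectively $W_{h,\mathfrak Q}$. Moreover $e_0^p:=(\alpha^{-1}+(\alpha\beta)^{-1})^{-1}\big(\nabla\cdot\boldsymbol u_{h,\Lambda}+(\alpha\beta)^{-1}\tilde p_{h,\Lambda}\big)$. Then $$\eta_1:=\big(|\tilde{\boldsymbol e}^{\boldsymbol u}_{h,\Lambda}|^2_{\bar a_0}+|\boldsymbol e^{\boldsymbol u}_{h,\mathfrak Q}|^2_{\bar a_0}\big)^{1/2},\quad \eta_2:=|e_0^p|_{\bar c},\quad \eta_3:=\big(|\tilde e^{\tilde p}_{h,\Lambda}|^2_{\bar d_0}+|e^{\tilde p}_{h,\mathfrak Q}|^2_{\bar d_0}\big)^{1/2}.$$ *)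

theory Defs
  imports
    "HOL-Analysis.Analysis"
    "HOL-Probability.Probability"
    "HOL-Library.Function_Algebras"
begin

text \<open>
  Elements of function spaces are represented by functions, not by equivalence classes. Random
  fields are curried: the parameter \<open>y\<close> comes first, the spatial variable \<open>x\<close> second.
\<close>

section \<open>Pointwise real vector space structure on functions\<close>

instantiation "fun" :: (type, real_vector) real_vector
begin

definition scaleR_fun :: "real \<Rightarrow> ('a \<Rightarrow> 'b) \<Rightarrow> 'a \<Rightarrow> 'b" where
  "scaleR_fun c f = (\<lambda>x. c *\<^sub>R f x)"

instance
  by standard (simp_all add: scaleR_fun_def fun_eq_iff scaleR_add_right scaleR_add_left)

end


section \<open>Lebesgue spaces\<close>

definition L2 :: "'a measure \<Rightarrow> ('a \<Rightarrow> 'b::euclidean_space) set" where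
  "L2 M = {g \<in> borel_measurable M. integrable M (\<lambda>x. (norm (g x))\<^sup>2)}"

definition L2_norm :: "'a measure \<Rightarrow> ('a \<Rightarrow> 'b::euclidean_space) \<Rightarrow> real" where
  "L2_norm M g = sqrt (LINT x|M. (norm (g x))\<^sup>2)"

definition Linf_norm :: "'a measure \<Rightarrow> ('a \<Rightarrow> real) \<Rightarrow> ereal" where
  "Linf_norm M g = esssup M (\<lambda>x. ereal \<bar>g x\<bar>)"

definition Linf :: "'a measure \<Rightarrow> ('a \<Rightarrow> real) set" where
  "Linf M = {g \<in> borel_measurable M. Linf_norm M g < \<infinity>}"

text \<open>
  \<open>L\<^sup>2(M; S)\<close> for a space \<open>S\<close> of functions with norm \<open>N\<close>: strongly measurable functions (pointwise
  \<open>N\<close>-limits of \<open>S\<close>-valued simple functions) with square integrable norm. As for Bochner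
  integrability in the library, the limit is required everywhere, not only almost everywhere; every
  class modulo null sets has such a representative.
\<close>
definition L2_Bochner :: "'a measure \<Rightarrow> ('b \<Rightarrow> 'c::real_vector) set \<Rightarrow> (('b \<Rightarrow> 'c) \<Rightarrow> real)
    \<Rightarrow> ('a \<Rightarrow> 'b \<Rightarrow> 'c) set" where
  "L2_Bochner M S N = {v.
     (\<forall>y\<in>space M. v y \<in> S) \<and>
     (\<exists>s. (\<forall>n. simple_function M (s n) \<and> (\<forall>y\<in>space M. s n y \<in> S)) \<and>
          (\<forall>y\<in>space M. (\<lambda>n. N (s n y - v y)) \<longlonglongrightarrow> 0)) \<and>
     integrable M (\<lambda>y. (N (v y))\<^sup>2)}"


section \<open>Lipschitz polygons and polyhedra, surface measure\<close>

definition lipschitz_boundary :: "(real^'n) set \<Rightarrow> bool" where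
  "lipschitz_boundary D \<longleftrightarrow> (\<forall>x\<in>frontier D. \<exists>U e L \<phi>.
     open U \<and> x \<in> U \<and> norm e = 1 \<and> L-lipschitz_on {z. z \<bullet> e = 0} \<phi> \<and>
     D \<inter> U = {z \<in> U. \<phi> (z - (z \<bullet> e) *\<^sub>R e) < z \<bullet> e})"

definition lipschitz_polyhedral_domain :: "(real^'n) set \<Rightarrow> bool" where
  "lipschitz_polyhedral_domain D \<longleftrightarrow>
     D \<noteq> {} \<and> open D \<and> connected D \<and> bounded D \<and> lipschitz_boundary D \<and>
     (\<exists>P. finite P \<and> (\<forall>K\<in>P. polytope K) \<and> closure D = \<Union>P)"

definition hausdorff_pre :: "nat \<Rightarrow> real \<Rightarrow> 'a::metric_space set \<Rightarrow> ennreal" where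
  "hausdorff_pre k \<delta> A =
     (INF C\<in>{C :: nat \<Rightarrow> 'a set. A \<subseteq> (\<Union>i. C i) \<and> (\<forall>i. bounded (C i) \<and> diameter (C i) \<le> \<delta>)}.
       \<Sum>i. ennreal (unit_ball_vol (real k) * (diameter (C i) / 2) ^ k))"

definition hausdorff_outer :: "nat \<Rightarrow> 'a::metric_space set \<Rightarrow> ennreal" where
  "hausdorff_outer k A = (SUP \<delta>\<in>{0<..}. hausdorff_pre k \<delta> A)"

text \<open>
  In dimension \<open>d\<close> the surface measure is the Hausdorff measure with \<open>k = d - 1 \<ge> 1\<close>. Since
  \<^const>\<open>measure_of\<close> yields the zero measure unless the given function is countably additive,
  lemma \<open>emeasure_hausdorff_measure\<close> below confirms that it takes the intended values.
\<close>
definition hausdorff_measure :: "nat \<Rightarrow> 'a::metric_space measure" where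
  "hausdorff_measure k = measure_of UNIV (sets borel) (hausdorff_outer k)"

lemma hausdorff_pre_mono: "A \<subseteq> B \<Longrightarrow> hausdorff_pre k \<delta> A \<le> hausdorff_pre k \<delta> B"
  unfolding hausdorff_pre_def by (rule INF_superset_mono) auto

lemma hausdorff_pre_antimono: "\<delta> \<le> \<epsilon> \<Longrightarrow> hausdorff_pre k \<epsilon> A \<le> hausdorff_pre k \<delta> A"
  unfolding hausdorff_pre_def by (rule INF_superset_mono) (auto intro: order_trans)

lemma hausdorff_pre_le:
  "A \<subseteq> (\<Union>i. C i) \<Longrightarrow> (\<And>i. bounded (C i)) \<Longrightarrow> (\<And>i. diameter (C i) \<le> \<delta>) \<Longrightarrow>
   hausdorff_pre k \<delta> A \<le> (\<Sum>i. ennreal (unit_ball_vol (real k) * (diameter (C i) / 2) ^ k))"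
  unfolding hausdorff_pre_def by (rule INF_lower) auto

lemma hausdorff_pre_countable_subadd:
  fixes A :: "nat \<Rightarrow> 'a::metric_space set"
  shows "hausdorff_pre k \<delta> (\<Union>n. A n) \<le> (\<Sum>n. hausdorff_pre k \<delta> (A n))"
proof (rule ennreal_le_epsilon)
  let ?w = "\<lambda>S::'a set. ennreal (unit_ball_vol (real k) * (diameter S / 2) ^ k)"
  fix e :: real assume fin: "(\<Sum>n. hausdorff_pre k \<delta> (A n)) < top" and e: "0 < e"
  have "\<exists>C. A n \<subseteq> (\<Union>i. C i) \<and> (\<forall>i. bounded (C i) \<and> diameter (C i) \<le> \<delta>) \<and>
          (\<Sum>i. ?w (C i)) \<le> hausdorff_pre k \<delta> (A n) + e * (1/2) ^ Suc n" for n
  proof -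
    have "hausdorff_pre k \<delta> (A n) \<noteq> top"
      using fin sum_le_suminf[OF summableI, of "{n}" "\<lambda>n. hausdorff_pre k \<delta> (A n)"]
      by (auto simp: top_unique)
    then have "hausdorff_pre k \<delta> (A n) < hausdorff_pre k \<delta> (A n) + e * (1/2) ^ Suc n"
      using e by (auto simp: less_top)
    then obtain C where "C \<in> {C. A n \<subseteq> (\<Union>i. C i) \<and> (\<forall>i. bounded (C i) \<and> diameter (C i) \<le> \<delta>)}"
      "(\<Sum>i. ?w (C i)) < hausdorff_pre k \<delta> (A n) + e * (1/2) ^ Suc n"
      by (subst (asm) (1) hausdorff_pre_def) (unfold INF_less_iff, blast)
    then show ?thesis using less_imp_le by (intro exI[of _ C]) auto
  qed
  then obtain C where C: "\<And>n. A n \<subseteq> (\<Union>i. C n i)" "\<And>n i. bounded (C n i)" "\<And>n i. diameter (C n i) \<le> \<delta>"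
    "\<And>n. (\<Sum>i. ?w (C n i)) \<le> hausdorff_pre k \<delta> (A n) + e * (1/2) ^ Suc n"
    by metis
  define B where "B = (\<lambda>(n, i). C n i)"
  have "hausdorff_pre k \<delta> (\<Union>n. A n) \<le> (\<Sum>j. ?w (B (prod_decode j)))"
  proof (rule hausdorff_pre_le)
    show "(\<Union>n. A n) \<subseteq> (\<Union>j. B (prod_decode j))"
    proof
      fix x assume "x \<in> (\<Union>n. A n)"
      then obtain n i where "x \<in> C n i" using C(1) by blast
      then have "x \<in> B (prod_decode (prod_encode (n, i)))" by (simp add: B_def)
      then show "x \<in> (\<Union>j. B (prod_decode j))" by blast
    qed
  qed (auto simp: B_def C split: prod.split)
  also have "\<dots> = (\<Sum>n. \<Sum>i. ?w (C n i))"
    using suminf_ennreal_2dimen[of "\<lambda>n. \<Sum>i. ?w (C n i)" "\<lambda>p. ?w (B p)"] by (simp add: B_def)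
  also have "\<dots> \<le> (\<Sum>n. hausdorff_pre k \<delta> (A n) + e * (1/2) ^ Suc n)"
    by (intro suminf_le C allI summableI)
  also have "\<dots> = (\<Sum>n. hausdorff_pre k \<delta> (A n)) + (\<Sum>n. ennreal e * ennreal ((1/2) ^ Suc n))"
    using e by (subst suminf_add[symmetric])
      (auto simp del: ennreal_suminf_cmult simp add: ennreal_mult[symmetric])
  also have "\<dots> = (\<Sum>n. hausdorff_pre k \<delta> (A n)) + e"
    unfolding ennreal_suminf_cmult
    by (subst suminf_ennreal_eq[OF zero_le_power power_half_series]) auto
  finally show "hausdorff_pre k \<delta> (\<Union>n. A n) \<le> (\<Sum>n. hausdorff_pre k \<delta> (A n)) + e" .
qed

lemma hausdorff_outer_ge: "0 < \<delta> \<Longrightarrow> hausdorff_pre k \<delta> A \<le> hausdorff_outer k A"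
  unfolding hausdorff_outer_def by (rule SUP_upper) auto

lemma hausdorff_outer_mono: "A \<subseteq> B \<Longrightarrow> hausdorff_outer k A \<le> hausdorff_outer k B"
  unfolding hausdorff_outer_def by (rule SUP_mono) (auto intro: hausdorff_pre_mono)

lemma hausdorff_outer_countable_subadd:
  "hausdorff_outer k (\<Union>n. A n) \<le> (\<Sum>n::nat. hausdorff_outer k (A n))"
proof (subst (1) hausdorff_outer_def, rule SUP_least)
  fix \<delta> :: real assume "\<delta> \<in> {0<..}"
  then have "(\<Sum>n. hausdorff_pre k \<delta> (A n)) \<le> (\<Sum>n. hausdorff_outer k (A n))"
    by (intro suminf_le allI summableI hausdorff_outer_ge) auto
  then show "hausdorff_pre k \<delta> (\<Union>n. A n) \<le> (\<Sum>n. hausdorff_outer k (A n))"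
    using hausdorff_pre_countable_subadd[of k \<delta> A] by simp
qed

lemma hausdorff_outer_empty:
  assumes "0 < k" shows "hausdorff_outer k ({}::'a::metric_space set) = 0"
proof -
  have w: "ennreal (unit_ball_vol (real k) * (diameter ({}::'a set) / 2) ^ k) = 0"
    using zero_power[OF assms, where 'a=real] by (simp only: diameter_empty div_0 mult_zero_right ennreal_0)
  have pre: "hausdorff_pre k \<delta> ({}::'a set) \<le> 0" if "0 < \<delta>" for \<delta>
  proof -
    have "hausdorff_pre k \<delta> ({}::'a set)
        \<le> (\<Sum>i::nat. ennreal (unit_ball_vol (real k) * (diameter ({}::'a set) / 2) ^ k))"
      by (rule hausdorff_pre_le) (use that in \<open>simp_all add: diameter_empty\<close>)
    then show ?thesis unfolding w by (simp only: suminf_zero)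
  qed
  then have "hausdorff_outer k ({}::'a set) \<le> 0" unfolding hausdorff_outer_def by (intro SUP_least pre) simp
  then show ?thesis by simp
qed

lemma hausdorff_outer_space:
  assumes "0 < k" shows "outer_measure_space (Pow UNIV) (hausdorff_outer k)"
  unfolding outer_measure_space_def
proof (intro conjI)
  show "positive (Pow UNIV) (hausdorff_outer k)"
    using hausdorff_outer_empty[OF assms] by (simp add: positive_def)
  show "increasing (Pow UNIV) (hausdorff_outer k)"
    unfolding increasing_def using hausdorff_outer_mono by blast
  show "countably_subadditive (Pow UNIV) (hausdorff_outer k)"
    unfolding countably_subadditive_def using hausdorff_outer_countable_subadd by blast
qed

lemma hausdorff_outer_separated:
  fixes A B :: "'a::metric_space set"
  assumes k: "0 < k" and r: "0 < r" and sep: "\<And>a b. a \<in> A \<Longrightarrow> b \<in> B \<Longrightarrow> r \<le> dist a b"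
  shows "hausdorff_outer k A + hausdorff_outer k B \<le> hausdorff_outer k (A \<union> B)"
proof -
  let ?w = "\<lambda>S::'a set. ennreal (unit_ball_vol (real k) * (diameter S / 2) ^ k)"
  have pre: "hausdorff_pre k \<delta> A + hausdorff_pre k \<delta> B \<le> hausdorff_pre k \<delta> (A \<union> B)"
    if \<delta>: "0 < \<delta>" "\<delta> < r" for \<delta>
    unfolding hausdorff_pre_def[of k \<delta> "A \<union> B"]
  proof (safe intro!: INF_greatest)
    fix C :: "nat \<Rightarrow> 'a set"
    assume C: "A \<union> B \<subseteq> (\<Union>i. C i)" "\<forall>i. bounded (C i) \<and> diameter (C i) \<le> \<delta>"
    define CA where "CA = (\<lambda>i. if C i \<inter> A = {} then {} else C i)"
    define CB where "CB = (\<lambda>i. if C i \<inter> B = {} then {} else C i)"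
    have "hausdorff_pre k \<delta> A \<le> (\<Sum>i. ?w (CA i))"
      using C \<delta> by (intro hausdorff_pre_le) (fastforce simp: CA_def)+
    moreover have "hausdorff_pre k \<delta> B \<le> (\<Sum>i. ?w (CB i))"
      using C \<delta> by (intro hausdorff_pre_le) (fastforce simp: CB_def)+
    moreover have "?w (CA i) + ?w (CB i) \<le> ?w (C i)" for i
    proof (cases "C i \<inter> A = {} \<or> C i \<inter> B = {}")
      case True
      have w: "?w {} = 0"
        using zero_power[OF k, where 'a=real] by (simp only: diameter_empty div_0 mult_zero_right ennreal_0)
      show ?thesis
      proof (cases "C i \<inter> A = {}")
        case True
        then have "CA i = {}" "CB i = {} \<or> CB i = C i" by (simp_all add: CA_def CB_def)
        then show ?thesis using w by (elim disjE) (simp_all only: add_0_left order_refl zero_le)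
      next
        case False
        then have "CB i = {}" "CA i = C i" using \<open>C i \<inter> A = {} \<or> C i \<inter> B = {}\<close> by (simp_all add: CA_def CB_def)
        then show ?thesis using w by (simp only: add_0_right order_refl)
      qed
    next
      case False
      then obtain a b where "a \<in> C i" "a \<in> A" "b \<in> C i" "b \<in> B" by blast
      then have "r \<le> diameter (C i)"
        using sep[of a b] C(2) diameter_bounded_bound[of "C i" a b] by auto
      moreover have "diameter (C i) \<le> \<delta>" using C(2) by blast
      ultimately show ?thesis using \<delta> by linarith
    qed
    then have "(\<Sum>i. ?w (CA i)) + (\<Sum>i. ?w (CB i)) \<le> (\<Sum>i. ?w (C i))"
      by (subst suminf_add) (auto intro!: suminf_le)
    ultimately show "hausdorff_pre k \<delta> A + hausdorff_pre k \<delta> B \<le> (\<Sum>i. ?w (C i))"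
      by (meson add_mono order_trans)
  qed
  define F where "F = (\<lambda>n S. hausdorff_pre k (r / (real n + 2)) (S :: 'a set))"
  have outer: "hausdorff_outer k S = (SUP n. F n S)" for S
    unfolding hausdorff_outer_def
  proof (rule SUP_eq)
    fix \<delta> :: real assume "\<delta> \<in> {0<..}"
    then obtain n :: nat where "r / \<delta> < n" using reals_Archimedean2 by blast
    then have "r / (real n + 2) \<le> \<delta>" using r \<open>\<delta> \<in> _\<close> by (auto simp: field_simps)
    then show "\<exists>n\<in>UNIV. hausdorff_pre k \<delta> S \<le> F n S" by (auto simp: F_def intro: hausdorff_pre_antimono)
  qed (use r in \<open>auto simp: F_def intro!: bexI[of _ "r / (real _ + 2)"]\<close>)
  have inc: "incseq (\<lambda>n. F n S)" for S
    using r by (auto simp: incseq_def F_def intro!: hausdorff_pre_antimono divide_left_mono)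
  have "hausdorff_outer k A + hausdorff_outer k B = (SUP n. F n A + F n B)"
    unfolding outer by (rule ennreal_SUP_add[symmetric]) (rule inc)+
  also have "\<dots> \<le> (SUP n. F n (A \<union> B))"
  proof (rule SUP_mono')
    fix n
    have "r / (real n + 2) < r" using r divide_strict_left_mono[of 1 "real n + 2" r] by simp
    then show "F n A + F n B \<le> F n (A \<union> B)"
      unfolding F_def using r by (intro pre) auto
  qed
  finally show ?thesis unfolding outer .
qed

lemma hausdorff_outer_closed:
  fixes F X :: "'a::metric_space set"
  assumes k: "0 < k" and F: "closed F"
  shows "hausdorff_outer k (X \<inter> F) + hausdorff_outer k (X - F) \<le> hausdorff_outer k X"
proof (cases "F = {} \<or> hausdorff_outer k X = top")
  case True
  then show ?thesis using k by (auto simp: hausdorff_outer_empty)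
next
  case False
  then have F0: "F \<noteq> {}" and fin: "hausdorff_outer k X < top" by (auto simp: less_top)
  define Y where "Y = (\<lambda>n. {x \<in> X. 1 / (real n + 1) \<le> infdist x F})"
  define R where "R = (\<lambda>n. Y (Suc n) - Y n)"
  let ?h = "hausdorff_outer k :: 'a set \<Rightarrow> ennreal"
  have Y_mono: "Y m \<subseteq> Y n" if "m \<le> n" for m n
  proof -
    have "1 / (real n + 1) \<le> 1 / (real m + 1)" using that by (intro divide_left_mono) auto
    then show ?thesis by (auto simp: Y_def)
  qed
  have Y_X: "Y n \<subseteq> X" for n by (auto simp: Y_def)
  have sep: "1 / (real n + 1) - 1 / (real n + 2) \<le> dist a b" if "a \<in> Y n" "b \<notin> Y (Suc n)" "b \<in> X" for n a b
  proof -
    have "1 / (real n + 1) \<le> infdist a F" "infdist b F \<le> 1 / (real n + 2)"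
      using that by (auto simp: Y_def add_ac)
    then show ?thesis using infdist_triangle[of a F b] by linarith
  qed
  have parity: "(\<Sum>i<Suc N. ?h (R (2 * i + p))) \<le> ?h (Y (2 * N + p + 1))" for N p
  proof (induction N)
    case 0
    show ?case by (auto simp: R_def intro: hausdorff_outer_mono)
  next
    case (Suc N)
    let ?m = "2 * N + p + 1"
    have "(\<Sum>i<Suc (Suc N). ?h (R (2 * i + p))) \<le> ?h (Y ?m) + ?h (R (Suc ?m))"
      using add_right_mono[OF Suc.IH, of "?h (R (Suc ?m))"] by simp
    also have "\<dots> \<le> ?h (Y ?m \<union> R (Suc ?m))"
      by (rule hausdorff_outer_separated[OF k _ sep[of _ ?m]])
        (auto simp: R_def Y_def frac_less2)
    also have "\<dots> \<le> ?h (Y (2 * Suc N + p + 1))"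
      using Y_mono[of ?m "2 * Suc N + p + 1"] by (intro hausdorff_outer_mono) (auto simp: R_def)
    finally show ?case .
  qed
  have par: "(\<Sum>i<N. ?h (R (2 * i + p))) \<le> ?h X" for N p
  proof (cases N)
    case (Suc M)
    then show ?thesis using order_trans[OF parity[where N=M and p=p] hausdorff_outer_mono[OF Y_X]] by simp
  qed simp
  have "(\<Sum>i<n. ?h (R i)) \<le> ?h X + ?h X" for n
  proof -
    have "(\<Sum>i<n. ?h (R i)) \<le> (\<Sum>i<2 * n. ?h (R i))"
      by (intro sum_mono2) auto
    also have "(\<Sum>i<2 * n. ?h (R i)) = (\<Sum>i<n. ?h (R (2 * i + 0))) + (\<Sum>i<n. ?h (R (2 * i + 1)))"
      by (induction n) (auto simp: add_ac)
    also have "\<dots> \<le> ?h X + ?h X" by (intro add_mono par)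
    finally show ?thesis .
  qed
  then have "(\<Sum>i. ?h (R i)) \<le> ?h X + ?h X"
    by (auto simp: suminf_eq_SUP intro: SUP_least)
  then have sum_fin: "(\<Sum>i. ?h (R i)) < top"
    using fin by (metis ennreal_add_less_top le_less_trans)
  show ?thesis
  proof (rule ennreal_le_epsilon)
    fix e :: real assume e: "0 < e"
    define r where "r = (\<lambda>i. enn2real (?h (R i)))"
    have hr: "?h (R i) = ennreal (r i)" for i
      using sum_fin sum_le_suminf[OF summableI, of "{i}" "\<lambda>i. ?h (R i)"] by (auto simp: r_def less_top)
    have r0: "0 \<le> r i" for i by (simp add: r_def)
    have sr: "summable r"
      using sum_fin r0 by (intro summable_suminf_not_top) (auto simp: hr)
    obtain N where N: "norm (\<Sum>i. r (i + N)) < e"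
      using suminf_exist_split[OF e sr] by blast
    have "X - F \<subseteq> (\<Union>i. case i of 0 \<Rightarrow> Y N | Suc j \<Rightarrow> R (j + N))"
    proof
      fix x assume x: "x \<in> X - F"
      then have "0 < infdist x F" using infdist_pos_not_in_closed[OF F F0] by blast
      then obtain m where "1 / infdist x F < real m" using reals_Archimedean2 by blast
      then have "1 / (real m + 1) \<le> infdist x F" 
        using \<open>0 < infdist x F\<close> by (auto simp: field_simps)
      then have xm: "x \<in> Y m" using x by (auto simp: Y_def)
      show "x \<in> (\<Union>i. case i of 0 \<Rightarrow> Y N | Suc j \<Rightarrow> R (j + N))"
      proof (cases "x \<in> Y N")
        case True then show ?thesis by (auto intro!: exI[of _ 0])
      next
        case False
        define l where "l = (LEAST l. x \<in> Y l)"
        have l: "x \<in> Y l" unfolding l_def by (rule LeastI[of _ m]) (rule xm)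
        then have "N < l" using False Y_mono[of l N] by (metis not_le subsetD)
        then obtain j where j: "l = Suc (j + N)" by (metis add.commute less_iff_Suc_add)
        then have "x \<notin> Y (j + N)" using not_less_Least[of "j + N" "\<lambda>l. x \<in> Y l"] by (auto simp: l_def)
        then have "x \<in> R (j + N)" using l j by (auto simp: R_def)
        then show ?thesis by (auto intro!: exI[of _ "Suc j"])
      qed
    qed
    then have "?h (X - F) \<le> ?h (\<Union>i. case i of 0 \<Rightarrow> Y N | Suc j \<Rightarrow> R (j + N))"
      by (rule hausdorff_outer_mono)
    also have "\<dots> \<le> (\<Sum>i. ?h (case i of 0 \<Rightarrow> Y N | Suc j \<Rightarrow> R (j + N)))"
      by (rule hausdorff_outer_countable_subadd)
    also have "\<dots> = ?h (Y N) + (\<Sum>j. ?h (R (j + N)))"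
      by (subst suminf_offset[of _ 1]) (auto intro: summableI simp: add.commute)
    also have "(\<Sum>j. ?h (R (j + N))) = ennreal (\<Sum>j. r (j + N))"
      unfolding hr using r0 sr by (intro suminf_ennreal2) (auto simp: summable_iff_shift)
    also have "\<dots> \<le> ennreal e" using N by (intro ennreal_leI) auto
    finally have 1: "?h (X - F) \<le> ?h (Y N) + ennreal e" by (simp add: add_left_mono)
    have "?h (X \<inter> F) + ?h (Y N) \<le> ?h (X \<inter> F \<union> Y N)"
    proof (rule hausdorff_outer_separated[OF k, of "1 / (real N + 1)"])
      fix a b assume "a \<in> X \<inter> F" "b \<in> Y N"
      then show "1 / (real N + 1) \<le> dist a b"
        using infdist_le[of a F b] by (auto simp: Y_def dist_commute)
    qed auto
    also have "\<dots> \<le> ?h X" using Y_X by (intro hausdorff_outer_mono) auto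
    finally have 2: "?h (X \<inter> F) + ?h (Y N) \<le> ?h X" .
    have "?h (X \<inter> F) + ?h (X - F) \<le> ?h (X \<inter> F) + (?h (Y N) + e)"
      using 1 by (rule add_left_mono)
    also have "\<dots> \<le> ?h X + e" using 2 by (simp add: add.assoc[symmetric] add_right_mono)
    finally show "?h (X \<inter> F) + ?h (X - F) \<le> ?h X + e" .
  qed
qed

lemma emeasure_hausdorff_measure:
  fixes A :: "'a::metric_space set"
  assumes k: "0 < k" and A: "A \<in> sets borel"
  shows "emeasure (hausdorff_measure k) A = hausdorff_outer k A"
proof -
  let ?L = "lambda_system UNIV (Pow UNIV) (hausdorff_outer k :: 'a set \<Rightarrow> ennreal)"
  interpret P: sigma_algebra "UNIV :: 'a set" "Pow UNIV" by (rule sigma_algebra_Pow)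
  have L: "measure_space UNIV ?L (hausdorff_outer k)"
    by (rule P.caratheodory_lemma[OF hausdorff_outer_space[OF k]])
  have sub: "subadditive (Pow UNIV) (hausdorff_outer k :: 'a set \<Rightarrow> ennreal)"
    using hausdorff_outer_space[OF k, where 'a='a] unfolding outer_measure_space_def
    by (intro P.countably_subadditive_subadditive) auto
  have "closed F \<Longrightarrow> F \<in> ?L" for F :: "'a set"
  proof -
    assume F: "closed F"
    have "hausdorff_outer k (X \<inter> F) + hausdorff_outer k (X - F) = hausdorff_outer k X" for X
    proof (rule antisym[OF hausdorff_outer_closed[OF k F]])
      show "hausdorff_outer k X \<le> hausdorff_outer k (X \<inter> F) + hausdorff_outer k (X - F)"
        using subadditiveD[OF sub, of "X \<inter> F" "X - F"] by (simp add: Int_Diff_disjoint Int_Diff_Un)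
    qed
    then show "F \<in> ?L" using P.lambda_system_eq[of "hausdorff_outer k"] by simp
  qed
  then have "sigma_sets UNIV (Collect closed) \<subseteq> ?L"
    using L unfolding measure_space_def by (intro sigma_algebra.sigma_sets_subset) auto
  then have "sets borel \<subseteq> ?L"
    by (simp add: borel_eq_closed)
  then have "measure_space UNIV (sets borel) (hausdorff_outer k :: 'a set \<Rightarrow> ennreal)"
    using L sets.sigma_algebra_axioms[of "borel :: 'a measure"]
    by (intro measure_down[OF L]) auto
  then show ?thesis
    using A unfolding measure_space_def hausdorff_measure_def
    by (intro emeasure_measure_of_sigma) auto
qed


section \<open>Sobolev spaces\<close>

definition pderivative :: "'n \<Rightarrow> (real^'n \<Rightarrow> real) \<Rightarrow> real^'n \<Rightarrow> real" where
  "pderivative j \<phi> x = frechet_derivative \<phi> (at x) (axis j 1)"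

primrec Ck :: "nat \<Rightarrow> (real^'n \<Rightarrow> real) \<Rightarrow> bool" where
  "Ck 0 \<phi> \<longleftrightarrow> continuous_on UNIV \<phi>"
| "Ck (Suc k) \<phi> \<longleftrightarrow> (\<forall>x. \<phi> differentiable (at x)) \<and> (\<forall>j. Ck k (pderivative j \<phi>))"

definition smooth :: "(real^'n \<Rightarrow> real) \<Rightarrow> bool" where
  "smooth \<phi> \<longleftrightarrow> (\<forall>k. Ck k \<phi>)"

definition test_functions :: "(real^'n) set \<Rightarrow> (real^'n \<Rightarrow> real) set" where
  "test_functions D = {\<phi>. smooth \<phi> \<and> compact (closure {x. \<phi> x \<noteq> 0}) \<and> closure {x. \<phi> x \<noteq> 0} \<subseteq> D}"

text \<open>The entry \<open>(i, j)\<close> of a gradient is the derivative of the \<open>i\<close>-th component along \<open>x\<^sub>j\<close>.\<close>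
definition is_weak_grad :: "(real^'n) set \<Rightarrow> (real^'n \<Rightarrow> real^'n) \<Rightarrow> (real^'n \<Rightarrow> real^'n^'n) \<Rightarrow> bool" where
  "is_weak_grad D v G \<longleftrightarrow> G \<in> L2 (lebesgue_on D) \<and>
     (\<forall>\<phi>\<in>test_functions D. \<forall>i j.
        (LINT x|lebesgue_on D. v x $ i * pderivative j \<phi> x) =
        - (LINT x|lebesgue_on D. G x $ i $ j * \<phi> x))"

definition H1 :: "(real^'n) set \<Rightarrow> (real^'n \<Rightarrow> real^'n) set" where
  "H1 D = {v \<in> L2 (lebesgue_on D). \<exists>G. is_weak_grad D v G}"

text \<open>
  Some representative of the weak gradient, which is unique up to null sets. For a random field the
  representatives chosen for different \<open>y\<close> are unrelated, so below every integral over
  \<open>\<Gamma> \<times> D\<close> involving a gradient is an iterated one, with inner integral over \<open>D\<close>.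
\<close>
definition grad :: "(real^'n) set \<Rightarrow> (real^'n \<Rightarrow> real^'n) \<Rightarrow> real^'n \<Rightarrow> real^'n^'n" where
  "grad D v = (SOME G. is_weak_grad D v G)"

definition H1_norm :: "(real^'n) set \<Rightarrow> (real^'n \<Rightarrow> real^'n) \<Rightarrow> real" where
  "H1_norm D v = sqrt ((L2_norm (lebesgue_on D) v)\<^sup>2 + (L2_norm (lebesgue_on D) (grad D v))\<^sup>2)"

definition symgrad :: "(real^'n) set \<Rightarrow> (real^'n \<Rightarrow> real^'n) \<Rightarrow> real^'n \<Rightarrow> real^'n^'n" where
  "symgrad D v x = (1/2) *\<^sub>R (grad D v x + transpose (grad D v x))"

definition divergence :: "(real^'n) set \<Rightarrow> (real^'n \<Rightarrow> real^'n) \<Rightarrow> real^'n \<Rightarrow> real" where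
  "divergence D v x = trace (grad D v x)"

text \<open>
  The trace operator \<open>H\<^sup>1(D) \<rightarrow> L\<^sup>2(\<partial>D)\<close> as the continuous extension of the restriction of smooth
  functions to the boundary (smooth functions on \<open>\<real>\<^sup>d\<close> are dense in \<open>H\<^sup>1(D)\<close> for Lipschitz \<open>D\<close>).
\<close>
definition has_trace :: "(real^'n) set \<Rightarrow> (real^'n \<Rightarrow> real^'n) \<Rightarrow> (real^'n \<Rightarrow> real^'n) \<Rightarrow> bool" where
  "has_trace D v g \<longleftrightarrow> g \<in> borel_measurable borel \<and>
     (\<exists>\<phi>. (\<forall>n i. smooth (\<lambda>x. \<phi> n x $ i)) \<and> (\<forall>n. \<phi> n \<in> H1 D) \<and>
          (\<lambda>n. H1_norm D (\<phi> n - v)) \<longlonglongrightarrow> 0 \<and>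
          (\<lambda>n. \<integral>\<^sup>+x\<in>frontier D. ennreal ((norm (\<phi> n x - g x))\<^sup>2) \<partial>hausdorff_measure (CARD('n) - 1))
             \<longlonglongrightarrow> 0)"

definition H1_E0 :: "(real^'n) set \<Rightarrow> (real^'n) set \<Rightarrow> (real^'n \<Rightarrow> real^'n) set" where
  "H1_E0 D DD = {v \<in> H1 D. \<exists>g. has_trace D v g \<and>
     (AE x in hausdorff_measure (CARD('n) - 1). x \<in> DD \<longrightarrow> g x = 0)}"


section \<open>The parameter domain and the solution spaces\<close>

text \<open>
  Coordinates are numbered from 0: \<open>y k\<close> and \<open>e k\<close> stand for the usual \<open>y\<^bsub>k+1\<^esub>\<close> and
  \<open>e\<^bsub>k+1\<^esub>\<close>, while the mean field \<open>e\<^sub>0\<close> is the separate argument \<open>e0\<close>.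
\<close>
definition param :: "(nat \<Rightarrow> real) measure" where
  "param = Pi\<^sub>M UNIV (\<lambda>_. uniform_measure (restrict_space lborel {-1..1}) {-1..1})"

definition modulus :: "('x \<Rightarrow> real) \<Rightarrow> (nat \<Rightarrow> 'x \<Rightarrow> real) \<Rightarrow> 'x \<Rightarrow> (nat \<Rightarrow> real) \<Rightarrow> real" where
  "modulus e0 e x y = e0 x + (\<Sum>k. e k x * y k)"

type_synonym 'n vfield = "(nat \<Rightarrow> real) \<Rightarrow> real^'n \<Rightarrow> real^'n"
type_synonym 'n sfield = "(nat \<Rightarrow> real) \<Rightarrow> real^'n \<Rightarrow> real"

definition VV :: "(real^'n) set \<Rightarrow> (real^'n) set \<Rightarrow> 'n vfield set" where
  "VV D DD = L2_Bochner param (H1_E0 D DD) (H1_norm D)"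

definition WW :: "(real^'n) set \<Rightarrow> 'n sfield set" where
  "WW D = L2_Bochner param (L2 (lebesgue_on D)) (L2_norm (lebesgue_on D))"

definition W_norm :: "(real^'n) set \<Rightarrow> 'n sfield \<Rightarrow> real" where
  "W_norm D q = sqrt (LINT y|param. LINT x|lebesgue_on D. (q y x)\<^sup>2)"

definition gradW_norm :: "(real^'n) set \<Rightarrow> 'n vfield \<Rightarrow> real" where
  "gradW_norm D v = sqrt (LINT y|param. LINT x|lebesgue_on D. (norm (grad D (v y) x))\<^sup>2)"

definition triple_norm :: "(real^'n) set \<Rightarrow> real \<Rightarrow> real \<Rightarrow> 'n vfield \<Rightarrow> 'n sfield \<Rightarrow> 'n sfield \<Rightarrow> real" where
  "triple_norm D \<alpha> \<beta> v q qt =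
     sqrt (\<alpha> * (gradW_norm D v)\<^sup>2 + (1 / \<alpha> + 1 / (\<alpha> * \<beta>)) * (W_norm D q)\<^sup>2
           + 1 / (\<alpha> * \<beta>) * (W_norm D qt)\<^sup>2)"

definition zero_ae :: "(real^'n) set \<Rightarrow> (real^'n \<Rightarrow> 'b::zero) \<Rightarrow> bool" where
  "zero_ae D v \<longleftrightarrow> (AE x in lebesgue_on D. v x = 0)"

definition zero_field :: "(real^'n) set \<Rightarrow> ((nat \<Rightarrow> real) \<Rightarrow> real^'n \<Rightarrow> 'b::zero) \<Rightarrow> bool" where
  "zero_field D v \<longleftrightarrow> (AE y in param. zero_ae D (v y))"


section \<open>Forms\<close>

text \<open>The inner product of matrices is the Frobenius product.\<close>

definition a_form :: "(real^'n) set \<Rightarrow> real \<Rightarrow> (real^'n \<Rightarrow> (nat \<Rightarrow> real) \<Rightarrow> real) \<Rightarrow> 'n vfield \<Rightarrow> 'n vfield \<Rightarrow> real" where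
  "a_form D \<alpha> E u v =
     \<alpha> * (LINT y|param. LINT x|lebesgue_on D. E x y * (symgrad D (u y) x \<bullet> symgrad D (v y) x))"

definition b_form :: "(real^'n) set \<Rightarrow> 'n vfield \<Rightarrow> 'n sfield \<Rightarrow> real" where
  "b_form D v p = - (LINT y|param. LINT x|lebesgue_on D. p y x * divergence D (v y) x)"

definition c_form :: "(real^'n) set \<Rightarrow> real \<Rightarrow> real \<Rightarrow> 'n sfield \<Rightarrow> 'n sfield \<Rightarrow> real" where
  "c_form D \<alpha> \<beta> p q = 1 / (\<alpha> * \<beta>) * (LINT y|param. LINT x|lebesgue_on D. p y x * q y x)"

definition d_form :: "(real^'n) set \<Rightarrow> real \<Rightarrow> real \<Rightarrow> (real^'n \<Rightarrow> (nat \<Rightarrow> real) \<Rightarrow> real) \<Rightarrow> 'n sfield \<Rightarrow> 'n sfield \<Rightarrow> real" where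
  "d_form D \<alpha> \<beta> E p q = 1 / (\<alpha> * \<beta>) * (LINT y|param. LINT x|lebesgue_on D. E x y * p y x * q y x)"

definition f_form :: "(real^'n) set \<Rightarrow> (real^'n \<Rightarrow> real^'n) \<Rightarrow> 'n vfield \<Rightarrow> real" where
  "f_form D f v = (LINT y|param. LINT x|lebesgue_on D. f x \<bullet> v y x)"

definition a0_form :: "(real^'n) set \<Rightarrow> real \<Rightarrow> 'n vfield \<Rightarrow> 'n vfield \<Rightarrow> real" where
  "a0_form D \<alpha> u v = \<alpha> * (LINT y|param. LINT x|lebesgue_on D. grad D (u y) x \<bullet> grad D (v y) x)"

definition cbar_form :: "(real^'n) set \<Rightarrow> real \<Rightarrow> real \<Rightarrow> 'n sfield \<Rightarrow> 'n sfield \<Rightarrow> real" where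
  "cbar_form D \<alpha> \<beta> p q =
     (1 / \<alpha> + 1 / (\<alpha> * \<beta>)) * (LINT y|param. LINT x|lebesgue_on D. p y x * q y x)"

definition d0_form :: "(real^'n) set \<Rightarrow> real \<Rightarrow> real \<Rightarrow> 'n sfield \<Rightarrow> 'n sfield \<Rightarrow> real" where
  "d0_form D \<alpha> \<beta> p q = 1 / (\<alpha> * \<beta>) * (LINT y|param. LINT x|lebesgue_on D. p y x * q y x)"

definition form_norm :: "('v \<Rightarrow> 'v \<Rightarrow> real) \<Rightarrow> 'v \<Rightarrow> real" where
  "form_norm B v = sqrt (B v v)"

definition weak_solution :: "(real^'n) set \<Rightarrow> real \<Rightarrow> real \<Rightarrow> (real^'n \<Rightarrow> (nat \<Rightarrow> real) \<Rightarrow> real)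
    \<Rightarrow> (real^'n \<Rightarrow> real^'n) \<Rightarrow> 'n vfield set \<Rightarrow> 'n sfield set \<Rightarrow> 'n vfield \<Rightarrow> 'n sfield \<Rightarrow> 'n sfield \<Rightarrow> bool" where
  "weak_solution D \<alpha> \<beta> E f V W u p pt \<longleftrightarrow>
     u \<in> V \<and> p \<in> W \<and> pt \<in> W \<and>
     (\<forall>v\<in>V. a_form D \<alpha> E u v + b_form D v p = f_form D f v) \<and>
     (\<forall>q\<in>W. b_form D u q - c_form D \<alpha> \<beta> pt q = 0) \<and>
     (\<forall>qt\<in>W. - c_form D \<alpha> \<beta> p qt + d_form D \<alpha> \<beta> E pt qt = 0)"

definition res_u :: "(real^'n) set \<Rightarrow> real \<Rightarrow> (real^'n \<Rightarrow> (nat \<Rightarrow> real) \<Rightarrow> real)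
    \<Rightarrow> (real^'n \<Rightarrow> real^'n) \<Rightarrow> 'n vfield \<Rightarrow> 'n sfield \<Rightarrow> 'n vfield \<Rightarrow> real" where
  "res_u D \<alpha> E f uh ph v = f_form D f v - a_form D \<alpha> E uh v - b_form D v ph"

definition res_pt :: "(real^'n) set \<Rightarrow> real \<Rightarrow> real \<Rightarrow> (real^'n \<Rightarrow> (nat \<Rightarrow> real) \<Rightarrow> real)
    \<Rightarrow> 'n sfield \<Rightarrow> 'n sfield \<Rightarrow> 'n sfield \<Rightarrow> real" where
  "res_pt D \<alpha> \<beta> E ph pth qt = c_form D \<alpha> \<beta> ph qt - d_form D \<alpha> \<beta> E pth qt"

definition represents :: "('v \<Rightarrow> 'v \<Rightarrow> real) \<Rightarrow> 'v set \<Rightarrow> ('v \<Rightarrow> real) \<Rightarrow> 'v \<Rightarrow> bool" where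
  "represents B S R e \<longleftrightarrow> e \<in> S \<and> (\<forall>v\<in>S. B e v = R v)"


section \<open>Constants\<close>

definition korn_constant :: "(real^'n) set \<Rightarrow> (real^'n) set \<Rightarrow> real \<Rightarrow> bool" where
  "korn_constant D DD C \<longleftrightarrow> 0 < C \<and> C \<le> 1 \<and>
     (\<forall>v\<in>H1_E0 D DD. C * (L2_norm (lebesgue_on D) (grad D v))\<^sup>2
        \<le> (LINT x|lebesgue_on D. symgrad D v x \<bullet> symgrad D v x))"

definition inf_sup_constant :: "(real^'n) set \<Rightarrow> (real^'n) set \<Rightarrow> real \<Rightarrow> bool" where
  "inf_sup_constant D DD C \<longleftrightarrow> 0 < C \<and>
     (\<forall>q\<in>WW D. ereal (C * W_norm D q)
        \<le> (SUP v\<in>{v \<in> VV D DD. \<not> zero_field D v}. ereal (b_form D v q / gradW_norm D v)))"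

definition inf_sup_stable :: "(real^'n) set \<Rightarrow> (real^'n \<Rightarrow> real^'n) set \<Rightarrow> (real^'n \<Rightarrow> real) set \<Rightarrow> bool" where
  "inf_sup_stable D Vh Wh \<longleftrightarrow> (\<exists>\<gamma>>0. \<forall>q\<in>Wh. ereal (\<gamma> * L2_norm (lebesgue_on D) q)
     \<le> (SUP v\<in>{v \<in> Vh. \<not> zero_ae D v}.
          ereal ((LINT x|lebesgue_on D. q x * divergence D v x) / L2_norm (lebesgue_on D) (grad D v))))"


section \<open>Discretisation\<close>

definition fin_dim_subspace :: "'v::real_vector set \<Rightarrow> bool" where
  "fin_dim_subspace S \<longleftrightarrow> (\<exists>B. finite B \<and> S = span B)"

text \<open>Trivial intersection, for spaces of functions that are identified when equal a.e. in \<open>D\<close>.\<close>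
definition trivial_inter :: "(real^'n) set \<Rightarrow> (real^'n \<Rightarrow> 'b::zero) set \<Rightarrow> (real^'n \<Rightarrow> 'b) set \<Rightarrow> bool" where
  "trivial_inter D A B \<longleftrightarrow>
     (\<forall>v\<in>A. \<forall>w\<in>B. (AE x in lebesgue_on D. v x = w x) \<longrightarrow> zero_ae D v)"

definition multi_indices :: "(nat \<Rightarrow> nat) set" where
  "multi_indices = {\<mu>. finite {i. \<mu> i \<noteq> 0}}"

text \<open>
  Rodrigues' formula; the factor \<open>sqrt (2n + 1)\<close> normalises with respect to the uniform probability
  measure on \<open>[-1, 1]\<close>.
\<close>
definition legendre :: "nat \<Rightarrow> real \<Rightarrow> real" where
  "legendre n t = sqrt (2 * real n + 1) * poly ((pderiv ^^ n) ([:-1, 0, 1:] ^ n)) t / (2 ^ n * fact n)"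

text \<open>The factors with \<open>\<mu> i = 0\<close> are constant 1.\<close>
definition psi :: "(nat \<Rightarrow> nat) \<Rightarrow> (nat \<Rightarrow> real) \<Rightarrow> real" where
  "psi \<mu> y = (\<Prod>i\<in>{i. \<mu> i \<noteq> 0}. legendre (\<mu> i) (y i))"

definition S_space :: "(nat \<Rightarrow> nat) set \<Rightarrow> ((nat \<Rightarrow> real) \<Rightarrow> real) set" where
  "S_space \<Lambda> = span (psi ` \<Lambda>)"

definition tensor :: "('x \<Rightarrow> 'b::real_vector) set \<Rightarrow> ('y \<Rightarrow> real) set \<Rightarrow> ('y \<Rightarrow> 'x \<Rightarrow> 'b) set" where
  "tensor V S = span {(\<lambda>y x. s y *\<^sub>R v x) | v s. v \<in> V \<and> s \<in> S}"

definition e0p_field :: "(real^'n) set \<Rightarrow> real \<Rightarrow> real \<Rightarrow> 'n vfield \<Rightarrow> 'n sfield \<Rightarrow> 'n sfield" where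
  "e0p_field D \<alpha> \<beta> uh pth y x =
     inverse (1 / \<alpha> + 1 / (\<alpha> * \<beta>)) * (divergence D (uh y) x + 1 / (\<alpha> * \<beta>) * pth y x)"

end

theory Submission
  imports Defs
begin

text \<open>
  The error solves a saddle point problem whose right-hand sides are represented by \<open>e0u\<close>,
  \<open>e0p_field\<close> and \<open>e0pt\<close>. Testing with \<open>(eu + t w, - ep, ept - ep / Emax)\<close>, where \<open>w\<close> nearly
  attains the inf-sup supremum at \<open>ep\<close>, bounds the error by the representers; testing with the
  representers themselves gives the converse.

  By Galerkin orthogonality, the representers on the enriched spaces only see the enrichments, whose
  two parts are orthogonal to each other because \<open>\<Lambda>\<close> and \<open>Q\<close> are disjoint, and the CBS
  inequality, which integrates over the parameter domain, accounts for the factor \<open>1 - \<gamma>\<^sup>2\<close>. The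
  constant \<open>\<Theta>\<close> exists because the forms are definite; for \<open>a0\<close> this is deduced from Korn's
  inequality.
\<close>

section \<open>Positive semidefinite forms\<close>

text \<open>Elements of the spaces are functions rather than classes, so all forms are only
  semidefinite, and the gradient, being a chosen representative, is linear only up to null sets.
  Representatives chosen at different parameters are unrelated, so a gradient field need not be
  jointly measurable: integrals over \<open>D\<close> become measurable functions of the parameter
  through approximation by simple functions whose values are themselves functions on
  \<open>D\<close>. All bilinear forms are instances of one weighted pairing, to which these
  arguments are applied once. That weak gradients are unique up to null sets rests on the
  fundamental lemma of the calculus of variations, for which smooth cut-offs are built from
  exp(-1/t).

  On the constants: the supremum in the inf-sup condition may not be attained, so the stability
  bound is first proved with a factor \<open>\<theta>\<^sup>2\<close> for every \<theta> below 1.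
  The square root of the dimension is the Frobenius norm of the identity matrix, which bounds the
  trace. The factor \<open>1 - \<gamma>\<^sup>2\<close> is what a CBS inequality leaves of the
  square of \<open>w\<close> in the square of \<open>v + w\<close>, whatever \<open>v\<close>
  is.\<close>

lemma scaleR_fun_apply [simp]: "(c *\<^sub>R f) x = c *\<^sub>R f x" for f :: "'a \<Rightarrow> 'b::real_vector"
  by (simp add: scaleR_fun_def)

text \<open>Definiteness cannot be asked for, since functions equal almost everywhere are different
  elements. The carrier is explicit because additivity of the integrals is only guaranteed for
  square integrable functions.\<close>

locale psd_form =
  fixes S :: "'v::real_vector set" and B :: "'v \<Rightarrow> 'v \<Rightarrow> real"
  assumes subspace: "subspace S"
    and add_left: "x \<in> S \<Longrightarrow> y \<in> S \<Longrightarrow> z \<in> S \<Longrightarrow> B (x + y) z = B x z + B y z"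
    and scale_left: "x \<in> S \<Longrightarrow> z \<in> S \<Longrightarrow> B (c *\<^sub>R x) z = c * B x z"
    and sym: "x \<in> S \<Longrightarrow> y \<in> S \<Longrightarrow> B x y = B y x"
    and nonneg: "x \<in> S \<Longrightarrow> 0 \<le> B x x"
begin

lemma closed:
  "0 \<in> S" "x \<in> S \<Longrightarrow> y \<in> S \<Longrightarrow> x + y \<in> S" "x \<in> S \<Longrightarrow> c *\<^sub>R x \<in> S"
  "x \<in> S \<Longrightarrow> y \<in> S \<Longrightarrow> x - y \<in> S"
  using subspace by (auto simp: subspace_0 subspace_add subspace_scale subspace_diff)

lemma add_right: "x \<in> S \<Longrightarrow> y \<in> S \<Longrightarrow> z \<in> S \<Longrightarrow> B z (x + y) = B z x + B z y"
  by (metis add_left closed(2) sym)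

lemma scale_right: "x \<in> S \<Longrightarrow> z \<in> S \<Longrightarrow> B z (c *\<^sub>R x) = c * B z x"
  by (metis scale_left closed(3) sym)

lemma diff_left: "x \<in> S \<Longrightarrow> y \<in> S \<Longrightarrow> z \<in> S \<Longrightarrow> B (x - y) z = B x z - B y z"
  using add_left[of x "(-1) *\<^sub>R y" z] scale_left[of y z "-1"] closed(3)[of y "-1"] by simp

lemma diff_right: "x \<in> S \<Longrightarrow> y \<in> S \<Longrightarrow> z \<in> S \<Longrightarrow> B z (x - y) = B z x - B z y"
  by (metis diff_left closed(4) sym)

lemma zero_left: "x \<in> S \<Longrightarrow> B 0 x = 0"
  using scale_left[of 0 x 0] closed(1) by simp

lemma form_norm_sq: "x \<in> S \<Longrightarrow> (form_norm B x)\<^sup>2 = B x x"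
  by (simp add: form_norm_def nonneg)

lemma form_norm_nonneg: "x \<in> S \<Longrightarrow> 0 \<le> form_norm B x"
  by (simp add: form_norm_def nonneg)

lemma Cauchy_Schwarz_sq:
  assumes "x \<in> S" "y \<in> S"
  shows "(B x y)\<^sup>2 \<le> B x x * B y y"
proof -
  have q: "0 \<le> B x x - 2 * c * B x y + c\<^sup>2 * B y y" for c
  proof -
    have "0 \<le> B (x - c *\<^sub>R y) (x - c *\<^sub>R y)"
      using assms by (intro nonneg closed)
    also have "\<dots> = B x x - 2 * c * B x y + c\<^sup>2 * B y y"
      using assms sym[of x y]
      by (simp add: diff_left diff_right scale_left scale_right closed power2_eq_square algebra_simps)
    finally show ?thesis .
  qed
  show ?thesis
  proof (cases "B y y = 0")
    case True
    have "B x y = 0"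
    proof (rule ccontr)
      assume "B x y \<noteq> 0"
      then show False
        \<comment> \<open>For \<open>B y y = 0\<close> the quadratic in \<open>q\<close> is affine
          in \<open>c\<close>, and this \<open>c\<close> gives it the value -1.\<close>
        using q[of "(B x x + 1) / (2 * B x y)"] True nonneg[OF assms(1)] by simp
    qed
    then show ?thesis using True by simp
  next
    case False
    then have pos: "B y y > 0" using nonneg[OF assms(2)] by simp
    show ?thesis
      using q[of "B x y / B y y"] pos by (simp add: field_simps power2_eq_square)
  qed
qed

lemma Cauchy_Schwarz:
  assumes "x \<in> S" "y \<in> S"
  shows "\<bar>B x y\<bar> \<le> form_norm B x * form_norm B y"
proof -
  have "sqrt ((B x y)\<^sup>2) \<le> sqrt (B x x * B y y)"
    using Cauchy_Schwarz_sq[OF assms] by (rule real_sqrt_le_mono)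
  then show ?thesis by (simp add: form_norm_def real_sqrt_mult)
qed

lemma form_norm_scale: "x \<in> S \<Longrightarrow> form_norm B (c *\<^sub>R x) = \<bar>c\<bar> * form_norm B x"
proof -
  assume "x \<in> S"
  then have "B (c *\<^sub>R x) (c *\<^sub>R x) = c\<^sup>2 * B x x"
    by (simp add: scale_left scale_right closed power2_eq_square)
  then show ?thesis by (simp add: form_norm_def real_sqrt_mult)
qed

lemma form_norm_triangle:
  assumes "x \<in> S" "y \<in> S"
  shows "form_norm B (x + y) \<le> form_norm B x + form_norm B y"
proof (rule power2_le_imp_le)
  have "(form_norm B (x + y))\<^sup>2 = (form_norm B x)\<^sup>2 + 2 * B x y + (form_norm B y)\<^sup>2"
    using assms sym[of x y] by (simp add: form_norm_sq add_left add_right closed)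
  also have "\<dots> \<le> (form_norm B x + form_norm B y)\<^sup>2"
    using Cauchy_Schwarz[OF assms] by (simp add: power2_sum)
  finally show "(form_norm B (x + y))\<^sup>2 \<le> (form_norm B x + form_norm B y)\<^sup>2" .
qed (use assms form_norm_nonneg in auto)

lemma form_norm_minus_commute: "x \<in> S \<Longrightarrow> y \<in> S \<Longrightarrow> form_norm B (x - y) = form_norm B (y - x)"
  using form_norm_scale[of "x - y" "-1"] closed(4)[of x y] by simp

lemma form_norm_triangle_sub:
  assumes "x \<in> S" "y \<in> S"
  shows "\<bar>form_norm B x - form_norm B y\<bar> \<le> form_norm B (x - y)"
  using form_norm_triangle[of "x - y" y] form_norm_triangle[of "y - x" x] assms
    form_norm_minus_commute[OF assms] closed(4)[OF assms] closed(4)[OF assms(2,1)] by simp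

lemma form_norm_add_sq_le:
  assumes "x \<in> S" "y \<in> S"
  shows "B (x + y) (x + y) \<le> 2 * B x x + 2 * B y y"
proof -
  have "0 \<le> B (x - y) (x - y)" using assms by (intro nonneg closed)
  then show ?thesis
    using assms sym[of x y] by (simp add: add_left add_right diff_left diff_right closed)
qed

lemma subset: "subspace T \<Longrightarrow> T \<subseteq> S \<Longrightarrow> psd_form T B"
  by (intro psd_form.intro) (auto simp: add_left scale_left sym nonneg subset_iff)

lemma scaled:
  assumes "0 \<le> k" shows "psd_form S (\<lambda>x y. k * B x y)"
  using assms subspace add_left scale_left sym nonneg
  by (intro psd_form.intro) (auto simp: distrib_left)

end

section \<open>Stability of the saddle point problem\<close>

text \<open>Lagrange's identity: the gap in the squared inequality is the sum of the squares of the
  2 by 2 minors.\<close>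

lemma sum3_Cauchy_Schwarz:
  fixes x1 x2 x3 y1 y2 y3 :: real
  shows "x1 * y1 + x2 * y2 + x3 * y3 \<le> sqrt (x1\<^sup>2 + x2\<^sup>2 + x3\<^sup>2) * sqrt (y1\<^sup>2 + y2\<^sup>2 + y3\<^sup>2)"
proof -
  have "(x1\<^sup>2 + x2\<^sup>2 + x3\<^sup>2) * (y1\<^sup>2 + y2\<^sup>2 + y3\<^sup>2) - (x1 * y1 + x2 * y2 + x3 * y3)\<^sup>2
    = (x1 * y2 - x2 * y1)\<^sup>2 + (x1 * y3 - x3 * y1)\<^sup>2 + (x2 * y3 - x3 * y2)\<^sup>2"
    by (simp add: power2_eq_square algebra_simps)
  also have "\<dots> \<ge> 0" by simp
  finally have "(x1 * y1 + x2 * y2 + x3 * y3)\<^sup>2 \<le> (x1\<^sup>2 + x2\<^sup>2 + x3\<^sup>2) * (y1\<^sup>2 + y2\<^sup>2 + y3\<^sup>2)"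
    by simp
  then have "x1 * y1 + x2 * y2 + x3 * y3 \<le> sqrt ((x1\<^sup>2 + x2\<^sup>2 + x3\<^sup>2) * (y1\<^sup>2 + y2\<^sup>2 + y3\<^sup>2))"
    by (rule real_le_rsqrt)
  then show ?thesis by (simp add: real_sqrt_mult)
qed

text \<open>Shares a weight evenly between two factors, so that Cauchy-Schwarz produces the weighted
  squares occurring in the energy.\<close>

lemma mult_sqrt_split: "0 \<le> k \<Longrightarrow> k * (x * y) = (sqrt k * x) * (sqrt k * y)" for k x y :: real
proof -
  assume "0 \<le> k"
  then have "k * (x * y) = (sqrt k * sqrt k) * (x * y)" by simp
  then show ?thesis by (simp only: mult_ac)
qed

lemma sum2_power2_le:
  fixes a b x y :: real
  shows "(a * x + b * y)\<^sup>2 \<le> (a\<^sup>2 + b\<^sup>2) * (x\<^sup>2 + y\<^sup>2)"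
proof -
  have "(a\<^sup>2 + b\<^sup>2) * (x\<^sup>2 + y\<^sup>2) - (a * x + b * y)\<^sup>2 = (a * y - b * x)\<^sup>2"
    by (simp add: power2_eq_square algebra_simps)
  then show ?thesis by (smt (verit) zero_le_power2)
qed

lemma (in psd_form) two_abs_le:
  assumes "x \<in> S" "y \<in> S"
  shows "2 * \<bar>B x y\<bar> \<le> B x x + B y y"
proof -
  have "0 \<le> B (x + y) (x + y)" "0 \<le> B (x - y) (x - y)" using assms by (auto intro!: nonneg closed)
  then show ?thesis
    using assms sym[of x y] by (simp add: add_left add_right diff_left diff_right closed)
qed

text \<open>Abstracts the error problem. \<open>m\<close> is the plain pairing of pressures and
  \<open>d\<close> the one weighted by Young's modulus, both without their common factor \<kappa>,
  which stands for 1/(\<alpha>\<beta>). \<delta> bounds the divergence and becomes the square root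
  of the dimension. The norm of \<open>a0\<close> contains the square root of \<alpha>, which is
  compensated on the left of \<open>b_bound\<close>.\<close>

locale saddle_point =
  A: psd_form V a + A0: psd_form V a0 + M: psd_form W m + D: psd_form W d
  for V :: "'v::real_vector set" and a a0 and W :: "'w::real_vector set" and m d +
  fixes b :: "'v \<Rightarrow> 'w \<Rightarrow> real" and \<alpha> \<kappa> Emin Emax CK \<delta> :: real
  assumes b_add_left: "v \<in> V \<Longrightarrow> v' \<in> V \<Longrightarrow> q \<in> W \<Longrightarrow> b (v + v') q = b v q + b v' q"
    and b_scale_left: "v \<in> V \<Longrightarrow> q \<in> W \<Longrightarrow> b (r *\<^sub>R v) q = r * b v q"
    and b_scale_right: "v \<in> V \<Longrightarrow> q \<in> W \<Longrightarrow> b v (r *\<^sub>R q) = r * b v q"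
    and b_bound: "v \<in> V \<Longrightarrow> q \<in> W \<Longrightarrow> \<bar>b v q\<bar> * sqrt \<alpha> \<le> \<delta> * form_norm a0 v * form_norm m q"
    and constants: "0 < \<alpha>" "0 < \<kappa>" "0 < Emin" "Emin \<le> Emax" "0 < CK" "CK \<le> 1" "1 \<le> \<delta>"
    and a_lower: "v \<in> V \<Longrightarrow> Emin * CK * a0 v v \<le> a v v"
    and a_upper: "v \<in> V \<Longrightarrow> a v v \<le> Emax * a0 v v"
    and d_lower: "q \<in> W \<Longrightarrow> Emin * m q q \<le> d q q"
    and d_upper: "q \<in> W \<Longrightarrow> d q q \<le> Emax * m q q"
begin

text \<open>This is the square of the triple norm, see \<open>triple_norm_eq\<close>.\<close>

definition energy :: "'v \<Rightarrow> 'w \<Rightarrow> 'w \<Rightarrow> real" where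
  "energy v q q' = a0 v v + (1 / \<alpha> + \<kappa>) * m q q + \<kappa> * m q' q'"

lemma energy_nonneg: "v \<in> V \<Longrightarrow> q \<in> W \<Longrightarrow> q' \<in> W \<Longrightarrow> 0 \<le> energy v q q'"
  using constants by (auto simp: energy_def intro!: add_nonneg_nonneg mult_nonneg_nonneg A0.nonneg M.nonneg)

text \<open>Cauchy-Schwarz for \<open>a\<close> itself turns the bound \<open>a_upper\<close> on the
  diagonal into one on all pairs.\<close>

lemma a_abs_le:
  assumes "v \<in> V" "v' \<in> V"
  shows "\<bar>a v v'\<bar> \<le> Emax * form_norm a0 v * form_norm a0 v'"
proof -
  have "form_norm a w \<le> sqrt Emax * form_norm a0 w" if "w \<in> V" for w
    using a_upper[OF that] by (simp add: form_norm_def flip: real_sqrt_mult)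
  then have "\<bar>a v v'\<bar> \<le> (sqrt Emax * form_norm a0 v) * (sqrt Emax * form_norm a0 v')"
    using assms constants
    by (intro order_trans[OF A.Cauchy_Schwarz] mult_mono)
       (auto intro!: mult_nonneg_nonneg A.form_norm_nonneg A0.form_norm_nonneg)
  also have "\<dots> = (sqrt Emax * sqrt Emax) * form_norm a0 v * form_norm a0 v'" by (simp only: mult_ac)
  finally show ?thesis using constants by simp
qed

lemma d_abs_le:
  assumes "q \<in> W" "q' \<in> W"
  shows "\<bar>d q q'\<bar> \<le> Emax * form_norm m q * form_norm m q'"
proof -
  have "form_norm d w \<le> sqrt Emax * form_norm m w" if "w \<in> W" for w
    using d_upper[OF that] by (simp add: form_norm_def flip: real_sqrt_mult)
  then have "\<bar>d q q'\<bar> \<le> (sqrt Emax * form_norm m q) * (sqrt Emax * form_norm m q')"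
    using assms constants
    by (intro order_trans[OF D.Cauchy_Schwarz] mult_mono)
       (auto intro!: mult_nonneg_nonneg D.form_norm_nonneg M.form_norm_nonneg)
  also have "\<dots> = (sqrt Emax * sqrt Emax) * form_norm m q * form_norm m q'" by (simp only: mult_ac)
  finally show ?thesis using constants by simp
qed

section \<open>The error and the representers of its residuals bound each other\<close>

context
  fixes eu r :: 'v and ep ept s t :: 'w
  assumes mem: "eu \<in> V" "r \<in> V" "ep \<in> W" "ept \<in> W" "s \<in> W" "t \<in> W"
    and eq_u: "\<And>v. v \<in> V \<Longrightarrow> a eu v + b v ep = a0 r v"
    and eq_p: "\<And>q. q \<in> W \<Longrightarrow> b eu q - \<kappa> * m ept q = (1 / \<alpha> + \<kappa>) * m s q"
    and eq_pt: "\<And>q. q \<in> W \<Longrightarrow> - \<kappa> * m ep q + \<kappa> * d ept q = \<kappa> * m t q"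
begin

text \<open>In the sum of the bounds \<rho>, \<sigma>, \<tau> every part of the error energy occurs
  at most twice, each time with a coefficient of at most \<open>K\<^sup>2\<close>; the factor 3
  covers this.\<close>

lemma residual_le_error:
  defines "K \<equiv> max (Emax + \<delta>) (1 + \<delta>)"
  shows "energy r s t \<le> 3 * K\<^sup>2 * energy eu ep ept"
proof -
  let ?X = "form_norm a0 eu" and ?\<rho> = "form_norm a0 r" and ?n = "form_norm m ep"
    and ?y = "form_norm m ept" and ?\<sigma> = "form_norm m s" and ?\<tau> = "form_norm m t"
  note nn = A0.form_norm_nonneg[OF mem(1)] A0.form_norm_nonneg[OF mem(2)]
    M.form_norm_nonneg[OF mem(3)] M.form_norm_nonneg[OF mem(4)]
    M.form_norm_nonneg[OF mem(5)] M.form_norm_nonneg[OF mem(6)]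
  have Emax: "0 < Emax" using constants by linarith
  have K: "Emax + \<delta> \<le> K" "1 + \<delta> \<le> K" by (auto simp: K_def)
  have \<rho>: "?\<rho>\<^sup>2 \<le> (Emax\<^sup>2 + \<delta>\<^sup>2) * (?X\<^sup>2 + ?n\<^sup>2 / \<alpha>)"
  proof -
    have "?\<rho>\<^sup>2 = a eu r + b r ep" using eq_u[OF mem(2)] mem by (simp add: A0.form_norm_sq)
    also have "\<dots> \<le> Emax * ?X * ?\<rho> + \<delta> * ?\<rho> * ?n / sqrt \<alpha>"
    proof (rule add_mono)
      have "b r ep * sqrt \<alpha> \<le> \<bar>b r ep\<bar> * sqrt \<alpha>" using constants by (intro mult_right_mono) auto
      then show "b r ep \<le> \<delta> * ?\<rho> * ?n / sqrt \<alpha>"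
        using order_trans[OF _ b_bound[OF mem(2,3)]] constants by (simp add: pos_le_divide_eq)
    qed (use a_abs_le[OF mem(1,2)] in linarith)
    also have "\<dots> = (Emax * ?X + \<delta> * (?n / sqrt \<alpha>)) * ?\<rho>" by (simp add: algebra_simps)
    finally have "?\<rho> * ?\<rho> \<le> (Emax * ?X + \<delta> * (?n / sqrt \<alpha>)) * ?\<rho>" by (simp add: power2_eq_square)
    then have "?\<rho> \<le> Emax * ?X + \<delta> * (?n / sqrt \<alpha>)"
      using nn constants Emax by (cases "?\<rho> = 0") (auto intro!: add_nonneg_nonneg mult_nonneg_nonneg)
    then have "?\<rho>\<^sup>2 \<le> (Emax * ?X + \<delta> * (?n / sqrt \<alpha>))\<^sup>2" using nn by (intro power_mono)
    also note sum2_power2_le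
    finally show ?thesis using constants by (simp add: power_divide)
  qed
  have \<sigma>: "(1 / \<alpha> + \<kappa>) * ?\<sigma>\<^sup>2 \<le> \<delta>\<^sup>2 * ?X\<^sup>2 + \<kappa> * ?y\<^sup>2"
  proof -
    let ?k = "1 / \<alpha> + \<kappa>"
    have k: "?k > 0" using constants by (simp add: add_pos_pos)
    have "?k * ?\<sigma>\<^sup>2 = b eu s - \<kappa> * m ept s" using eq_p[OF mem(5)] mem by (simp add: M.form_norm_sq)
    also have "\<dots> \<le> \<bar>b eu s\<bar> + \<kappa> * \<bar>m ept s\<bar>"
      using constants mult_left_mono[of "- m ept s" "\<bar>m ept s\<bar>" \<kappa>] abs_ge_self[of "b eu s"]
        abs_ge_minus_self[of "m ept s"] by simp
    also have "\<dots> \<le> \<delta> * ?X * ?\<sigma> / sqrt \<alpha> + \<kappa> * (?y * ?\<sigma>)"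
      using b_bound[OF mem(1,5)] M.Cauchy_Schwarz[OF mem(4,5)] constants
      by (intro add_mono mult_left_mono) (auto simp: pos_le_divide_eq)
    \<comment> \<open>The squares of the weights \<open>1 / sqrt \<alpha>\<close> and
      \<open>sqrt \<kappa>\<close> add up to \<open>?k\<close>; after squaring, one copy of
      \<open>?k\<close> therefore cancels.\<close>
    also have "\<dots> = ((1 / sqrt \<alpha>) * (\<delta> * ?X) + sqrt \<kappa> * (sqrt \<kappa> * ?y)) * ?\<sigma>"
      using mult_sqrt_split[of \<kappa> ?y ?\<sigma>] constants by (simp add: algebra_simps)
    finally have "?k * ?\<sigma> * ?\<sigma> \<le> ((1 / sqrt \<alpha>) * (\<delta> * ?X) + sqrt \<kappa> * (sqrt \<kappa> * ?y)) * ?\<sigma>"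
      by (simp add: power2_eq_square)
    then have "?k * ?\<sigma> \<le> (1 / sqrt \<alpha>) * (\<delta> * ?X) + sqrt \<kappa> * (sqrt \<kappa> * ?y)"
      using nn constants by (cases "?\<sigma> = 0") (auto intro!: add_nonneg_nonneg mult_nonneg_nonneg)
    then have "(?k * ?\<sigma>)\<^sup>2 \<le> ((1 / sqrt \<alpha>) * (\<delta> * ?X) + sqrt \<kappa> * (sqrt \<kappa> * ?y))\<^sup>2"
      using nn k by (intro power_mono mult_nonneg_nonneg) auto
    also have "\<dots> \<le> ((1 / sqrt \<alpha>)\<^sup>2 + (sqrt \<kappa>)\<^sup>2) * ((\<delta> * ?X)\<^sup>2 + (sqrt \<kappa> * ?y)\<^sup>2)"
      by (rule sum2_power2_le)
    also have "\<dots> = ?k * (\<delta>\<^sup>2 * ?X\<^sup>2 + \<kappa> * ?y\<^sup>2)"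
      using constants by (simp add: power_divide power_mult_distrib)
    finally have "?k * (?k * ?\<sigma>\<^sup>2) \<le> ?k * (\<delta>\<^sup>2 * ?X\<^sup>2 + \<kappa> * ?y\<^sup>2)"
      by (simp add: power2_eq_square mult_ac)
    then show ?thesis using k by simp
  qed
  have \<tau>: "?\<tau>\<^sup>2 \<le> (1 + Emax\<^sup>2) * (?n\<^sup>2 + ?y\<^sup>2)"
  proof -
    have "\<kappa> * ?\<tau>\<^sup>2 = \<kappa> * (- m ep t + d ept t)"
      using eq_pt[OF mem(6)] mem by (simp add: M.form_norm_sq algebra_simps)
    then have "?\<tau>\<^sup>2 = - m ep t + d ept t" using constants by simp
    also have "\<dots> \<le> ?n * ?\<tau> + Emax * ?y * ?\<tau>"
      using M.Cauchy_Schwarz[OF mem(3,6)] d_abs_le[OF mem(4,6)] by linarith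
    finally have "?\<tau> * ?\<tau> \<le> (?n + Emax * ?y) * ?\<tau>" by (simp add: power2_eq_square algebra_simps)
    then have "?\<tau> \<le> 1 * ?n + Emax * ?y"
      using nn Emax by (cases "?\<tau> = 0") (auto intro!: add_nonneg_nonneg mult_nonneg_nonneg)
    then have "?\<tau>\<^sup>2 \<le> (1 * ?n + Emax * ?y)\<^sup>2" using nn by (intro power_mono)
    also note sum2_power2_le
    finally show ?thesis by simp
  qed
  have sq: "(Emax + \<delta>)\<^sup>2 \<le> K\<^sup>2" "(1 + \<delta>)\<^sup>2 \<le> K\<^sup>2" "(Emax + 1)\<^sup>2 \<le> K\<^sup>2"
    using K Emax constants by (auto intro!: power_mono)
  have pos: "0 \<le> Emax * \<delta>" "1 \<le> \<delta>\<^sup>2" using Emax constants by (auto simp: one_le_power)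
  have c: "Emax\<^sup>2 + \<delta>\<^sup>2 \<le> K\<^sup>2" "\<delta>\<^sup>2 \<le> K\<^sup>2" "1 + Emax\<^sup>2 \<le> K\<^sup>2" "1 \<le> K\<^sup>2"
    using sq pos Emax zero_le_power2[of Emax] unfolding power2_sum power_one by linarith+
  have "energy r s t = ?\<rho>\<^sup>2 + (1 / \<alpha> + \<kappa>) * ?\<sigma>\<^sup>2 + \<kappa> * ?\<tau>\<^sup>2"
    using mem by (simp add: energy_def A0.form_norm_sq M.form_norm_sq)
  also have "\<dots> \<le> (Emax\<^sup>2 + \<delta>\<^sup>2) * (?X\<^sup>2 + ?n\<^sup>2 / \<alpha>) + (\<delta>\<^sup>2 * ?X\<^sup>2 + \<kappa> * ?y\<^sup>2)
      + \<kappa> * ((1 + Emax\<^sup>2) * (?n\<^sup>2 + ?y\<^sup>2))"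
    using \<rho> \<sigma> \<tau> constants by (intro add_mono mult_left_mono) auto
  also have "\<dots> \<le> K\<^sup>2 * (?X\<^sup>2 + ?n\<^sup>2 / \<alpha>) + (K\<^sup>2 * ?X\<^sup>2 + \<kappa> * (K\<^sup>2 * ?y\<^sup>2))
      + \<kappa> * (K\<^sup>2 * (?n\<^sup>2 + ?y\<^sup>2))"
    using c constants mult_right_mono[OF c(4), of "?y\<^sup>2"] by (intro add_mono mult_left_mono mult_right_mono) auto
  also have "\<dots> \<le> 3 * K\<^sup>2 * (?X\<^sup>2 + (1 / \<alpha> + \<kappa>) * ?n\<^sup>2 + \<kappa> * ?y\<^sup>2)"
  proof -
    have "0 \<le> K\<^sup>2 * ?X\<^sup>2" "0 \<le> K\<^sup>2 * ?n\<^sup>2 / \<alpha>" "0 \<le> K\<^sup>2 * \<kappa> * ?n\<^sup>2" "0 \<le> K\<^sup>2 * \<kappa> * ?y\<^sup>2"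
      using constants by auto
    then have "2 * (K\<^sup>2 * ?X\<^sup>2) + K\<^sup>2 * ?n\<^sup>2 / \<alpha> + K\<^sup>2 * \<kappa> * ?n\<^sup>2 + 2 * (K\<^sup>2 * \<kappa> * ?y\<^sup>2)
      \<le> 3 * (K\<^sup>2 * ?X\<^sup>2) + 3 * (K\<^sup>2 * ?n\<^sup>2 / \<alpha>) + 3 * (K\<^sup>2 * \<kappa> * ?n\<^sup>2) + 3 * (K\<^sup>2 * \<kappa> * ?y\<^sup>2)"
      by linarith
    moreover have "3 * K\<^sup>2 * (?X\<^sup>2 + (1 / \<alpha> + \<kappa>) * ?n\<^sup>2 + \<kappa> * ?y\<^sup>2)
      = 3 * (K\<^sup>2 * ?X\<^sup>2) + 3 * (K\<^sup>2 * ?n\<^sup>2 / \<alpha>) + 3 * (K\<^sup>2 * \<kappa> * ?n\<^sup>2) + 3 * (K\<^sup>2 * \<kappa> * ?y\<^sup>2)"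
      by (simp add: algebra_simps)
    moreover have "K\<^sup>2 * (?X\<^sup>2 + ?n\<^sup>2 / \<alpha>) + (K\<^sup>2 * ?X\<^sup>2 + \<kappa> * (K\<^sup>2 * ?y\<^sup>2)) + \<kappa> * (K\<^sup>2 * (?n\<^sup>2 + ?y\<^sup>2))
      = 2 * (K\<^sup>2 * ?X\<^sup>2) + K\<^sup>2 * ?n\<^sup>2 / \<alpha> + K\<^sup>2 * \<kappa> * ?n\<^sup>2 + 2 * (K\<^sup>2 * \<kappa> * ?y\<^sup>2)"
      by (simp add: algebra_simps)
    ultimately show ?thesis by (simp only:)
  qed
  also have "\<dots> = 3 * K\<^sup>2 * energy eu ep ept"
    using mem by (simp add: energy_def A0.form_norm_sq M.form_norm_sq)
  finally show ?thesis .
qed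

text \<open>The hypothesis \<open>inf_sup\<close> speaks of every \<theta> below 1 because a
  supremum need not be attained. In \<open>lower\<close>, the shift \<open>w\<close> is responsible
  for the part \<open>m ep ep / \<alpha>\<close> of the energy and the shift of \<open>ept\<close>
  for the part \<open>\<kappa> * m ep ep\<close>; the other two parts come from coercivity of
  \<open>a\<close> and \<open>d\<close>.\<close>

lemma error_le_residual:
  assumes CD: "0 < CD"
    and inf_sup: "\<And>q \<theta>. q \<in> W \<Longrightarrow> 0 < \<theta> \<Longrightarrow> \<theta> < 1 \<Longrightarrow>
      \<exists>w\<in>V. form_norm a0 w = form_norm m q \<and> \<theta> * CD * (form_norm m q)\<^sup>2 \<le> b w q * sqrt \<alpha>"
  defines "C1 \<equiv> 1 / 2 * Min {CK, CD\<^sup>2 / Emax\<^sup>2, 1 / Emax\<^sup>2}"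
    and "C2 \<equiv> sqrt (2 * (Emax\<^sup>2 + CD\<^sup>2 + 1)) / Emax"
  shows "sqrt (energy eu ep ept) \<le> C2 / (C1 * Emin) * sqrt (energy r s t)"
proof -
  let ?N = "sqrt (energy eu ep ept)" and ?R = "sqrt (energy r s t)"
  let ?X = "a0 eu eu" and ?n = "m ep ep" and ?y = "m ept ept"
  have Emax: "0 < Emax" using constants by linarith
  have nn: "0 \<le> ?X" "0 \<le> ?n" "0 \<le> ?y" using mem A0.nonneg M.nonneg by auto
  have C1: "C1 \<le> CK / 2" "C1 \<le> CD\<^sup>2 / Emax\<^sup>2 / 2" "C1 \<le> 1 / Emax\<^sup>2 / 2" "0 < C1"
    using constants CD Emax by (auto simp: C1_def)
  have C2: "0 \<le> C2" "C2\<^sup>2 = 2 + 2 * CD\<^sup>2 / Emax\<^sup>2 + 2 / Emax\<^sup>2"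
    using Emax by (auto simp: C2_def power_divide field_simps)
  have N: "?N\<^sup>2 = energy eu ep ept" "0 \<le> ?N" "0 \<le> ?R"
    using energy_nonneg[OF mem(1,3,4)] energy_nonneg[OF mem(2,5,6)] by auto
  have step: "\<theta>\<^sup>2 * ?N \<le> C2 / (C1 * Emin) * ?R" if \<theta>: "0 < \<theta>" "\<theta> < 1" for \<theta>
  proof -
    have \<theta>2: "0 \<le> \<theta>\<^sup>2" "\<theta>\<^sup>2 \<le> 1" using \<theta> by (auto simp: power_le_one)
    \<comment> \<open>Only the part \<open>m ep ep / \<alpha>\<close> really loses the factor
      \<open>\<theta>\<^sup>2\<close>; the others are weakened by it so that all parts carry the
      same factor.\<close>
    have \<theta>le: "\<theta>\<^sup>2 * z \<le> z" if "0 \<le> z" for z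
      using mult_right_mono[OF \<theta>2(2) that] by simp
    obtain w0 where w0: "w0 \<in> V" "form_norm a0 w0 = form_norm m ep"
      "\<theta> * CD * (form_norm m ep)\<^sup>2 \<le> b w0 ep * sqrt \<alpha>"
      using inf_sup[OF mem(3) \<theta>] by blast
    \<comment> \<open>The optimal step length: it maximises
      \<open>k * \<theta> * CD / sqrt \<alpha> - Emax * k\<^sup>2 / 2\<close>, the guaranteed gain
      from \<open>b w ep\<close> minus the bound for half of \<open>a w w\<close>, which is spent on
      the mixed term \<open>a eu w\<close>.\<close>
    define k where "k = \<theta> * CD / (Emax * sqrt \<alpha>)"
    define w where "w = k *\<^sub>R w0"
    define v where "v = eu + w"
    \<comment> \<open>The sign of \<open>q\<close> cancels both couplings, through
      \<open>b eu ep\<close> and through \<open>m ep ept\<close>. The shift in \<open>q'\<close>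
      produces \<open>\<kappa> * m ep ep / Emax\<close>; its cost, a multiple of
      \<open>d ept ep\<close>, is absorbed by \<open>dd\<close>.\<close>
    define q where "q = (-1) *\<^sub>R ep"
    define q' where "q' = ept - (1 / Emax) *\<^sub>R ep"
    have V: "w \<in> V" "v \<in> V" "q \<in> W" "q' \<in> W"
      using w0 mem unfolding w_def v_def q_def q'_def by (blast intro: A.closed M.closed)+
    have k: "0 \<le> k" "k\<^sup>2 = \<theta>\<^sup>2 * CD\<^sup>2 / (Emax\<^sup>2 * \<alpha>)"
      using \<theta> CD Emax constants by (auto simp: k_def power_divide power_mult_distrib)
    have ww: "a0 w w = k\<^sup>2 * ?n"
      using w0 mem A0.form_norm_sq[of w0] M.form_norm_sq[of ep]
      by (simp add: w_def A0.scale_left A0.scale_right A0.closed power2_eq_square)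
    have bw: "\<theta>\<^sup>2 * CD\<^sup>2 / (Emax * \<alpha>) * ?n \<le> b w ep"
    proof -
      have "k * (\<theta> * CD * ?n) \<le> k * (b w0 ep * sqrt \<alpha>)"
        using w0(3) mem k by (intro mult_left_mono) (auto simp: M.form_norm_sq)
      then have "k * (\<theta> * CD * ?n) / sqrt \<alpha> \<le> b w ep"
        using w0(1) mem constants by (simp add: w_def b_scale_left pos_divide_le_eq)
      also have "k * (\<theta> * CD * ?n) / sqrt \<alpha> = \<theta>\<^sup>2 * CD\<^sup>2 / (Emax * \<alpha>) * ?n"
      proof -
        have "Emax * sqrt \<alpha> * sqrt \<alpha> = Emax * \<alpha>" using constants by (simp add: mult.assoc)
        moreover have "k * (\<theta> * CD * ?n) / sqrt \<alpha> = \<theta> * \<theta> * (CD * CD) * ?n / (Emax * sqrt \<alpha> * sqrt \<alpha>)"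
          by (simp add: k_def)
        ultimately show ?thesis by (simp only: power2_eq_square times_divide_eq_left)
      qed
      finally show ?thesis .
    qed
    have aw: "- a eu w \<le> a eu eu / 2 + \<theta>\<^sup>2 * CD\<^sup>2 / (Emax * \<alpha>) / 2 * ?n"
    proof -
      have "2 * (- a eu w) \<le> a eu eu + a w w" using A.two_abs_le[OF mem(1) V(1)] by linarith
      also have "a w w \<le> Emax * (k\<^sup>2 * ?n)" using a_upper[OF V(1)] ww by simp
      also have "\<dots> = \<theta>\<^sup>2 * CD\<^sup>2 / (Emax * \<alpha>) * ?n"
        unfolding k(2) using Emax by (simp add: power2_eq_square)
      finally show ?thesis by simp
    qed
    have dd: "d ept ep / Emax \<le> d ept ept / 2 + ?n / Emax / 2"
    proof -
      have "2 * \<bar>d ept ((1 / Emax) *\<^sub>R ep)\<bar> \<le> d ept ept + d ((1 / Emax) *\<^sub>R ep) ((1 / Emax) *\<^sub>R ep)"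
        using mem by (intro D.two_abs_le D.closed)
      also have "d ((1 / Emax) *\<^sub>R ep) ((1 / Emax) *\<^sub>R ep) = d ep ep / Emax\<^sup>2"
        using mem by (simp add: D.scale_left D.scale_right D.closed power2_eq_square)
      also have "\<dots> \<le> Emax * ?n / Emax\<^sup>2" using d_upper[OF mem(3)] by (intro divide_right_mono) auto
      also have "\<dots> = ?n / Emax" using Emax by (simp add: power2_eq_square)
      finally have "2 * \<bar>d ept ((1 / Emax) *\<^sub>R ep)\<bar> \<le> d ept ept + ?n / Emax" by simp
      moreover have "z \<le> p / 2 + q / 2" if "2 * \<bar>z\<bar> \<le> p + q" for z p q :: real using that by linarith
      moreover have "d ept ((1 / Emax) *\<^sub>R ep) = d ept ep / Emax" using mem by (simp add: D.scale_right)
      ultimately show ?thesis by metis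
    qed
    have lower: "\<theta>\<^sup>2 * (Emin * C1 * energy eu ep ept)
      \<le> a0 r v + (1 / \<alpha> + \<kappa>) * m s q + \<kappa> * m t q'"
    proof -
      have "a0 r v + (1 / \<alpha> + \<kappa>) * m s q + \<kappa> * m t q' =
        (a eu v + b v ep) + (b eu q - \<kappa> * m ept q) + (- \<kappa> * m ep q' + \<kappa> * d ept q')"
        by (simp only: eq_u[OF V(2)] eq_p[OF V(3)] eq_pt[OF V(4)])
      also have "\<dots> = a eu eu + a eu w + b w ep + \<kappa> * (?n / Emax + d ept ept - d ept ep / Emax)"
        using mem V(1) M.sym[OF mem(3,4)] b_scale_right[OF mem(1,3), of "-1"] M.scale_right[OF mem(3,4), of "-1"]
        unfolding v_def q_def q'_def
        by (simp add: A.add_right b_add_left b_scale_right M.scale_right M.diff_right D.diff_right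
            D.scale_right M.closed D.closed algebra_simps)
      also have "\<dots> \<ge> a eu eu / 2 + \<theta>\<^sup>2 * CD\<^sup>2 / (Emax * \<alpha>) / 2 * ?n
          + \<kappa> * (?n / Emax / 2 + d ept ept / 2)"
      proof -
        have "\<kappa> * (?n / Emax / 2 + d ept ept / 2) \<le> \<kappa> * (?n / Emax + d ept ept - d ept ep / Emax)"
          using dd constants by (intro mult_left_mono) auto
        then show ?thesis using aw bw by simp
      qed
      finally have 1: "a eu eu / 2 + \<theta>\<^sup>2 * CD\<^sup>2 / (Emax * \<alpha>) / 2 * ?n
          + \<kappa> * (?n / Emax / 2 + d ept ept / 2) \<le> a0 r v + (1 / \<alpha> + \<kappa>) * m s q + \<kappa> * m t q'" .
      \<comment> \<open>The estimate yields \<open>1 / Emax\<close> where \<open>C1\<close> contains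
        \<open>1 / Emax\<^sup>2\<close>; the factor \<open>Emin\<close>, at most
        \<open>Emax\<close>, bridges the two.\<close>
      have EE: "Emin / Emax\<^sup>2 \<le> 1 / Emax"
        using constants Emax by (simp add: power2_eq_square divide_simps)
      have "Emin * C1 * ?X \<le> Emin * (CK / 2) * ?X"
        using C1 constants nn by (intro mult_right_mono mult_left_mono) auto
      also have "\<dots> \<le> a eu eu / 2" using a_lower[OF mem(1)] by simp
      finally have x: "\<theta>\<^sup>2 * (Emin * C1 * ?X) \<le> a eu eu / 2"
        by (rule order_trans[OF \<theta>le, rotated]) (use nn C1 constants in auto)
      have "Emin * C1 \<le> Emin * (CD\<^sup>2 / Emax\<^sup>2 / 2)"
        using C1 constants by (intro mult_left_mono) auto
      also have "\<dots> = Emin / Emax\<^sup>2 * (CD\<^sup>2 / 2)" by simp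
      also have "\<dots> \<le> 1 / Emax * (CD\<^sup>2 / 2)" using EE by (intro mult_right_mono) auto
      finally have "\<theta>\<^sup>2 / \<alpha> * ?n * (Emin * C1) \<le> \<theta>\<^sup>2 / \<alpha> * ?n * (1 / Emax * (CD\<^sup>2 / 2))"
        using nn constants by (intro mult_left_mono) auto
      then have n1: "\<theta>\<^sup>2 * (Emin * C1 * (?n / \<alpha>)) \<le> \<theta>\<^sup>2 * CD\<^sup>2 / (Emax * \<alpha>) / 2 * ?n"
        by (simp add: mult_ac)
      have "Emin * C1 \<le> Emin * (1 / Emax\<^sup>2 / 2)"
        using C1 constants by (intro mult_left_mono) auto
      also have "\<dots> \<le> 1 / Emax / 2" using EE by simp
      finally have "\<kappa> * ?n * (Emin * C1) \<le> \<kappa> * ?n * (1 / Emax / 2)"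
        using nn constants by (intro mult_left_mono) auto
      then have "Emin * C1 * (\<kappa> * ?n) \<le> \<kappa> * (?n / Emax / 2)" by (simp add: mult_ac)
      then have n2: "\<theta>\<^sup>2 * (Emin * C1 * (\<kappa> * ?n)) \<le> \<kappa> * (?n / Emax / 2)"
        by (rule order_trans[OF \<theta>le, rotated]) (use nn C1 constants in auto)
      \<comment> \<open>\<open>C1\<close> is at most 1/2 because \<open>CK\<close> is at most
        1.\<close>
      have "Emin * C1 * ?y \<le> Emin * (1 / 2) * ?y"
        using C1 constants nn by (intro mult_right_mono mult_left_mono) auto
      also have "\<dots> \<le> d ept ept / 2" using d_lower[OF mem(4)] by simp
      finally have "\<kappa> * (Emin * C1 * ?y) \<le> \<kappa> * (d ept ept / 2)"
        using constants by (intro mult_left_mono) auto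
      then have "Emin * C1 * (\<kappa> * ?y) \<le> \<kappa> * (d ept ept / 2)" by (simp add: mult_ac)
      then have y: "\<theta>\<^sup>2 * (Emin * C1 * (\<kappa> * ?y)) \<le> \<kappa> * (d ept ept / 2)"
        by (rule order_trans[OF \<theta>le, rotated]) (use nn C1 constants in auto)
      have "\<theta>\<^sup>2 * (Emin * C1 * energy eu ep ept) = \<theta>\<^sup>2 * (Emin * C1 * ?X)
          + \<theta>\<^sup>2 * (Emin * C1 * (?n / \<alpha>)) + \<theta>\<^sup>2 * (Emin * C1 * (\<kappa> * ?n)) + \<theta>\<^sup>2 * (Emin * C1 * (\<kappa> * ?y))"
        by (simp add: energy_def algebra_simps)
      with 1 x n1 n2 y show ?thesis by (simp add: distrib_left)
    qed
    have upper: "a0 r v + (1 / \<alpha> + \<kappa>) * m s q + \<kappa> * m t q' \<le> ?R * sqrt (energy v q q')"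
    proof -
      let ?k = "1 / \<alpha> + \<kappa>"
      have kpos: "0 \<le> ?k" using constants by auto
      have "a0 r v \<le> form_norm a0 r * form_norm a0 v"
        using A0.Cauchy_Schwarz[OF mem(2) V(2)] by linarith
      moreover have "?k * m s q \<le> ?k * (form_norm m s * form_norm m q)"
        using M.Cauchy_Schwarz[OF mem(5) V(3)] kpos by (intro mult_left_mono) auto
      moreover have "\<kappa> * m t q' \<le> \<kappa> * (form_norm m t * form_norm m q')"
        using M.Cauchy_Schwarz[OF mem(6) V(4)] constants by (intro mult_left_mono) auto
      ultimately have "a0 r v + ?k * m s q + \<kappa> * m t q' \<le> form_norm a0 r * form_norm a0 v
          + (sqrt ?k * form_norm m s) * (sqrt ?k * form_norm m q)
          + (sqrt \<kappa> * form_norm m t) * (sqrt \<kappa> * form_norm m q')"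
        using mult_sqrt_split[OF kpos] mult_sqrt_split[of \<kappa>] constants by simp
      also note sum3_Cauchy_Schwarz
      finally show ?thesis
        using mem V kpos constants
        by (simp add: energy_def power_mult_distrib A0.form_norm_sq M.form_norm_sq)
    qed
    \<comment> \<open>\<open>C2\<^sup>2\<close> is made of a 2 for splitting the two shifted
      components and twice the squares of \<open>CD / Emax\<close> and \<open>1 / Emax\<close>, the
      sizes of the shifts.\<close>
    have test: "energy v q q' \<le> C2\<^sup>2 * energy eu ep ept"
    proof -
      have v: "a0 v v \<le> 2 * ?X + 2 * CD\<^sup>2 / Emax\<^sup>2 * (?n / \<alpha>)"
      proof -
        have "a0 v v \<le> 2 * ?X + 2 * (k\<^sup>2 * ?n)"
          using A0.form_norm_add_sq_le[OF mem(1) V(1)] ww by (simp add: v_def)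
        also have "k\<^sup>2 * ?n = \<theta>\<^sup>2 * (CD\<^sup>2 / Emax\<^sup>2 * (?n / \<alpha>))" by (simp add: k)
        also have "\<dots> \<le> CD\<^sup>2 / Emax\<^sup>2 * (?n / \<alpha>)"
          using nn constants by (intro \<theta>le) auto
        finally show ?thesis by simp
      qed
      have q: "m q q = ?n" 
        using M.scale_left[OF mem(3) M.closed(3)[OF mem(3)], of "-1" "-1"] M.scale_right[OF mem(3,3), of "-1"]
        by (simp add: q_def)
      have q': "m q' q' \<le> 2 * ?y + 2 / Emax\<^sup>2 * ?n"
      proof -
        define c where "c = - 1 / Emax"
        have "m q' q' = m (ept + c *\<^sub>R ep) (ept + c *\<^sub>R ep)" by (simp add: q'_def c_def)
        also have "\<dots> \<le> 2 * ?y + 2 * m (c *\<^sub>R ep) (c *\<^sub>R ep)"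
          using mem by (intro M.form_norm_add_sq_le M.closed)
        also have "m (c *\<^sub>R ep) (c *\<^sub>R ep) = c\<^sup>2 * ?n"
          using mem by (simp add: M.scale_left M.scale_right M.closed power2_eq_square)
        finally show ?thesis by (simp add: c_def power_divide)
      qed
      have "energy v q q' \<le> 2 * ?X + 2 * CD\<^sup>2 / Emax\<^sup>2 * (?n / \<alpha>) + (1 / \<alpha> + \<kappa>) * ?n
          + \<kappa> * (2 * ?y + 2 / Emax\<^sup>2 * ?n)"
        unfolding energy_def q using v q' constants by (intro add_mono mult_left_mono) auto
      also have "\<dots> \<le> C2\<^sup>2 * energy eu ep ept"
      proof -
        let ?u = "CD\<^sup>2 / Emax\<^sup>2" and ?w = "1 / Emax\<^sup>2"
        have pos: "0 \<le> ?u" "0 \<le> ?w" "0 \<le> ?n / \<alpha>" "0 \<le> \<kappa> * ?n" "0 \<le> \<kappa> * ?y" using nn constants by auto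
        have "C2\<^sup>2 * energy eu ep ept - (2 * ?X + 2 * CD\<^sup>2 / Emax\<^sup>2 * (?n / \<alpha>) + (1 / \<alpha> + \<kappa>) * ?n
          + \<kappa> * (2 * ?y + 2 / Emax\<^sup>2 * ?n)) =
          2 * (?u * ?X) + 2 * (?w * ?X) + ?n / \<alpha> + 2 * (?w * (?n / \<alpha>)) + \<kappa> * ?n + 2 * (?u * (\<kappa> * ?n))
          + 2 * (?u * (\<kappa> * ?y)) + 2 * (?w * (\<kappa> * ?y))"
          unfolding C2(2) energy_def by (simp add: algebra_simps add_divide_distrib)
        also have "\<dots> \<ge> 0" using pos nn constants by (intro add_nonneg_nonneg mult_nonneg_nonneg) auto
        finally show ?thesis by simp
      qed
      finally show ?thesis .
    qed
    then have "sqrt (energy v q q') \<le> C2 * ?N"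
      using C2(1) real_sqrt_le_mono[OF test] by (simp add: real_sqrt_mult)
    then have "?R * sqrt (energy v q q') \<le> ?R * (C2 * ?N)" using N by (intro mult_left_mono) auto
    then have "\<theta>\<^sup>2 * (Emin * C1 * (?N * ?N)) \<le> ?R * (C2 * ?N)"
      using lower upper N(1) by (simp add: power2_eq_square)
    then have "(\<theta>\<^sup>2 * ?N * (Emin * C1)) * ?N \<le> (C2 * ?R) * ?N" by (simp add: mult_ac)
    then have "\<theta>\<^sup>2 * ?N * (Emin * C1) \<le> C2 * ?R"
    proof (cases "?N = 0")
      case True
      then show ?thesis using N C2 by simp
    next
      case False
      then have "0 < ?N" using N(2) by linarith
      with \<open>(\<theta>\<^sup>2 * ?N * (Emin * C1)) * ?N \<le> (C2 * ?R) * ?N\<close> show ?thesis by (rule mult_right_le_imp_le)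
    qed
    then show ?thesis using C1 constants by (simp add: pos_le_divide_eq mult_ac)
  qed
  show ?thesis
  \<comment> \<open>Taking \<open>\<theta> = sqrt z\<close> lets \<open>\<theta>\<^sup>2\<close> run
    through the whole open unit interval, which removes it.\<close>
  proof (rule field_le_mult_one_interval)
    fix z :: real assume "0 < z" "z < 1"
    then show "z * ?N \<le> C2 / (C1 * Emin) * ?R" using step[of "sqrt z"] by simp
  qed
qed

end

end

section \<open>Square integrable functions and strongly measurable fields\<close>

lemma inner_L2:
  assumes "g \<in> L2 L" "h \<in> L2 L"
  shows integrable_inner_L2: "integrable L (\<lambda>x. g x \<bullet> h x)"
    and integrable_norm_mult_L2: "integrable L (\<lambda>x. norm (g x) * norm (h x))"
proof -
  have meas [measurable]: "g \<in> borel_measurable L" "h \<in> borel_measurable L"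
    using assms by (auto simp: L2_def)
  have sq: "integrable L (\<lambda>x. (norm (g x))\<^sup>2 + (norm (h x))\<^sup>2)" using assms by (auto simp: L2_def)
  have le: "norm (norm (g x) * norm (h x)) \<le> norm ((norm (g x))\<^sup>2 + (norm (h x))\<^sup>2)" for x
    using sum_squares_bound[of "norm (g x)" "norm (h x)"]
      mult_nonneg_nonneg[OF norm_ge_zero norm_ge_zero, of "g x" "h x"]
    unfolding real_norm_def by linarith
  show 1: "integrable L (\<lambda>x. norm (g x) * norm (h x))"
    by (rule Bochner_Integration.integrable_bound[OF sq _ AE_I2[OF le]]) measurable
  show "integrable L (\<lambda>x. g x \<bullet> h x)"
    by (rule Bochner_Integration.integrable_bound[OF 1]) (auto intro: Cauchy_Schwarz_ineq2)
qed

lemma subspace_L2: "subspace (L2 L :: ('a \<Rightarrow> 'b::euclidean_space) set)"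
proof (rule subspaceI)
  show "(0 :: 'a \<Rightarrow> 'b) \<in> L2 L" by (simp add: L2_def zero_fun_def)
next
  fix g h :: "'a \<Rightarrow> 'b" assume gh: "g \<in> L2 L" "h \<in> L2 L"
  then have [measurable]: "g \<in> borel_measurable L" "h \<in> borel_measurable L" by (auto simp: L2_def)
  have int: "integrable L (\<lambda>x. 2 * (norm (g x))\<^sup>2 + 2 * (norm (h x))\<^sup>2)"
    using gh by (auto simp: L2_def)
  have "(norm (g x + h x))\<^sup>2 \<le> 2 * (norm (g x))\<^sup>2 + 2 * (norm (h x))\<^sup>2" for x
  proof -
    have "(norm (g x + h x))\<^sup>2 \<le> (norm (g x) + norm (h x))\<^sup>2"
      by (intro power_mono norm_triangle_ineq) auto
    then show ?thesis using sum_squares_bound[of "norm (g x)" "norm (h x)"] by (simp add: power2_sum)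
  qed
  then have "integrable L (\<lambda>x. (norm (g x + h x))\<^sup>2)"
    by (intro Bochner_Integration.integrable_bound[OF int]) auto
  then show "g + h \<in> L2 L" by (simp add: L2_def plus_fun_def)
next
  fix c and g :: "'a \<Rightarrow> 'b" assume "g \<in> L2 L"
  then show "c *\<^sub>R g \<in> L2 L" by (auto simp: L2_def scaleR_fun_def power_mult_distrib)
qed

lemma psd_form_L2: "psd_form (L2 L) (\<lambda>g h. LINT x|L. g x \<bullet> h x)"
  by (intro psd_form.intro subspace_L2)
     (auto simp: inner_add_left integrable_inner_L2 intro: Bochner_Integration.integral_cong inner_commute)

lemma L2_norm_eq: "L2_norm L g = form_norm (\<lambda>g h. LINT x|L. g x \<bullet> h x) g"
  by (simp add: L2_norm_def form_norm_def power2_norm_eq_inner)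

lemma L2_norm_cong: "(AE x in L. g x = h x) \<Longrightarrow> g \<in> L2 L \<Longrightarrow> h \<in> L2 L \<Longrightarrow> L2_norm L g = L2_norm L h"
  unfolding L2_norm_def L2_def by (intro arg_cong[of _ _ sqrt] integral_cong_AE) auto

lemma integral_norm_mult_le:
  assumes "g \<in> L2 L" "h \<in> L2 L"
  shows "(LINT x|L. norm (g x) * norm (h x)) \<le> L2_norm L g * L2_norm L h"
proof -
  have L: "(\<lambda>x. norm (g x)) \<in> L2 L" "(\<lambda>x. norm (h x)) \<in> L2 L"
    using assms by (auto simp: L2_def)
  show ?thesis
    using psd_form.Cauchy_Schwarz[OF psd_form_L2 L] by (simp add: L2_norm_def form_norm_def power2_eq_square)
qed

lemma L2_imageI:
  fixes g :: "'a \<Rightarrow> 'b::euclidean_space" and T :: "'b \<Rightarrow> 'c::euclidean_space"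
  assumes "linear T" "g \<in> L2 L"
  shows "(\<lambda>x. T (g x)) \<in> L2 L"
proof -
  have T: "bounded_linear T" using assms(1) by (simp add: linear_conv_bounded_linear)
  then obtain K where K: "\<And>x. norm (T x) \<le> norm x * K" "K > 0" using bounded_linear.pos_bounded by blast
  have [measurable]: "g \<in> borel_measurable L" using assms by (auto simp: L2_def)
  have [measurable]: "(\<lambda>x. T (g x)) \<in> borel_measurable L"
    by (rule measurable_compose[OF _ borel_measurable_continuous_onI])
       (use T in \<open>auto intro: linear_continuous_on\<close>)
  have int: "integrable L (\<lambda>x. (norm (g x))\<^sup>2 * K\<^sup>2)" using assms by (auto simp: L2_def)
  have "integrable L (\<lambda>x. (norm (T (g x)))\<^sup>2)"
    by (rule Bochner_Integration.integrable_bound[OF int])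
       (use K in \<open>auto intro!: power_mono simp flip: power_mult_distrib\<close>)
  then show ?thesis by (simp add: L2_def)
qed

lemma L2_norm_image_le:
  assumes T: "linear T" and g: "g \<in> L2 L" and K: "\<And>z. norm (T z) \<le> K * norm z" "0 \<le> K"
  shows "L2_norm L (\<lambda>x. T (g x)) \<le> K * L2_norm L g"
proof -
  have "(LINT x|L. (norm (T (g x)))\<^sup>2) \<le> (LINT x|L. (K * norm (g x))\<^sup>2)"
    using L2_imageI[OF T g] g K
    by (intro integral_mono power_mono) (auto simp: L2_def power_mult_distrib)
  then show ?thesis
    using K(2) real_sqrt_le_mono by (fastforce simp: L2_norm_def power_mult_distrib real_sqrt_mult)
qed

section \<open>Measurability in the parameter of integrals over the domain\<close>

lemma simple_function_comp2:
  assumes "simple_function M f" "simple_function M g"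
  shows "simple_function M (\<lambda>x. h (f x) (g x))"
  using simple_function_compose[OF simple_function_Pair[OF assms], of "case_prod h"] by (simp add: comp_def)

text \<open>On each of the finitely many level sets of \<open>k\<close> the integrand is
  \<open>F\<close> times a fixed function, whose integral is measurable in the parameter; the pieces
  are then glued. This is the base case for fields that are limits of such \<open>k\<close> without
  being known to be jointly measurable.\<close>

lemma measurable_finite_range_integral:
  fixes k :: "'y \<Rightarrow> 'x \<Rightarrow> real" and F :: "'x \<Rightarrow> 'y \<Rightarrow> real"
  assumes "sigma_finite_measure L" and F: "(\<lambda>(x, y). F x y) \<in> borel_measurable (L \<Otimes>\<^sub>M M)"
    and k: "simple_function M k" "\<And>y. y \<in> space M \<Longrightarrow> k y \<in> borel_measurable L"
  shows "(\<lambda>y. LINT x|L. F x y * k y x) \<in> borel_measurable M"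
proof -
  interpret sigma_finite_measure L by fact
  have F': "(\<lambda>(y, x). F x y) \<in> borel_measurable (M \<Otimes>\<^sub>M L)"
    using measurable_pair_swap[OF F] by (simp add: case_prod_beta')
  show ?thesis
  proof (rule measurable_compose_countable'[where I = "k ` space M" and g = k])
    show "k \<in> measurable M (count_space (k ` space M))"
      using k(1) by (auto simp: simple_function_def intro!: measurable_count_space_eq2[THEN iffD2])
    show "countable (k ` space M)" using k(1) by (simp add: simple_function_def countable_finite)
    fix i assume "i \<in> k ` space M"
    then have [measurable]: "i \<in> borel_measurable L" using k(2) by auto
    show "(\<lambda>y. LINT x|L. F x y * i x) \<in> borel_measurable M"
      by (rule borel_measurable_lebesgue_integral) (use F' in measurable)
  qed
qed

text \<open>Multiplication by a bounded weight preserves L1 convergence, so at every parameter the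
  integrals of the simple approximants converge.\<close>

lemma measurable_integral_bounded_weight:
  fixes k :: "'y \<Rightarrow> 'x \<Rightarrow> real"
  assumes L: "sigma_finite_measure L" and F: "(\<lambda>(x, y). F x y) \<in> borel_measurable (L \<Otimes>\<^sub>M M)"
    and bdd: "\<And>x y. \<bar>F x y\<bar> \<le> C"
    and s: "\<And>n. simple_function M (s n)" "\<And>n y. y \<in> space M \<Longrightarrow> integrable L (s n y)"
    and k: "\<And>y. y \<in> space M \<Longrightarrow> integrable L (k y)"
    and lim: "\<And>y. y \<in> space M \<Longrightarrow> (\<lambda>n. LINT x|L. \<bar>s n y x - k y x\<bar>) \<longlonglongrightarrow> 0"
  shows "(\<lambda>y. LINT x|L. F x y * k y x) \<in> borel_measurable M"
proof (rule borel_measurable_LIMSEQ_real)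
  fix n show "(\<lambda>y. LINT x|L. F x y * s n y x) \<in> borel_measurable M"
    using s by (intro measurable_finite_range_integral L F) auto
next
  fix y assume y: "y \<in> space M"
  have [measurable]: "(\<lambda>x. F x y) \<in> borel_measurable L"
    using measurable_compose[OF measurable_Pair2'[OF y] F] by simp
  have C: "0 \<le> C" using bdd[of undefined undefined] by linarith
  have int: "integrable L (\<lambda>x. F x y * h x)" if "integrable L h" for h :: "'x \<Rightarrow> real"
  proof (rule Bochner_Integration.integrable_bound)
    show "integrable L (\<lambda>x. C * h x)" using that by simp
    have [measurable]: "h \<in> borel_measurable L" using that by auto
    show "(\<lambda>x. F x y * h x) \<in> borel_measurable L" by measurable
    show "AE x in L. norm (F x y * h x) \<le> norm (C * h x)"
      using bdd C by (auto simp: abs_mult intro!: mult_right_mono)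
  qed
  show "(\<lambda>n. LINT x|L. F x y * s n y x) \<longlonglongrightarrow> (LINT x|L. F x y * k y x)"
  proof (rule LIM_zero_cancel, rule Lim_null_comparison)
    show "\<forall>\<^sub>F n in sequentially. norm ((LINT x|L. F x y * s n y x) - (LINT x|L. F x y * k y x))
        \<le> C * (LINT x|L. \<bar>s n y x - k y x\<bar>)"
    proof (intro always_eventually allI)
      fix n
      have d: "integrable L (\<lambda>x. s n y x - k y x)" using s(2)[OF y] k[OF y] by simp
      have "norm ((LINT x|L. F x y * s n y x) - (LINT x|L. F x y * k y x))
          = norm (LINT x|L. F x y * (s n y x - k y x))"
        using int[OF s(2)[OF y]] int[OF k[OF y]] by (simp add: right_diff_distrib)
      also have "\<dots> \<le> (LINT x|L. norm (F x y * (s n y x - k y x)))" by (rule integral_norm_bound)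
      also have "\<dots> \<le> (LINT x|L. C * \<bar>s n y x - k y x\<bar>)"
        using integrable_abs[OF int[OF d]] d bdd by (intro integral_mono) (auto simp: abs_mult intro!: mult_right_mono)
      finally show "norm ((LINT x|L. F x y * s n y x) - (LINT x|L. F x y * k y x))
        \<le> C * (LINT x|L. \<bar>s n y x - k y x\<bar>)" by simp
    qed
    show "(\<lambda>n. C * (LINT x|L. \<bar>s n y x - k y x\<bar>)) \<longlonglongrightarrow> 0"
      using tendsto_mult_left[OF lim[OF y], of C] by simp
  qed
qed

text \<open>Monotone convergence in the truncation level. It expresses integrability by countably
  many integrals with bounded weights, whose measurability in the parameter is already
  available.\<close>

lemma integrable_if_truncations_bounded:
  fixes h :: "'a \<Rightarrow> real" and F :: "'a \<Rightarrow> real"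
  assumes [measurable]: "F \<in> borel_measurable L" and h: "integrable L h"
    and bdd: "\<And>n. (LINT x|L. min \<bar>F x\<bar> (real n) * \<bar>h x\<bar>) \<le> B"
  shows "integrable L (\<lambda>x. F x * h x)"
proof -
  have [measurable]: "h \<in> borel_measurable L" using h by auto
  have int: "integrable L (\<lambda>x. min \<bar>F x\<bar> (real n) * \<bar>h x\<bar>)" for n
  proof (rule Bochner_Integration.integrable_bound)
    show "integrable L (\<lambda>x. real n * h x)" using h by simp
  qed (auto simp: abs_mult intro!: mult_right_mono)
  have "(\<integral>\<^sup>+x. ennreal \<bar>F x * h x\<bar> \<partial>L) = (\<integral>\<^sup>+x. (SUP n. ennreal (min \<bar>F x\<bar> (real n) * \<bar>h x\<bar>)) \<partial>L)"
  proof (rule nn_integral_cong)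
    fix x
    have "(\<lambda>n. ennreal (min \<bar>F x\<bar> (real n) * \<bar>h x\<bar>)) \<longlonglongrightarrow> ennreal \<bar>F x * h x\<bar>"
    proof (rule tendsto_eventually)
      obtain N where "\<bar>F x\<bar> \<le> real N" using real_arch_simple by blast
      then have "min \<bar>F x\<bar> (real n) * \<bar>h x\<bar> = \<bar>F x * h x\<bar>" if "N \<le> n" for n
        using that by (auto simp: min_def abs_mult)
      then show "\<forall>\<^sub>F n in sequentially. ennreal (min \<bar>F x\<bar> (real n) * \<bar>h x\<bar>) = ennreal \<bar>F x * h x\<bar>"
        by (auto simp: eventually_sequentially)
    qed
    moreover have "incseq (\<lambda>n. ennreal (min \<bar>F x\<bar> (real n) * \<bar>h x\<bar>))"
      by (auto simp: incseq_def intro!: ennreal_leI mult_right_mono)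
    ultimately show "ennreal \<bar>F x * h x\<bar> = (SUP n. ennreal (min \<bar>F x\<bar> (real n) * \<bar>h x\<bar>))"
      using LIMSEQ_SUP LIMSEQ_unique by blast
  qed
  also have "\<dots> = (SUP n. \<integral>\<^sup>+x. ennreal (min \<bar>F x\<bar> (real n) * \<bar>h x\<bar>) \<partial>L)"
    by (intro nn_integral_monotone_convergence_SUP)
       (auto simp: incseq_def le_fun_def intro!: ennreal_leI mult_right_mono)
  also have "\<dots> \<le> ennreal B"
    using int bdd by (intro SUP_least) (auto simp: nn_integral_eq_integral intro!: ennreal_leI)
  also have "\<dots> < \<infinity>" by simp
  finally show ?thesis by (intro integrableI_bounded) auto
qed

text \<open>The weight is merely measurable, since Young's modulus is bounded for almost every parameter only
  while the integral has to be measurable in every parameter; truncate it.\<close>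
lemma measurable_integral_weight:
  fixes k :: "'y \<Rightarrow> 'x \<Rightarrow> real"
  assumes L: "sigma_finite_measure L" and F: "(\<lambda>(x, y). F x y) \<in> borel_measurable (L \<Otimes>\<^sub>M M)"
    and s: "\<And>n. simple_function M (s n)" "\<And>n y. y \<in> space M \<Longrightarrow> integrable L (s n y)"
    and k: "\<And>y. y \<in> space M \<Longrightarrow> integrable L (k y)"
    and lim: "\<And>y. y \<in> space M \<Longrightarrow> (\<lambda>n. LINT x|L. \<bar>s n y x - k y x\<bar>) \<longlonglongrightarrow> 0"
  shows "(\<lambda>y. LINT x|L. F x y * k y x) \<in> borel_measurable M"
proof -
  define T where "T n x y = max (- real n) (min (real n) (F x y))" for n :: nat and x y
  define J where "J n y = (LINT x|L. min \<bar>F x y\<bar> (real n) * \<bar>k y x\<bar>)" for n :: nat and y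
  \<comment> \<open>This will describe the parameters at which the integrand is integrable. The
    bound ranges over the naturals, which makes it a countable combination of measurable
    conditions.\<close>
  define P where "P y \<longleftrightarrow> (\<exists>B::nat. \<forall>n. J n y \<le> real B)" for y
  have T [measurable]: "(\<lambda>y. LINT x|L. T n x y * k y x) \<in> borel_measurable M" for n
  proof (rule measurable_integral_bounded_weight[OF L _ _ s k lim])
    show "(\<lambda>(x, y). T n x y) \<in> borel_measurable (L \<Otimes>\<^sub>M M)"
      unfolding T_def using F by (simp add: case_prod_beta')
    show "\<bar>T n x y\<bar> \<le> real n" for x y unfolding T_def by auto
  qed
  have [measurable]: "J n \<in> borel_measurable M" for n
    unfolding J_def
  proof (rule measurable_integral_bounded_weight[OF L _ _, where s = "\<lambda>n y x. \<bar>s n y x\<bar>"])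
    show "(\<lambda>(x, y). min \<bar>F x y\<bar> (real n)) \<in> borel_measurable (L \<Otimes>\<^sub>M M)"
      using F by (simp add: case_prod_beta')
    show "\<bar>min \<bar>F x y\<bar> (real n)\<bar> \<le> real n" for x y by auto
    show "simple_function M (\<lambda>y x. \<bar>s i y x\<bar>)" for i
      using simple_function_compose1[OF s(1), of "\<lambda>g x. \<bar>g x\<bar>"] .
    show "integrable L (\<lambda>x. \<bar>s i y x\<bar>)" "integrable L (\<lambda>x. \<bar>k y x\<bar>)" if "y \<in> space M" for i y
      using s(2)[OF that] k[OF that] by auto
    fix y assume y: "y \<in> space M"
    show "(\<lambda>n. LINT x|L. \<bar>\<bar>s n y x\<bar> - \<bar>k y x\<bar>\<bar>) \<longlonglongrightarrow> 0"
    proof (rule Lim_null_comparison[OF _ lim[OF y]], intro always_eventually allI)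
      fix n
      show "norm (LINT x|L. \<bar>\<bar>s n y x\<bar> - \<bar>k y x\<bar>\<bar>) \<le> (LINT x|L. \<bar>s n y x - k y x\<bar>)"
        using s(2)[OF y, of n] k[OF y] by (auto intro!: integral_mono)
    qed
  qed
  have P: "P y \<longleftrightarrow> integrable L (\<lambda>x. F x y * k y x)" if y: "y \<in> space M" for y
  proof
    have [measurable]: "(\<lambda>x. F x y) \<in> borel_measurable L"
      using measurable_compose[OF measurable_Pair2'[OF y] F] by simp
    show "integrable L (\<lambda>x. F x y * k y x)" if "P y"
      using that integrable_if_truncations_bounded[OF _ k[OF y], of "\<lambda>x. F x y"]
      unfolding P_def J_def by auto
    assume int: "integrable L (\<lambda>x. F x y * k y x)"
    obtain B :: nat where B: "(LINT x|L. \<bar>F x y * k y x\<bar>) \<le> real B" using real_arch_simple by blast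
    have "J n y \<le> real B" for n
    proof -
      have "J n y \<le> (LINT x|L. \<bar>F x y * k y x\<bar>)"
        unfolding J_def using integrable_abs[OF int]
        by (intro integral_mono_AE') (auto simp: abs_mult intro!: mult_right_mono)
      then show ?thesis using B by linarith
    qed
    then show "P y" unfolding P_def by blast
  qed
  show ?thesis
  proof (rule borel_measurable_LIMSEQ_real)
    fix n show "(\<lambda>y. if P y then LINT x|L. T n x y * k y x else 0) \<in> borel_measurable M"
      unfolding P_def by measurable
  next
    fix y assume y: "y \<in> space M"
    have [measurable]: "(\<lambda>x. F x y) \<in> borel_measurable L" "k y \<in> borel_measurable L"
      using measurable_compose[OF measurable_Pair2'[OF y] F] k[OF y] by auto
    show "(\<lambda>n. if P y then LINT x|L. T n x y * k y x else 0) \<longlonglongrightarrow> (LINT x|L. F x y * k y x)"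
    proof (cases "P y")
      case True
      then have int: "integrable L (\<lambda>x. F x y * k y x)" using P[OF y] by simp
      have "(\<lambda>n. LINT x|L. T n x y * k y x) \<longlonglongrightarrow> (LINT x|L. F x y * k y x)"
      proof (rule integral_dominated_convergence[where w = "\<lambda>x. \<bar>F x y * k y x\<bar>"])
        show "AE x in L. (\<lambda>n. T n x y * k y x) \<longlonglongrightarrow> F x y * k y x"
        proof (intro AE_I2 tendsto_mult tendsto_const tendsto_eventually)
          fix x
          obtain N where "\<bar>F x y\<bar> \<le> real N" using real_arch_simple by blast
          then show "\<forall>\<^sub>F n in sequentially. T n x y = F x y"
            unfolding eventually_sequentially T_def by (intro exI[of _ N]) (auto simp: min_def max_def)
        qed
        show "AE x in L. norm (T n x y * k y x) \<le> \<bar>F x y * k y x\<bar>" for n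
          by (intro AE_I2) (auto simp: T_def abs_mult intro!: mult_right_mono)
      qed (use int in \<open>auto simp: T_def\<close>)
      then show ?thesis using True by simp
    next
      case False
      \<comment> \<open>A function that is not integrable has integral 0 by convention, which is why
        the approximants are 0 where \<open>P\<close> fails.\<close>
      then show ?thesis using P[OF y] by (simp add: not_integrable_integral_eq)
    qed
  qed
qed

text \<open>The approximating sequence is an argument so that sums and images of fields can be given
  their sequences explicitly.\<close>

definition strongly_measurable :: "'a measure \<Rightarrow> ('b \<Rightarrow> 'c::real_vector) set \<Rightarrow> (('b \<Rightarrow> 'c) \<Rightarrow> real)
    \<Rightarrow> ('a \<Rightarrow> 'b \<Rightarrow> 'c) \<Rightarrow> (nat \<Rightarrow> 'a \<Rightarrow> 'b \<Rightarrow> 'c) \<Rightarrow> bool" where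
  "strongly_measurable M S N v s \<longleftrightarrow> (\<forall>y\<in>space M. v y \<in> S) \<and>
     (\<forall>n. simple_function M (s n) \<and> (\<forall>y\<in>space M. s n y \<in> S)) \<and>
     (\<forall>y\<in>space M. (\<lambda>n. N (s n y - v y)) \<longlonglongrightarrow> 0)"

lemma L2_Bochner_iff:
  "v \<in> L2_Bochner M S N \<longleftrightarrow> (\<exists>s. strongly_measurable M S N v s) \<and> integrable M (\<lambda>y. (N (v y))\<^sup>2)"
  unfolding L2_Bochner_def strongly_measurable_def by blast

lemma L2_Bochner_mem: "v \<in> L2_Bochner M S N \<Longrightarrow> y \<in> space M \<Longrightarrow> v y \<in> S"
  unfolding L2_Bochner_def by blast

text \<open>Restricts the carrier to functions, the type on which \<open>L2_Bochner\<close> is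
  defined.\<close>

locale psd_form_fun = psd_form S B for S :: "('b \<Rightarrow> 'c::real_vector) set" and B
begin

lemma strongly_measurable_norm:
  assumes "strongly_measurable M S (form_norm B) v s"
  shows "(\<lambda>y. form_norm B (v y)) \<in> borel_measurable M"
proof (rule borel_measurable_LIMSEQ_real)
  fix n show "(\<lambda>y. form_norm B (s n y)) \<in> borel_measurable M"
    using assms simple_function_compose1[of M "s n" "form_norm B"]
    by (auto simp: strongly_measurable_def intro: borel_measurable_simple_function)
next
  fix y assume y: "y \<in> space M"
  show "(\<lambda>n. form_norm B (s n y)) \<longlonglongrightarrow> form_norm B (v y)"
  proof (rule LIM_zero_cancel, rule Lim_null_comparison)
    show "\<forall>\<^sub>F n in sequentially. norm (form_norm B (s n y) - form_norm B (v y)) \<le> form_norm B (s n y - v y)"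
      using assms y form_norm_triangle_sub by (auto simp: strongly_measurable_def)
    show "(\<lambda>n. form_norm B (s n y - v y)) \<longlonglongrightarrow> 0" using assms y by (auto simp: strongly_measurable_def)
  qed
qed

lemma strongly_measurable_add:
  assumes "strongly_measurable M S (form_norm B) v s" "strongly_measurable M S (form_norm B) w t"
  shows "strongly_measurable M S (form_norm B) (v + w) (\<lambda>n. s n + t n)"
  unfolding strongly_measurable_def
proof (intro conjI ballI allI)
  fix n show "simple_function M (s n + t n)"
    using assms simple_function_comp2[of M "s n" "t n" "(+)"]
    by (auto simp: strongly_measurable_def plus_fun_def)
next
  fix y assume y: "y \<in> space M"
  have st: "s n y \<in> S" "t n y \<in> S" "v y \<in> S" "w y \<in> S" for n
    using assms y by (auto simp: strongly_measurable_def)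
  then show "(v + w) y \<in> S" "(s n + t n) y \<in> S" for n by (auto intro: closed)
  show "(\<lambda>n. form_norm B ((s n + t n) y - (v + w) y)) \<longlonglongrightarrow> 0"
  proof (rule Lim_null_comparison)
    show "\<forall>\<^sub>F n in sequentially. norm (form_norm B ((s n + t n) y - (v + w) y))
        \<le> form_norm B (s n y - v y) + form_norm B (t n y - w y)"
    proof (intro always_eventually allI)
      fix n
      have d: "s n y - v y \<in> S" "t n y - w y \<in> S" using st by (auto intro: closed)
      have "(s n + t n) y - (v + w) y = (s n y - v y) + (t n y - w y)" by simp
      then show "norm (form_norm B ((s n + t n) y - (v + w) y))
        \<le> form_norm B (s n y - v y) + form_norm B (t n y - w y)"
        using form_norm_triangle[OF d] form_norm_nonneg[OF closed(2)[OF d]]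
        by (simp only: real_norm_def abs_of_nonneg)
    qed
    show "(\<lambda>n. form_norm B (s n y - v y) + form_norm B (t n y - w y)) \<longlonglongrightarrow> 0"
      using assms y by (auto simp: strongly_measurable_def intro!: tendsto_add_zero)
  qed
qed

lemma subspace_L2_Bochner: "subspace (L2_Bochner M S (form_norm B))"
proof (rule subspaceI)
  have "strongly_measurable M S (form_norm B) 0 (\<lambda>_. 0)"
    by (auto simp: strongly_measurable_def zero_fun_def closed form_norm_def zero_left
        closed[unfolded zero_fun_def] zero_left[unfolded zero_fun_def])
  then show "0 \<in> L2_Bochner M S (form_norm B)"
    by (auto simp: L2_Bochner_iff form_norm_def zero_left closed)
next
  fix v w assume "v \<in> L2_Bochner M S (form_norm B)" "w \<in> L2_Bochner M S (form_norm B)"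
  then obtain s t where st: "strongly_measurable M S (form_norm B) v s" "strongly_measurable M S (form_norm B) w t"
    and int: "integrable M (\<lambda>y. (form_norm B (v y))\<^sup>2)" "integrable M (\<lambda>y. (form_norm B (w y))\<^sup>2)"
    by (auto simp: L2_Bochner_iff)
  note vw = strongly_measurable_add[OF st]
  have [measurable]: "(\<lambda>y. form_norm B ((v + w) y)) \<in> borel_measurable M"
    by (rule strongly_measurable_norm[OF vw])
  have int': "integrable M (\<lambda>y. 2 * (form_norm B (v y))\<^sup>2 + 2 * (form_norm B (w y))\<^sup>2)" using int by simp
  have "integrable M (\<lambda>y. (form_norm B ((v + w) y))\<^sup>2)"
  proof (rule Bochner_Integration.integrable_bound[OF int' _ AE_I2])
    fix y assume "y \<in> space M"
    then have "v y \<in> S" "w y \<in> S" using st by (auto simp: strongly_measurable_def)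
    then show "norm ((form_norm B ((v + w) y))\<^sup>2) \<le> norm (2 * (form_norm B (v y))\<^sup>2 + 2 * (form_norm B (w y))\<^sup>2)"
      using form_norm_add_sq_le[of "v y" "w y"] by (simp add: form_norm_sq closed nonneg)
  qed measurable
  then show "v + w \<in> L2_Bochner M S (form_norm B)" using vw by (auto simp: L2_Bochner_iff)
next
  fix c v assume "v \<in> L2_Bochner M S (form_norm B)"
  then obtain s where s: "strongly_measurable M S (form_norm B) v s"
    and int: "integrable M (\<lambda>y. (form_norm B (v y))\<^sup>2)"
    by (auto simp: L2_Bochner_iff)
  have "strongly_measurable M S (form_norm B) (c *\<^sub>R v) (\<lambda>n. c *\<^sub>R s n)"
    unfolding strongly_measurable_def
  proof (intro conjI ballI allI)
    fix n show "simple_function M (c *\<^sub>R s n)"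
      using s simple_function_compose1[of M "s n" "scaleR c"]
      by (auto simp: strongly_measurable_def scaleR_fun_def)
  next
    fix y assume y: "y \<in> space M"
    have st: "s n y \<in> S" "v y \<in> S" for n using s y by (auto simp: strongly_measurable_def)
    then show "(c *\<^sub>R v) y \<in> S" "(c *\<^sub>R s n) y \<in> S" for n by (auto intro: closed)
    have "form_norm B ((c *\<^sub>R s n) y - (c *\<^sub>R v) y) = \<bar>c\<bar> * form_norm B (s n y - v y)" for n
      using form_norm_scale[of "s n y - v y" c] st closed(4) by (simp add: scaleR_diff_right)
    then show "(\<lambda>n. form_norm B ((c *\<^sub>R s n) y - (c *\<^sub>R v) y)) \<longlonglongrightarrow> 0"
      using s y by (auto simp: strongly_measurable_def intro!: tendsto_mult_right_zero)
  qed
  moreover have "integrable M (\<lambda>y. (form_norm B ((c *\<^sub>R v) y))\<^sup>2)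
      = integrable M (\<lambda>y. c\<^sup>2 * (form_norm B (v y))\<^sup>2)"
    using s by (intro Bochner_Integration.integrable_cong)
      (auto simp: strongly_measurable_def form_norm_scale power_mult_distrib)
  ultimately show "c *\<^sub>R v \<in> L2_Bochner M S (form_norm B)" using int by (auto simp: L2_Bochner_iff)
qed

text \<open>The bound on differences is a hypothesis of its own because \<open>T\<close> is going to
  be a gradient: \<open>T a - T b\<close> and \<open>T (a - b)\<close> then agree only up to a null
  set and are different functions.\<close>

lemma L2_Bochner_image:
  assumes v: "v \<in> L2_Bochner M S (form_norm B)" and B': "psd_form S' B'"
    and T: "\<And>a. a \<in> S \<Longrightarrow> T a \<in> S'"
    and bound: "\<And>a. a \<in> S \<Longrightarrow> form_norm B' (T a) \<le> K * form_norm B a"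
    and diff: "\<And>a b. a \<in> S \<Longrightarrow> b \<in> S \<Longrightarrow> form_norm B' (T a - T b) \<le> K * form_norm B (a - b)"
  shows "(\<lambda>y. T (v y)) \<in> L2_Bochner M S' (form_norm B')"
proof -
  interpret B': psd_form_fun S' B' using B' by (rule psd_form_fun.intro)
  obtain s where s: "strongly_measurable M S (form_norm B) v s"
    and int: "integrable M (\<lambda>y. (form_norm B (v y))\<^sup>2)"
    using v by (auto simp: L2_Bochner_iff)
  have mem: "v y \<in> S" "s n y \<in> S" if "y \<in> space M" for n y
    using s that by (auto simp: strongly_measurable_def)
  have sm: "strongly_measurable M S' (form_norm B') (\<lambda>y. T (v y)) (\<lambda>n y. T (s n y))"
    unfolding strongly_measurable_def
  proof (intro conjI ballI allI)
    fix n show "simple_function M (\<lambda>y. T (s n y))"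
      using s simple_function_compose1[of M "s n" T] by (auto simp: strongly_measurable_def)
  next
    fix y assume y: "y \<in> space M"
    show "T (v y) \<in> S'" "T (s n y) \<in> S'" for n using mem[OF y] T by auto
    show "(\<lambda>n. form_norm B' (T (s n y) - T (v y))) \<longlonglongrightarrow> 0"
    proof (rule Lim_null_comparison)
      show "\<forall>\<^sub>F n in sequentially. norm (form_norm B' (T (s n y) - T (v y))) \<le> K * form_norm B (s n y - v y)"
        using diff mem[OF y] B'.form_norm_nonneg[OF B'.closed(4)] T by auto
      show "(\<lambda>n. K * form_norm B (s n y - v y)) \<longlonglongrightarrow> 0"
        using s y by (auto simp: strongly_measurable_def intro!: tendsto_mult_right_zero)
    qed
  qed
  have [measurable]: "(\<lambda>y. form_norm B' (T (v y))) \<in> borel_measurable M"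
    by (rule B'.strongly_measurable_norm[OF sm])
  have int': "integrable M (\<lambda>y. K\<^sup>2 * (form_norm B (v y))\<^sup>2)" using int by simp
  have "integrable M (\<lambda>y. (form_norm B' (T (v y)))\<^sup>2)"
  proof (rule Bochner_Integration.integrable_bound[OF int' _ AE_I2])
    fix y assume "y \<in> space M"
    then have "(form_norm B' (T (v y)))\<^sup>2 \<le> (K * form_norm B (v y))\<^sup>2"
      using mem T bound B'.form_norm_nonneg by (intro power_mono) auto
    then show "norm ((form_norm B' (T (v y)))\<^sup>2) \<le> norm (K\<^sup>2 * (form_norm B (v y))\<^sup>2)"
      by (simp add: power_mult_distrib)
  qed measurable
  then show ?thesis using sm by (auto simp: L2_Bochner_iff)
qed

lemma L2_Bochner_product:
  assumes c: "c \<in> borel_measurable M" "integrable M (\<lambda>y. (c y :: real)\<^sup>2)" and v: "v \<in> S"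
  shows "(\<lambda>y. c y *\<^sub>R v) \<in> L2_Bochner M S (form_norm B)"
proof -
  obtain s where s: "\<And>n. simple_function M (s n)" "\<And>y. y \<in> space M \<Longrightarrow> (\<lambda>n. s n y) \<longlonglongrightarrow> c y"
    using borel_measurable_implies_sequence_metric[OF c(1), of 0] by blast
  have "strongly_measurable M S (form_norm B) (\<lambda>y. c y *\<^sub>R v) (\<lambda>n y. s n y *\<^sub>R v)"
    unfolding strongly_measurable_def
  proof (intro conjI ballI allI)
    fix n show "simple_function M (\<lambda>y. s n y *\<^sub>R v)"
      using s(1) by (rule simple_function_compose1)
  next
    fix y assume y: "y \<in> space M"
    show "c y *\<^sub>R v \<in> S" "s n y *\<^sub>R v \<in> S" for n using v closed by auto
    have "form_norm B (s n y *\<^sub>R v - c y *\<^sub>R v) = \<bar>s n y - c y\<bar> * form_norm B v" for n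
      using form_norm_scale[OF v] by (simp add: scaleR_left_diff_distrib[symmetric])
    then show "(\<lambda>n. form_norm B (s n y *\<^sub>R v - c y *\<^sub>R v)) \<longlonglongrightarrow> 0"
      using s(2)[OF y] by (auto simp: LIM_zero_iff tendsto_rabs_zero_iff intro!: tendsto_mult_left_zero)
  qed
  moreover have "integrable M (\<lambda>y. (form_norm B (c y *\<^sub>R v))\<^sup>2)"
    using c(2) by (simp add: form_norm_scale[OF v] power_mult_distrib)
  ultimately show ?thesis by (auto simp: L2_Bochner_iff)
qed

end

section \<open>Weighted pairings of square integrable fields\<close>

abbreviation L2_fields :: "'y measure \<Rightarrow> 'x measure \<Rightarrow> ('y \<Rightarrow> 'x \<Rightarrow> 'b::euclidean_space) set" where
  "L2_fields M L \<equiv> L2_Bochner M (L2 L) (L2_norm L)"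

lemma L2_norm_eq': "L2_norm L = form_norm (\<lambda>g h. LINT x|L. g x \<bullet> h x)"
  by (rule ext) (rule L2_norm_eq)

text \<open>Splits the difference of products into (g' - g) h' and g (h' - h). This turns L2
  convergence of two factors into the L1 convergence of their product that
  \<open>measurable_integral_weight\<close> asks for.\<close>

lemma L2_inner_diff_le:
  fixes g g' h h' :: "'x \<Rightarrow> 'b::euclidean_space"
  assumes "g \<in> L2 L" "g' \<in> L2 L" "h \<in> L2 L" "h' \<in> L2 L"
  shows "(LINT x|L. \<bar>g' x \<bullet> h' x - g x \<bullet> h x\<bar>)
    \<le> L2_norm L (g' - g) * L2_norm L h' + L2_norm L g * L2_norm L (h' - h)"
proof -
  interpret P: psd_form_fun "L2 L :: ('x \<Rightarrow> 'b) set" "\<lambda>g h. LINT x|L. g x \<bullet> h x"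
    by (intro psd_form_fun.intro psd_form_L2)
  have d: "g' - g \<in> L2 L" "h' - h \<in> L2 L" using assms P.closed by auto
  have int: "integrable L (\<lambda>x. norm ((g' - g) x) * norm (h' x))" "integrable L (\<lambda>x. norm (g x) * norm ((h' - h) x))"
    using d assms by (auto intro!: integrable_norm_mult_L2 simp del: fun_diff_def minus_apply)
  have "(LINT x|L. \<bar>g' x \<bullet> h' x - g x \<bullet> h x\<bar>) \<le>
      (LINT x|L. norm ((g' - g) x) * norm (h' x) + norm (g x) * norm ((h' - h) x))"
  proof (rule integral_mono)
    show "integrable L (\<lambda>x. \<bar>g' x \<bullet> h' x - g x \<bullet> h x\<bar>)"
      using integrable_inner_L2[OF assms(2,4)] integrable_inner_L2[OF assms(1,3)] by auto
    show "integrable L (\<lambda>x. norm ((g' - g) x) * norm (h' x) + norm (g x) * norm ((h' - h) x))"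
      using int by (rule Bochner_Integration.integrable_add)
    fix x
    have "\<bar>g' x \<bullet> h' x - g x \<bullet> h x\<bar> = \<bar>(g' x - g x) \<bullet> h' x + g x \<bullet> (h' x - h x)\<bar>"
      by (simp add: inner_diff_left inner_diff_right)
    also have "\<dots> \<le> norm (g' x - g x) * norm (h' x) + norm (g x) * norm (h' x - h x)"
      by (intro order_trans[OF abs_triangle_ineq] add_mono Cauchy_Schwarz_ineq2)
    finally show "\<bar>g' x \<bullet> h' x - g x \<bullet> h x\<bar> \<le> norm ((g' - g) x) * norm (h' x) + norm (g x) * norm ((h' - h) x)"
      by simp
  qed
  also have "\<dots> = (LINT x|L. norm ((g' - g) x) * norm (h' x)) + (LINT x|L. norm (g x) * norm ((h' - h) x))"
    using int by (rule Bochner_Integration.integral_add)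
  also have "\<dots> \<le> L2_norm L (g' - g) * L2_norm L h' + L2_norm L g * L2_norm L (h' - h)"
    using d assms by (intro add_mono integral_norm_mult_le)
  finally show ?thesis .
qed

text \<open>The common shape of the bilinear forms: the weight is Young's modulus or 1, and the
  fields are gradients, symmetric gradients, divergences or pressures.\<close>

definition pairing :: "'y measure \<Rightarrow> 'x measure \<Rightarrow> ('x \<Rightarrow> 'y \<Rightarrow> real)
    \<Rightarrow> ('y \<Rightarrow> 'x \<Rightarrow> 'b::euclidean_space) \<Rightarrow> ('y \<Rightarrow> 'x \<Rightarrow> 'b) \<Rightarrow> real" where
  "pairing M L \<omega> g h = (LINT y|M. LINT x|L. \<omega> x y * (g y x \<bullet> h y x))"

locale weight = finite_measure M + L: sigma_finite_measure L for M :: "'y measure" and L :: "'x measure" +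
  fixes \<omega> :: "'x \<Rightarrow> 'y \<Rightarrow> real" and C :: real
  assumes meas: "(\<lambda>(x, y). \<omega> x y) \<in> borel_measurable (L \<Otimes>\<^sub>M M)"
    and bounds: "AE y in M. AE x in L. 0 \<le> \<omega> x y \<and> \<omega> x y \<le> C"
begin

lemma meas_section: "y \<in> space M \<Longrightarrow> (\<lambda>x. \<omega> x y) \<in> borel_measurable L"
  using measurable_compose[OF measurable_Pair2' meas] by simp

lemma integrable_section:
  fixes h :: "'x \<Rightarrow> real"
  assumes y: "y \<in> space M" "AE x in L. 0 \<le> \<omega> x y \<and> \<omega> x y \<le> C" and h: "integrable L h"
  shows "integrable L (\<lambda>x. \<omega> x y * h x)"
    and "\<bar>LINT x|L. \<omega> x y * h x\<bar> \<le> C * (LINT x|L. \<bar>h x\<bar>)"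
proof -
  have [measurable]: "(\<lambda>x. \<omega> x y) \<in> borel_measurable L" "h \<in> borel_measurable L"
    using meas_section[OF y(1)] h by auto
  have le: "AE x in L. \<bar>\<omega> x y * h x\<bar> \<le> C * \<bar>h x\<bar>"
    using y(2) by eventually_elim (auto simp: abs_mult intro!: mult_right_mono)
  have int: "integrable L (\<lambda>x. C * \<bar>h x\<bar>)" using h by simp
  show 1: "integrable L (\<lambda>x. \<omega> x y * h x)"
    using le by (intro Bochner_Integration.integrable_bound[OF int]) (auto intro: order_trans[OF _ abs_ge_self])
  have "\<bar>LINT x|L. \<omega> x y * h x\<bar> \<le> (LINT x|L. \<bar>\<omega> x y * h x\<bar>)" by (rule integral_abs_bound)
  also have "\<dots> \<le> (LINT x|L. C * \<bar>h x\<bar>)"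
    using le 1 int by (intro integral_mono_AE integrable_abs) auto
  finally show "\<bar>LINT x|L. \<omega> x y * h x\<bar> \<le> C * (LINT x|L. \<bar>h x\<bar>)" by simp
qed

lemma measurable_inner_integral:
  fixes g h :: "'y \<Rightarrow> 'x \<Rightarrow> 'b::euclidean_space"
  assumes g: "g \<in> L2_fields M L" and h: "h \<in> L2_fields M L"
  shows "(\<lambda>y. LINT x|L. \<omega> x y * (g y x \<bullet> h y x)) \<in> borel_measurable M"
proof -
  interpret P: psd_form_fun "L2 L :: ('x \<Rightarrow> 'b) set" "\<lambda>g h. LINT x|L. g x \<bullet> h x"
    by (intro psd_form_fun.intro psd_form_L2)
  obtain s t where st: "strongly_measurable M (L2 L) (L2_norm L) g s" "strongly_measurable M (L2 L) (L2_norm L) h t"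
    using g h unfolding L2_Bochner_iff by blast
  have mem: "s n y \<in> L2 L" "t n y \<in> L2 L" "g y \<in> L2 L" "h y \<in> L2 L" if "y \<in> space M" for n y
    using st that by (auto simp: strongly_measurable_def)
  show ?thesis
  proof (rule measurable_integral_weight[OF L.sigma_finite_measure_axioms meas,
        where s = "\<lambda>n y x. s n y x \<bullet> t n y x" and k = "\<lambda>y x. g y x \<bullet> h y x"])
    show "simple_function M (\<lambda>y x. s n y x \<bullet> t n y x)" for n
      using st simple_function_comp2[of M "s n" "t n" "\<lambda>a b x. a x \<bullet> b x"] by (auto simp: strongly_measurable_def)
    show "integrable L (\<lambda>x. s n y x \<bullet> t n y x)" "integrable L (\<lambda>x. g y x \<bullet> h y x)" if "y \<in> space M" for n y
      using mem[OF that] by (auto intro: integrable_inner_L2)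
    fix y assume y: "y \<in> space M"
    have lim: "(\<lambda>n. L2_norm L (s n y - g y)) \<longlonglongrightarrow> 0" "(\<lambda>n. L2_norm L (t n y - h y)) \<longlonglongrightarrow> 0"
      using st y by (auto simp: strongly_measurable_def)
    \<comment> \<open>The norm of \<open>t n y\<close> is replaced by its triangle bound, so that
      every factor of \<open>?b\<close> has a known limit.\<close>
    let ?b = "\<lambda>n. L2_norm L (s n y - g y) * (L2_norm L (t n y - h y) + L2_norm L (h y))
          + L2_norm L (g y) * L2_norm L (t n y - h y)"
    show "(\<lambda>n. LINT x|L. \<bar>s n y x \<bullet> t n y x - g y x \<bullet> h y x\<bar>) \<longlonglongrightarrow> 0"
    proof (rule Lim_null_comparison)
      show "\<forall>\<^sub>F n in sequentially. norm (LINT x|L. \<bar>s n y x \<bullet> t n y x - g y x \<bullet> h y x\<bar>) \<le> ?b n"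
      proof (intro always_eventually allI)
        fix n
        have "L2_norm L (t n y) \<le> L2_norm L (t n y - h y) + L2_norm L (h y)"
          using P.form_norm_triangle[of "t n y - h y" "h y"] mem[OF y] P.closed by (simp add: L2_norm_eq')
        then have "L2_norm L (s n y - g y) * L2_norm L (t n y)
            \<le> L2_norm L (s n y - g y) * (L2_norm L (t n y - h y) + L2_norm L (h y))"
          using mem[OF y] by (intro mult_left_mono) (auto simp: L2_norm_eq' intro!: P.form_norm_nonneg P.closed)
        moreover have "(LINT x|L. \<bar>s n y x \<bullet> t n y x - g y x \<bullet> h y x\<bar>)
            \<le> L2_norm L (s n y - g y) * L2_norm L (t n y) + L2_norm L (g y) * L2_norm L (t n y - h y)"
          using mem[OF y] by (intro L2_inner_diff_le)
        ultimately show "norm (LINT x|L. \<bar>s n y x \<bullet> t n y x - g y x \<bullet> h y x\<bar>) \<le> ?b n" by simp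
      qed
      have "?b \<longlonglongrightarrow> 0 * (0 + L2_norm L (h y)) + L2_norm L (g y) * 0"
        by (intro tendsto_intros lim)
      then show "?b \<longlonglongrightarrow> 0" by simp
    qed
  qed
qed

lemma integrable_inner_integral:
  fixes g h :: "'y \<Rightarrow> 'x \<Rightarrow> 'b::euclidean_space"
  assumes g: "g \<in> L2_fields M L" and h: "h \<in> L2_fields M L"
  shows "integrable M (\<lambda>y. LINT x|L. \<omega> x y * (g y x \<bullet> h y x))"
proof -
  have int: "integrable M (\<lambda>y. C * ((L2_norm L (g y))\<^sup>2 + (L2_norm L (h y))\<^sup>2))"
    using g h by (auto simp: L2_Bochner_iff)
  show ?thesis
  proof (rule Bochner_Integration.integrable_bound[OF int measurable_inner_integral[OF g h]])
    show "AE y in M. norm (LINT x|L. \<omega> x y * (g y x \<bullet> h y x))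
        \<le> norm (C * ((L2_norm L (g y))\<^sup>2 + (L2_norm L (h y))\<^sup>2))"
      using bounds AE_space
    proof eventually_elim
      fix y assume y: "AE x in L. 0 \<le> \<omega> x y \<and> \<omega> x y \<le> C" "y \<in> space M"
      let ?a = "L2_norm L (g y)" and ?b = "L2_norm L (h y)"
      have mem: "g y \<in> L2 L" "h y \<in> L2 L" using g h y(2) by (auto dest: L2_Bochner_mem)
      have "(LINT x|L. \<bar>g y x \<bullet> h y x\<bar>) \<le> (LINT x|L. norm (g y x) * norm (h y x))"
        using mem by (intro integral_mono integrable_abs integrable_inner_L2 integrable_norm_mult_L2)
          (auto intro: Cauchy_Schwarz_ineq2)
      also have "\<dots> \<le> ?a * ?b" using mem by (rule integral_norm_mult_le)
      also have "\<dots> \<le> ?a\<^sup>2 + ?b\<^sup>2"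
        using sum_squares_bound[of ?a ?b] zero_le_power2[of ?a] zero_le_power2[of ?b] by linarith
      finally have le: "(LINT x|L. \<bar>g y x \<bullet> h y x\<bar>) \<le> ?a\<^sup>2 + ?b\<^sup>2" .
      have "\<bar>LINT x|L. \<omega> x y * (g y x \<bullet> h y x)\<bar> \<le> C * (LINT x|L. \<bar>g y x \<bullet> h y x\<bar>)"
        using mem by (intro integrable_section(2)[OF y(2,1)] integrable_inner_L2)
      also have "\<dots> \<le> \<bar>C\<bar> * (LINT x|L. \<bar>g y x \<bullet> h y x\<bar>)"
        by (intro mult_right_mono Bochner_Integration.integral_nonneg) auto
      also have "\<dots> \<le> \<bar>C\<bar> * (?a\<^sup>2 + ?b\<^sup>2)" using le by (intro mult_left_mono) auto
      finally show "norm (LINT x|L. \<omega> x y * (g y x \<bullet> h y x)) \<le> norm (C * (?a\<^sup>2 + ?b\<^sup>2))"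
        by (simp add: abs_mult)
    qed
  qed
qed

lemma pairing_cong:
  fixes g h g' h' :: "'y \<Rightarrow> 'x \<Rightarrow> 'b::euclidean_space"
  assumes "g \<in> L2_fields M L" "h \<in> L2_fields M L" "g' \<in> L2_fields M L" "h' \<in> L2_fields M L"
    and "\<And>y. y \<in> space M \<Longrightarrow> AE x in L. g y x = g' y x" "\<And>y. y \<in> space M \<Longrightarrow> AE x in L. h y x = h' y x"
  shows "pairing M L \<omega> g h = pairing M L \<omega> g' h'"
  unfolding pairing_def
proof (rule Bochner_Integration.integral_cong[OF refl])
  fix y assume y: "y \<in> space M"
  have [measurable]: "g y \<in> borel_measurable L" "h y \<in> borel_measurable L"
    "g' y \<in> borel_measurable L" "h' y \<in> borel_measurable L" "(\<lambda>x. \<omega> x y) \<in> borel_measurable L"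
    using assms(1-4)[THEN L2_Bochner_mem, OF y] meas_section[OF y] by (auto simp: L2_def)
  show "(LINT x|L. \<omega> x y * (g y x \<bullet> h y x)) = (LINT x|L. \<omega> x y * (g' y x \<bullet> h' y x))"
  proof (rule integral_cong_AE)
    show "AE x in L. \<omega> x y * (g y x \<bullet> h y x) = \<omega> x y * (g' y x \<bullet> h' y x)"
      using assms(5)[OF y] assms(6)[OF y] by eventually_elim simp
  qed measurable
qed

lemma psd_form_pairing: "psd_form (L2_fields M L) (pairing M L \<omega> :: ('y \<Rightarrow> 'x \<Rightarrow> 'b::euclidean_space) \<Rightarrow> _)"
proof -
  interpret P: psd_form_fun "L2 L :: ('x \<Rightarrow> 'b) set" "\<lambda>g h. LINT x|L. g x \<bullet> h x" by (intro psd_form_fun.intro psd_form_L2)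
  show ?thesis
  proof
    show sub: "subspace (L2_fields M L :: ('y \<Rightarrow> 'x \<Rightarrow> 'b) set)"
      unfolding L2_norm_eq' by (rule P.subspace_L2_Bochner)
    fix f g h :: "'y \<Rightarrow> 'x \<Rightarrow> 'b" and c :: real
    assume fgh: "f \<in> L2_fields M L" "g \<in> L2_fields M L"
    show "pairing M L \<omega> f g = pairing M L \<omega> g f" unfolding pairing_def by (simp add: inner_commute)
    show "pairing M L \<omega> (c *\<^sub>R f) g = c * pairing M L \<omega> f g"
      unfolding pairing_def by (simp add: mult.left_commute[of _ c])
    show "0 \<le> pairing M L \<omega> f f"
      unfolding pairing_def
    proof (rule integral_nonneg_AE)
      show "AE y in M. 0 \<le> (LINT x|L. \<omega> x y * (f y x \<bullet> f y x))"
        using bounds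
      proof eventually_elim
        case (elim y)
        show ?case by (rule integral_nonneg_AE) (use elim in \<open>eventually_elim, auto\<close>)
      qed
    qed
    assume h: "h \<in> L2_fields M L"
    have fg: "f + g \<in> L2_fields M L" using sub fgh by (rule subspace_add)
    have "pairing M L \<omega> (f + g) h = (LINT y|M. (LINT x|L. \<omega> x y * (f y x \<bullet> h y x)) + (LINT x|L. \<omega> x y * (g y x \<bullet> h y x)))"
      unfolding pairing_def
    proof (rule integral_cong_AE)
      show "(\<lambda>y. LINT x|L. \<omega> x y * ((f + g) y x \<bullet> h y x)) \<in> borel_measurable M"
        using fg h by (rule measurable_inner_integral)
      show "(\<lambda>y. (LINT x|L. \<omega> x y * (f y x \<bullet> h y x)) + (LINT x|L. \<omega> x y * (g y x \<bullet> h y x))) \<in> borel_measurable M"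
        using fgh h by (intro borel_measurable_add measurable_inner_integral)
      \<comment> \<open>At the exceptional parameters the weight may be unbounded on the domain; the
        integrals over it may then fail to exist and to be additive.\<close>
      show "AE y in M. (LINT x|L. \<omega> x y * ((f + g) y x \<bullet> h y x)) =
          (LINT x|L. \<omega> x y * (f y x \<bullet> h y x)) + (LINT x|L. \<omega> x y * (g y x \<bullet> h y x))"
        using bounds AE_space
      proof eventually_elim
        fix y assume y: "AE x in L. 0 \<le> \<omega> x y \<and> \<omega> x y \<le> C" "y \<in> space M"
        have "integrable L (\<lambda>x. \<omega> x y * (f y x \<bullet> h y x))" "integrable L (\<lambda>x. \<omega> x y * (g y x \<bullet> h y x))"
          using fgh h y by (auto intro!: integrable_section integrable_inner_L2 dest: L2_Bochner_mem)
        then show "(LINT x|L. \<omega> x y * ((f + g) y x \<bullet> h y x)) =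
          (LINT x|L. \<omega> x y * (f y x \<bullet> h y x)) + (LINT x|L. \<omega> x y * (g y x \<bullet> h y x))"
          by (simp add: inner_add_left distrib_left)
      qed
    qed
    also have "\<dots> = pairing M L \<omega> f h + pairing M L \<omega> g h"
      unfolding pairing_def using fgh h by (intro Bochner_Integration.integral_add integrable_inner_integral)
    finally show "pairing M L \<omega> (f + g) h = pairing M L \<omega> f h + pairing M L \<omega> g h" .
  qed
qed

end

text \<open>The two fields may have values in different spaces: this compares the scalar divergence
  with the matrix valued gradient as well as two weights on the same field.\<close>

lemma pairing_mono:
  fixes g g' :: "'y \<Rightarrow> 'x \<Rightarrow> 'b::euclidean_space" and h h' :: "'y \<Rightarrow> 'x \<Rightarrow> 'c::euclidean_space"
  assumes "weight M L \<omega> C" "weight M L \<omega>' C'"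
    and g: "g \<in> L2_fields M L" and h: "h \<in> L2_fields M L"
    and le: "AE y in M. AE x in L. k * (\<omega> x y * (g y x \<bullet> g y x)) \<le> k' * (\<omega>' x y * (h y x \<bullet> h y x))"
  shows "k * pairing M L \<omega> g g \<le> k' * pairing M L \<omega>' h h"
proof -
  interpret A: weight M L \<omega> C by fact
  interpret B: weight M L \<omega>' C' by fact
  have "(LINT y|M. k * (LINT x|L. \<omega> x y * (g y x \<bullet> g y x))) \<le> (LINT y|M. k' * (LINT x|L. \<omega>' x y * (h y x \<bullet> h y x)))"
  proof (rule integral_mono_AE)
    show "AE y in M. k * (LINT x|L. \<omega> x y * (g y x \<bullet> g y x)) \<le> k' * (LINT x|L. \<omega>' x y * (h y x \<bullet> h y x))"
      using A.bounds B.bounds le AE_space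
    proof eventually_elim
      fix y assume y: "AE x in L. 0 \<le> \<omega> x y \<and> \<omega> x y \<le> C" "AE x in L. 0 \<le> \<omega>' x y \<and> \<omega>' x y \<le> C'"
        "AE x in L. k * (\<omega> x y * (g y x \<bullet> g y x)) \<le> k' * (\<omega>' x y * (h y x \<bullet> h y x))" "y \<in> space M"
      have "integrable L (\<lambda>x. \<omega> x y * (g y x \<bullet> g y x))" "integrable L (\<lambda>x. \<omega>' x y * (h y x \<bullet> h y x))"
        using g h y by (auto intro!: A.integrable_section B.integrable_section integrable_inner_L2 dest: L2_Bochner_mem)
      then have "(LINT x|L. k * (\<omega> x y * (g y x \<bullet> g y x))) \<le> (LINT x|L. k' * (\<omega>' x y * (h y x \<bullet> h y x)))"
        using y(3) by (intro integral_mono_AE integrable_mult_right)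
      then show "k * (LINT x|L. \<omega> x y * (g y x \<bullet> g y x)) \<le> k' * (LINT x|L. \<omega>' x y * (h y x \<bullet> h y x))" by simp
    qed
  qed (use A.integrable_inner_integral[OF g g] B.integrable_inner_integral[OF h h] in auto)
  then show ?thesis by (simp add: pairing_def)
qed

text \<open>Gradients are only defined up to null sets, hence linear only almost everywhere.\<close>
locale ae_linear = P: psd_form_fun S B for S :: "('x \<Rightarrow> 'b::real_vector) set" and B +
  fixes L :: "'x measure" and T :: "('x \<Rightarrow> 'b) \<Rightarrow> 'x \<Rightarrow> 'c::euclidean_space" and K :: real
  assumes T_L2: "a \<in> S \<Longrightarrow> T a \<in> L2 L"
    and T_add: "a \<in> S \<Longrightarrow> b \<in> S \<Longrightarrow> AE x in L. T (a + b) x = T a x + T b x"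
    and T_scale: "a \<in> S \<Longrightarrow> AE x in L. T (c *\<^sub>R a) x = c *\<^sub>R T a x"
    and T_bound: "a \<in> S \<Longrightarrow> L2_norm L (T a) \<le> K * form_norm B a"
begin

lemma T_diff:
  assumes "a \<in> S" "b \<in> S" shows "AE x in L. T (a - b) x = T a x - T b x"
  using T_add[OF assms(1) P.closed(3)[OF assms(2)], of "-1"] T_scale[OF assms(2), of "-1"]
  by eventually_elim simp

lemma T_fields:
  assumes "v \<in> L2_Bochner M S (form_norm B)"
  shows "(\<lambda>y. T (v y)) \<in> L2_fields M L"
  unfolding L2_norm_eq'
proof (rule P.L2_Bochner_image[OF assms psd_form_L2 T_L2])
  show "form_norm (\<lambda>g h. LINT x|L. g x \<bullet> h x) (T a) \<le> K * form_norm B a" if "a \<in> S" for a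
    using T_bound[OF that] by (simp add: L2_norm_eq')
  fix a b assume ab: "a \<in> S" "b \<in> S"
  interpret Q: psd_form "L2 L :: ('x \<Rightarrow> 'c) set" "\<lambda>g h. LINT x|L. g x \<bullet> h x" by (rule psd_form_L2)
  have "L2_norm L (T a - T b) = L2_norm L (T (a - b))"
    using T_diff[OF ab] ab T_L2 P.closed by (intro L2_norm_cong Q.closed) auto
  also have "\<dots> \<le> K * form_norm B (a - b)" using ab P.closed by (intro T_bound) auto
  finally show "form_norm (\<lambda>g h. LINT x|L. g x \<bullet> h x) (T a - T b) \<le> K * form_norm B (a - b)"
    by (simp add: L2_norm_eq')
qed

text \<open>Null sets disappear under the integral, so linearity of \<open>T\<close> almost
  everywhere becomes exact linearity of the pairing.\<close>

lemma pairing_T_left: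
  fixes h :: "'y \<Rightarrow> 'x \<Rightarrow> 'c"
  assumes "weight M L \<omega> C" and h: "h \<in> L2_fields M L"
    and u: "u \<in> L2_Bochner M S (form_norm B)" "v \<in> L2_Bochner M S (form_norm B)"
  shows "pairing M L \<omega> (\<lambda>y. T ((u + v) y)) h = pairing M L \<omega> (\<lambda>y. T (u y)) h + pairing M L \<omega> (\<lambda>y. T (v y)) h"
    and "pairing M L \<omega> (\<lambda>y. T ((c *\<^sub>R u) y)) h = c * pairing M L \<omega> (\<lambda>y. T (u y)) h"
proof -
  interpret W: weight M L \<omega> C by fact
  interpret Q: psd_form "L2_fields M L :: ('y \<Rightarrow> 'x \<Rightarrow> 'c) set" "pairing M L \<omega>" by (rule W.psd_form_pairing)
  note sub = P.subspace_L2_Bochner[of M]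
  note Tu = T_fields[OF u(1)] and Tv = T_fields[OF u(2)]
  have "pairing M L \<omega> (\<lambda>y. T ((u + v) y)) h = pairing M L \<omega> ((\<lambda>y. T (u y)) + (\<lambda>y. T (v y))) h"
    using Tu Tv h T_fields[OF subspace_add[OF sub u]] T_add u[THEN L2_Bochner_mem]
    by (intro W.pairing_cong Q.closed) auto
  then show "pairing M L \<omega> (\<lambda>y. T ((u + v) y)) h = pairing M L \<omega> (\<lambda>y. T (u y)) h + pairing M L \<omega> (\<lambda>y. T (v y)) h"
    using Q.add_left[OF Tu Tv h] by simp
  have "pairing M L \<omega> (\<lambda>y. T ((c *\<^sub>R u) y)) h = pairing M L \<omega> (c *\<^sub>R (\<lambda>y. T (u y))) h"
    using Tu h T_fields[OF subspace_scale[OF sub u(1)]] T_scale u(1)[THEN L2_Bochner_mem]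
    by (intro W.pairing_cong Q.closed) auto
  then show "pairing M L \<omega> (\<lambda>y. T ((c *\<^sub>R u) y)) h = c * pairing M L \<omega> (\<lambda>y. T (u y)) h"
    using Q.scale_left[OF Tu h] by simp
qed

lemma psd_form_pairing_T:
  assumes "weight M L \<omega> C"
  shows "psd_form (L2_Bochner M S (form_norm B)) (\<lambda>u v. pairing M L \<omega> (\<lambda>y. T (u y)) (\<lambda>y. T (v y)))"
proof -
  interpret W: weight M L \<omega> C by fact
  interpret Q: psd_form "L2_fields M L :: ('a \<Rightarrow> 'x \<Rightarrow> 'c) set" "pairing M L \<omega>" by (rule W.psd_form_pairing)
  show ?thesis
    by (intro psd_form.intro P.subspace_L2_Bochner pairing_T_left[OF assms] Q.sym Q.nonneg T_fields)
qed

end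

section \<open>Test functions\<close>

lemma pderivative_eq:
  assumes "(f has_derivative f') (at x)"
  shows "pderivative j f x = f' (axis j 1)"
  using frechet_derivative_at[OF assms] by (simp add: pderivative_def)

lemma pderivative_simps:
  fixes f g :: "real^'n \<Rightarrow> real"
  shows "pderivative j (\<lambda>x. c) = (\<lambda>x. 0)"
    and "pderivative j (\<lambda>x. x $ i) = (\<lambda>x. axis j 1 $ i)"
    and "(\<And>x. f differentiable at x) \<Longrightarrow> (\<And>x. g differentiable at x) \<Longrightarrow>
      pderivative j (\<lambda>x. f x + g x) = (\<lambda>x. pderivative j f x + pderivative j g x)"
    and "(\<And>x. f differentiable at x) \<Longrightarrow> (\<And>x. g differentiable at x) \<Longrightarrow>
      pderivative j (\<lambda>x. f x * g x) = (\<lambda>x. f x * pderivative j g x + pderivative j f x * g x)"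
    and "(\<And>x. f differentiable at x) \<Longrightarrow> (\<And>t. (h has_real_derivative h' t) (at t)) \<Longrightarrow>
      pderivative j (\<lambda>x. h (f x)) = (\<lambda>x. h' (f x) * pderivative j f x)"
proof -
  show "pderivative j (\<lambda>x. c) = (\<lambda>x. 0)"
    by (rule ext, subst pderivative_eq[OF has_derivative_const]) simp
  show "pderivative j (\<lambda>x. x $ i) = (\<lambda>x. axis j 1 $ i)"
    by (rule ext, subst pderivative_eq[OF bounded_linear_imp_has_derivative[OF bounded_linear_vec_nth]]) simp
next
  assume "\<And>x. f differentiable at x" "\<And>x. g differentiable at x"
  then have d: "(f has_derivative frechet_derivative f (at x)) (at x)"
    "(g has_derivative frechet_derivative g (at x)) (at x)" for x
    by (auto simp: frechet_derivative_works)
  show "pderivative j (\<lambda>x. f x + g x) = (\<lambda>x. pderivative j f x + pderivative j g x)"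
    by (rule ext, subst pderivative_eq[OF has_derivative_add[OF d]]) (simp add: pderivative_def)
  show "pderivative j (\<lambda>x. f x * g x) = (\<lambda>x. f x * pderivative j g x + pderivative j f x * g x)"
    by (rule ext, subst pderivative_eq[OF has_derivative_mult[OF d]]) (simp add: pderivative_def)
next
  assume "\<And>x. f differentiable at x"
  then have d: "(f has_derivative frechet_derivative f (at x)) (at x)" for x
    by (auto simp: frechet_derivative_works)
  assume h: "\<And>t. (h has_real_derivative h' t) (at t)"
  show "pderivative j (\<lambda>x. h (f x)) = (\<lambda>x. h' (f x) * pderivative j f x)"
    by (rule ext, subst pderivative_eq[OF has_derivative_compose[OF d h[unfolded has_field_derivative_def]]])
       (simp add: pderivative_def)
qed

lemma Ck_SucD: "Ck (Suc k) f \<Longrightarrow> Ck k f"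
proof (induction k arbitrary: f)
  case 0
  then show ?case by (auto intro!: continuous_at_imp_continuous_on differentiable_imp_continuous_within)
qed auto

lemma Ck_differentiable: "Ck (Suc k) f \<Longrightarrow> f differentiable at x"
  by simp

lemma Ck_const: "Ck k (\<lambda>x. c)"
  by (induction k arbitrary: c) (auto simp: pderivative_simps)

lemma Ck_coordinate: "Ck k (\<lambda>x. x $ i)"
  by (cases k) (auto simp: pderivative_simps Ck_const intro!: continuous_intros
      bounded_linear_imp_differentiable bounded_linear_vec_nth)

lemma Ck_add: "Ck k f \<Longrightarrow> Ck k g \<Longrightarrow> Ck k (\<lambda>x. f x + g x)"
  by (induction k arbitrary: f g) (auto simp: pderivative_simps intro!: continuous_intros)

lemma Ck_mult: "Ck k f \<Longrightarrow> Ck k g \<Longrightarrow> Ck k (\<lambda>x. f x * g x)"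
proof (induction k arbitrary: f g)
  case (Suc k)
  have "Ck k f" "Ck k g" using Suc.prems by (auto intro: Ck_SucD)
  then show ?case using Suc by (auto simp: pderivative_simps intro!: Ck_add)
qed (auto intro!: continuous_intros)

text \<open>\<open>h\<close> is the whole sequence of derivatives of the outer function, so that the
  chain rule stays within the family and the induction can pass from \<open>h m\<close> to
  \<open>h (Suc m)\<close>.\<close>

lemma Ck_compose:
  fixes h :: "nat \<Rightarrow> real \<Rightarrow> real"
  assumes h: "\<And>m t. (h m has_real_derivative h (Suc m) t) (at t)"
  shows "Ck k f \<Longrightarrow> Ck k (\<lambda>x. h m (f x))"
proof (induction k arbitrary: m)
  case 0
  have "continuous_on UNIV (h m)" using h DERIV_continuous_on by blast
  then show ?case using 0 by (auto intro: continuous_on_compose2)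
next
  case (Suc k)
  have "Ck k f" using Suc.prems by (rule Ck_SucD)
  moreover have "(\<lambda>x. h m (f x)) differentiable at x" for x
  proof -
    have "(h m) differentiable at (f x)" using h real_differentiable_def by blast
    then show ?thesis using Suc.prems differentiable_chain_at[of f x "h m"] by (simp add: comp_def)
  qed
  ultimately show ?case using Suc by (simp add: pderivative_simps(5)[OF _ h] Ck_mult)
qed

lemma smooth_intros:
  "smooth (\<lambda>x. c)" "smooth (\<lambda>x. x $ i)"
  "smooth f \<Longrightarrow> smooth g \<Longrightarrow> smooth (\<lambda>x. f x + g x)" "smooth f \<Longrightarrow> smooth g \<Longrightarrow> smooth (\<lambda>x. f x * g x)"
  by (auto simp: smooth_def intro: Ck_const Ck_coordinate Ck_add Ck_mult)

lemma smooth_sum: "finite I \<Longrightarrow> (\<And>i. i \<in> I \<Longrightarrow> smooth (f i)) \<Longrightarrow> smooth (\<lambda>x. \<Sum>i\<in>I. f i x)"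
  by (induction I rule: finite_induct) (auto intro: smooth_intros)

lemma smooth_prod: "finite I \<Longrightarrow> (\<And>i. i \<in> I \<Longrightarrow> smooth (f i)) \<Longrightarrow> smooth (\<lambda>x. \<Prod>i\<in>I. f i x)"
  by (induction I rule: finite_induct) (auto intro: smooth_intros)

lemma smooth_differentiable: "smooth f \<Longrightarrow> f differentiable at x"
  unfolding smooth_def using Ck_differentiable by blast

lemma smooth_pderivative: "smooth f \<Longrightarrow> smooth (pderivative j f)"
  unfolding smooth_def by (metis Ck.simps(2))

lemma smooth_continuous: "smooth f \<Longrightarrow> continuous_on UNIV f"
  unfolding smooth_def using Ck.simps(1) by blast

lemma pderivative_smooth_mult:
  assumes "smooth f" "smooth g"
  shows "pderivative j (\<lambda>x. f x * g x) x = f x * pderivative j g x + pderivative j f x * g x"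
  using assms by (simp add: pderivative_simps(4) smooth_differentiable)

text \<open>The recursion comes from differentiating P(1/t) exp(-1/t): with s = 1/t the result is
  \<open>s\<^sup>2 * (P s - P' s) * exp (- s)\<close>.\<close>

primrec flat_poly :: "nat \<Rightarrow> real poly" where
  "flat_poly 0 = 1"
| "flat_poly (Suc m) = [:0, 0, 1:] * (flat_poly m - pderiv (flat_poly m))"

text \<open>The \<open>m\<close>-th derivative of the smooth function \<open>exp (-1/t)\<close> extended by zero to \<open>t \<le> 0\<close>.\<close>
definition flat :: "nat \<Rightarrow> real \<Rightarrow> real" where
  "flat m t = (if t > 0 then poly (flat_poly m) (1 / t) * exp (- (1 / t)) else 0)"

lemma poly_div_exp_tendsto_0: "((\<lambda>s. poly p s / exp s) \<longlongrightarrow> (0::real)) at_top"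
proof -
  have "((\<lambda>s. \<Sum>i\<le>degree p. coeff p i * (s ^ i / exp s)) \<longlongrightarrow> (\<Sum>i\<le>degree p. coeff p i * 0)) at_top"
    by (intro tendsto_sum tendsto_mult tendsto_const tendsto_power_div_exp_0)
  moreover have "(\<lambda>s. \<Sum>i\<le>degree p. coeff p i * (s ^ i / exp s)) = (\<lambda>s. poly p s / exp s)"
    by (auto simp: poly_altdef sum_divide_distrib)
  ultimately show ?thesis by simp
qed

lemma DERIV_flat: "(flat m has_real_derivative flat (Suc m) t) (at t)"
proof -
  consider "t < 0" | "t = 0" | "t > 0" by linarith
  then show ?thesis
  proof cases
    case 1
    have "((\<lambda>_. 0) has_real_derivative 0) (at t)" by simp
    then have "(flat m has_real_derivative 0) (at t)"
      by (rule has_field_derivative_transform_within_open[of _ _ _ "{..<0}"]) (use 1 in \<open>auto simp: flat_def\<close>)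
    then show ?thesis using 1 by (simp add: flat_def)
  next
    case 2
    have "((\<lambda>y. flat m y / y) \<longlongrightarrow> 0) (at 0)"
    proof (rule filterlim_split_at)
      have "\<forall>\<^sub>F y in at_left 0. flat m y / y = 0"
        by (auto simp: eventually_at_left_field flat_def intro!: exI[of _ "-1"])
      then show "((\<lambda>y. flat m y / y) \<longlongrightarrow> 0) (at_left 0)" by (rule tendsto_eventually)
      \<comment> \<open>With s = 1/y the difference quotient at 0 is s P(s) / exp s;
        \<open>pCons 0\<close> supplies the factor s.\<close>
      have "((\<lambda>y. poly (pCons 0 (flat_poly m)) (inverse y) / exp (inverse y)) \<longlongrightarrow> 0) (at_right 0)"
        by (rule filterlim_compose[OF poly_div_exp_tendsto_0 filterlim_inverse_at_top_right])
      moreover have "\<forall>\<^sub>F y in at_right 0. poly (pCons 0 (flat_poly m)) (inverse y) / exp (inverse y) = flat m y / y"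
        by (auto simp: eventually_at_right_field flat_def exp_minus field_simps intro!: exI[of _ 1])
      ultimately show "((\<lambda>y. flat m y / y) \<longlongrightarrow> 0) (at_right 0)" by (rule Lim_transform_eventually)
    qed
    then show ?thesis using 2 by (simp add: has_field_derivative_iff flat_def)
  next
    case 3
    let ?P = "flat_poly m"
    have "((\<lambda>t. poly ?P (1 / t) * exp (- (1 / t))) has_real_derivative
        poly (pderiv ?P) (1 / t) * (- 1 / t\<^sup>2) * exp (- (1 / t)) + poly ?P (1 / t) * (exp (- (1 / t)) * (1 / t\<^sup>2))) (at t)"
      using 3 by (auto intro!: derivative_eq_intros DERIV_chain2[OF poly_DERIV] simp: power2_eq_square)
    also have "poly (pderiv ?P) (1 / t) * (- 1 / t\<^sup>2) * exp (- (1 / t)) + poly ?P (1 / t) * (exp (- (1 / t)) * (1 / t\<^sup>2))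
        = flat (Suc m) t"
      using 3 by (simp add: flat_def power2_eq_square algebra_simps)
    finally show ?thesis
      by (rule has_field_derivative_transform_within_open[of _ _ _ "{0<..}"]) (use 3 in \<open>auto simp: flat_def\<close>)
  qed
qed

lemma flat_0: "0 \<le> flat 0 t" "flat 0 t \<le> 1" "flat 0 t \<noteq> 0 \<longleftrightarrow> t > 0"
  by (auto simp: flat_def)

text \<open>The shift by 1 makes the function vanish for t up to 1/n, which later keeps supports
  away from the boundary of a box.\<close>

lemma flat_0_tendsto:
  "(\<lambda>n. flat 0 (real n * t - 1)) \<longlonglongrightarrow> (if t > 0 then 1 else 0)"
proof (cases "t > 0")
  case True
  have "filterlim (\<lambda>n. - 1 + t * real n) at_top sequentially"
    by (rule filterlim_tendsto_add_at_top[OF tendsto_const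
        filterlim_tendsto_pos_mult_at_top[OF tendsto_const True filterlim_real_sequentially]])
  then have top: "filterlim (\<lambda>n. real n * t - 1) at_top sequentially" by (simp add: mult.commute)
  have "(\<lambda>n. exp (- (1 / (real n * t - 1)))) \<longlonglongrightarrow> exp (- 0)"
    by (intro tendsto_exp tendsto_minus) (use tendsto_inverse_0_at_top[OF top] in \<open>simp add: inverse_eq_divide\<close>)
  moreover have "\<forall>\<^sub>F n in sequentially. exp (- (1 / (real n * t - 1))) = flat 0 (real n * t - 1)"
    using filterlim_at_top_dense[THEN iffD1, OF top, rule_format, of 0] by eventually_elim (auto simp: flat_def)
  ultimately show ?thesis using True by (auto intro: Lim_transform_eventually)
next
  case False
  then have "real n * t - 1 \<le> 0" for n using mult_nonneg_nonpos[of "real n" t] by simp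
  then have "flat 0 (real n * t - 1) = 0" for n using flat_0(3) not_less by blast
  then show ?thesis using False by simp
qed

text \<open>A product of one rising and one falling cut-off for each coordinate. Each vanishes
  within distance 1/n of its face, so the support is compact inside the open box.\<close>

lemma box_test_functions:
  fixes a b :: "real^'n"
  assumes "box a b \<subseteq> D"
  obtains \<phi> where "\<And>n::nat. \<phi> n \<in> test_functions D" "\<And>n x. 0 \<le> \<phi> n x" "\<And>n x. \<phi> n x \<le> 1"
    "\<And>x. (\<lambda>n. \<phi> n x) \<longlonglongrightarrow> indicator (box a b) x"
proof
  define \<phi> where "\<phi> n x = (\<Prod>i\<in>UNIV. flat 0 (real n * (x $ i - a $ i) - 1) * flat 0 (real n * (b $ i - x $ i) - 1))"
    for n :: nat and x :: "real^'n"
  show "0 \<le> \<phi> n x" "\<phi> n x \<le> 1" for n x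
    by (auto simp: \<phi>_def flat_0 intro!: prod_nonneg prod_le_1 mult_nonneg_nonneg mult_le_one)
  show "(\<lambda>n. \<phi> n x) \<longlonglongrightarrow> indicator (box a b) x" for x
  proof -
    have "(\<lambda>n. \<phi> n x) \<longlonglongrightarrow> (\<Prod>i\<in>UNIV. (if x $ i - a $ i > 0 then 1 else 0) * (if b $ i - x $ i > 0 then 1 else 0))"
      unfolding \<phi>_def by (intro tendsto_prod tendsto_mult flat_0_tendsto)
    moreover have "(\<Prod>i\<in>UNIV. (if x $ i - a $ i > 0 then 1 else 0) * (if b $ i - x $ i > 0 then 1 else 0))
        = (indicator (box a b) x :: real)"
      by (auto simp: indicator_def mem_box_cart)
    ultimately show ?thesis by simp
  qed
  show "\<phi> n \<in> test_functions D" for n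
  proof -
    have "smooth (\<lambda>x::real^'n. flat 0 (c * (s * x $ i - d) - 1))" for c d s i
    proof -
      have "smooth (\<lambda>x::real^'n. (c * s) * x $ i + (- c * d - 1))" by (intro smooth_intros)
      then have "smooth (\<lambda>x::real^'n. c * (s * x $ i - d) - 1)" by (simp add: algebra_simps)
      then show ?thesis unfolding smooth_def using Ck_compose[of flat, OF DERIV_flat] by blast
    qed
    from this[where s = 1] this[where s = "-1" and d = "- (b $ i)" for i]
    have s: "smooth (\<phi> n)" unfolding \<phi>_def by (intro smooth_prod smooth_intros) simp_all
    show ?thesis
    \<comment> \<open>The margin 1/n makes no sense for \<open>n = 0\<close>; there every factor is
      \<open>flat 0 (-1) = 0\<close>.\<close>
    proof (cases "n = 0")
      case True
      then have "\<phi> n = (\<lambda>_. 0)" by (auto simp: \<phi>_def flat_def)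
      then show ?thesis by (auto simp: test_functions_def smooth_intros)
    next
      case False
      let ?K = "cbox (a + (\<chi> i. 1 / real n)) (b - (\<chi> i. 1 / real n))"
      have "{x. \<phi> n x \<noteq> 0} \<subseteq> ?K"
        using False by (auto simp: \<phi>_def flat_0 mem_box_cart field_simps less_imp_le)
      then have K: "closure {x. \<phi> n x \<noteq> 0} \<subseteq> ?K" by (intro closure_minimal) auto
      have "?K \<subseteq> box a b"
      proof
        fix x assume "x \<in> ?K"
        then have "a $ i + 1 / real n \<le> x $ i" "x $ i \<le> b $ i - 1 / real n" for i by (auto simp: mem_box_cart)
        moreover have "1 / real n > 0" using False by simp
        ultimately have "a $ i < x $ i" "x $ i < b $ i" for i by (smt (verit))+
        then show "x \<in> box a b" by (auto simp: mem_box_cart)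
      qed
      moreover have "compact (closure {x. \<phi> n x \<noteq> 0})"
        using K bounded_subset[OF bounded_cbox] by (auto simp: compact_eq_bounded_closed)
      ultimately show ?thesis using K assms s by (auto simp: test_functions_def)
    qed
  qed
qed

text \<open>Boxes are stable under intersection and generate the Borel sets, so by Dynkin's theorem
  the integral vanishes over every Borel set. The hypothesis \<open>univ\<close> feeds the
  complement step.\<close>

lemma AE_zero_if_box_integrals_zero:
  fixes g :: "'a::euclidean_space \<Rightarrow> real"
  assumes g: "integrable lborel g" and box: "\<And>a b. (LINT x|lborel. indicator (box a b) x * g x) = 0"
    and univ: "(LINT x|lborel. g x) = 0"
  shows "AE x in lborel. g x = 0"
proof (rule density_unique_real[OF g, of "\<lambda>_. 0"])
  have int: "integrable lborel (\<lambda>x. indicator A x * g x)" if "A \<in> sets borel" for A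
    using integrable_mult_indicator[OF _ g, of A] that by simp
  fix A :: "'a set" assume "A \<in> sets lborel"
  then have A: "A \<in> sigma_sets UNIV (range (\<lambda>(a, b). box a b))" by (simp add: borel_eq_box)
  have "Int_stable (range (\<lambda>(a, b). box a b :: 'a set))" by (auto simp: Int_stable_def box_Int_box)
  moreover have "range (\<lambda>(a, b). box a b :: 'a set) \<subseteq> Pow UNIV" by simp
  ultimately have "(LINT x|lborel. indicator A x * g x) = 0" using A
  proof (induction rule: sigma_sets_induct_disjoint)
    case (compl A)
    then have A: "A \<in> sets borel" by (simp add: borel_eq_box)
    have "(LINT x|lborel. indicator (UNIV - A) x * g x) = (LINT x|lborel. g x - indicator A x * g x)"
      by (intro Bochner_Integration.integral_cong) (auto simp: indicator_def)
    also have "\<dots> = 0" using g int[OF A] univ compl by simp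
    finally show ?case .
  next
    case (union A)
    then have "A i \<in> sigma_sets UNIV (range (\<lambda>(a, b). box a b))" for i by blast
    then have A: "\<And>i. A i \<in> sets borel" by (simp add: borel_eq_box)
    have "(LINT x|lborel. indicator (\<Union>i. A i) x *\<^sub>R g x) = (\<Sum>i. LINT x|lborel. indicator (A i) x *\<^sub>R g x)"
      using A union int[of "\<Union>i. A i"]
      by (intro lebesgue_integral_countable_add[unfolded set_lebesgue_integral_def set_integrable_def])
         (auto simp: disjoint_family_on_def)
    then show ?case using union by simp
  qed (use box in auto)
  then show "(\<integral>x\<in>A. g x \<partial>lborel) = (\<integral>x\<in>A. 0 \<partial>lborel)"
    by (simp add: set_lebesgue_integral_def)
qed simp

text \<open>The fundamental lemma of the calculus of variations. Test functions reach the indicator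
  of a box inside \<open>D\<close> by dominated convergence. The argument about Borel sets is run in
  one such box at a time, because its intersection with any other box is a box that again lies in
  \<open>D\<close>.\<close>

lemma integral_test_functions_zero:
  fixes h :: "real^'n \<Rightarrow> real"
  assumes D: "open D" and h: "integrable (lebesgue_on D) h"
    and zero: "\<And>\<phi>. \<phi> \<in> test_functions D \<Longrightarrow> (LINT x|lebesgue_on D. h x * \<phi> x) = 0"
  shows "AE x in lebesgue_on D. h x = 0"
proof -
  have DL: "D \<in> sets lebesgue" using borel_open[OF D] by simp
  have hm [measurable]: "h \<in> borel_measurable (lebesgue_on D)" using h by auto
  have box0: "(LINT x|lebesgue_on D. h x * indicator (box a b) x) = 0" if "box a b \<subseteq> D" for a b
  proof -
    obtain \<phi> where \<phi>: "\<And>n::nat. \<phi> n \<in> test_functions D" "\<And>n x. 0 \<le> \<phi> n x" "\<And>n x. \<phi> n x \<le> 1"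
      "\<And>x. (\<lambda>n. \<phi> n x) \<longlonglongrightarrow> indicator (box a b) x"
      using box_test_functions[OF \<open>box a b \<subseteq> D\<close>] by blast
    have [measurable]: "\<phi> n \<in> borel_measurable (lebesgue_on D)" for n
      using \<phi>(1)[of n] smooth_continuous
      by (intro continuous_imp_measurable_on_sets_lebesgue DL) (auto simp: test_functions_def intro: continuous_on_subset)
    have [measurable]: "(\<lambda>x. indicator (box a b) x :: real) \<in> borel_measurable (lebesgue_on D)"
      by (rule borel_measurable_LIMSEQ_real[OF \<phi>(4)]) measurable
    have "(\<lambda>n. LINT x|lebesgue_on D. h x * \<phi> n x) \<longlonglongrightarrow> (LINT x|lebesgue_on D. h x * indicator (box a b) x)"
      by (rule integral_dominated_convergence[where w = "\<lambda>x. \<bar>h x\<bar>"])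
         (use h \<phi> in \<open>auto intro!: tendsto_mult AE_I2 simp: abs_mult mult_left_le\<close>)
    then show ?thesis using zero[OF \<phi>(1)] by (simp add: LIMSEQ_const_iff)
  qed
  have AE_box: "AE x in lebesgue. x \<in> box a b \<longrightarrow> h x = 0" if ab: "box a b \<subseteq> D" for a b
  proof -
    define g where "g x = (if x \<in> D then h x * indicator (box a b) x else 0)" for x
    have int: "integrable lebesgue (\<lambda>x. g x * indicator B x)" 
      "(LINT x|lebesgue. g x * indicator B x) = (LINT x|lebesgue_on D. h x * indicator (box a b \<inter> B) x)"
      if "B \<in> sets borel" for B
    proof -
      have eq: "(\<lambda>x. g x * indicator B x) = (\<lambda>x. indicator D x *\<^sub>R (h x * indicator (box a b \<inter> B) x))"
        by (auto simp: g_def indicator_def)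
      have "integrable (lebesgue_on D) (\<lambda>x. indicator ((box a b \<inter> B) \<inter> D) x *\<^sub>R h x)"
      proof (rule integrable_mult_indicator[OF _ h])
        have "box a b \<inter> B \<in> sets borel" using that by (intro sets.Int) auto
        then have "box a b \<inter> B \<in> sets lebesgue" by simp
        then show "(box a b \<inter> B) \<inter> D \<in> sets (lebesgue_on D)"
          using DL sets_restrict_space_iff[of D lebesgue] sets.Int by simp
      qed
      moreover have "integrable (lebesgue_on D) (\<lambda>x. indicator ((box a b \<inter> B) \<inter> D) x *\<^sub>R h x)
         = integrable (lebesgue_on D) (\<lambda>x. h x * indicator (box a b \<inter> B) x)"
        by (intro Bochner_Integration.integrable_cong) (auto simp: indicator_def)
      ultimately have "integrable (lebesgue_on D) (\<lambda>x. h x * indicator (box a b \<inter> B) x)" by simp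
      then show "integrable lebesgue (\<lambda>x. g x * indicator B x)"
        unfolding eq using DL by (simp add: integrable_restrict_space)
      show "(LINT x|lebesgue. g x * indicator B x) = (LINT x|lebesgue_on D. h x * indicator (box a b \<inter> B) x)"
        unfolding eq using DL by (simp add: integral_restrict_space)
    qed
    have gint: "integrable lebesgue g" using int(1)[of UNIV] by simp
    \<comment> \<open>\<open>AE_zero_if_box_integrals_zero\<close> lives on \<open>lborel\<close>,
      so \<open>g\<close> is replaced by a Borel function equal to it almost everywhere.\<close>
    then obtain g' where g' [measurable]: "g' \<in> borel_measurable lborel" and gg': "AE x in lborel. g x = g' x"
      using completion_ex_borel_measurable_real[of g lborel] by auto
    have gg'': "AE x in lebesgue. g x = g' x" using gg' by (rule AE_completion)
    have int': "integrable lborel (\<lambda>x. g' x * indicator B x)"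
      "(LINT x|lborel. g' x * indicator B x) = (LINT x|lebesgue. g x * indicator B x)" if [measurable]: "B \<in> sets borel" for B
    proof -
      have m: "(\<lambda>x. g' x * indicator B x) \<in> borel_measurable lborel" by measurable
      have eq: "AE x in lebesgue. g x * indicator B x = g' x * indicator B x" using gg'' by eventually_elim simp
      have "integrable lebesgue (\<lambda>x. g' x * indicator B x)"
        by (rule integrable_cong_AE_imp[OF int(1)[OF that]])
           (use m eq in \<open>auto intro: measurable_completion elim: eventually_mono\<close>)
      then show "integrable lborel (\<lambda>x. g' x * indicator B x)" using m by (simp add: integrable_completion)
      have "(LINT x|lebesgue. g x * indicator B x) = (LINT x|lebesgue. g' x * indicator B x)"
        using eq int(1)[OF that] m by (intro integral_cong_AE) (auto intro: measurable_completion)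
      then show "(LINT x|lborel. g' x * indicator B x) = (LINT x|lebesgue. g x * indicator B x)"
        using m by (simp add: integral_completion)
    qed
    have "AE x in lborel. g' x = 0"
    proof (rule AE_zero_if_box_integrals_zero)
      show "integrable lborel g'" using int'(1)[of UNIV] by simp
      show "(LINT x|lborel. indicator (box c d) x * g' x) = 0" for c d
      proof -
        obtain c' d' where cd: "box a b \<inter> box c d = box c' d'"
          by (rule that[OF box_Int_box])
        then have "box c' d' \<subseteq> D" using ab by blast
        then show ?thesis using int'(2)[of "box c d"] int(2)[of "box c d"] box0 cd by (simp add: mult.commute)
      qed
      show "(LINT x|lborel. g' x) = 0"
        using int'(2)[of UNIV] int(2)[of UNIV] box0[OF ab] by simp
    qed
    then have "AE x in lebesgue. g' x = 0" by (rule AE_completion)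
    then show ?thesis using gg'' by eventually_elim (use ab in \<open>auto simp: g_def indicator_def\<close>)
  qed
  \<comment> \<open>Countably many boxes fill \<open>D\<close>, so their exceptional sets have a
    null union.\<close>
  obtain \<D> where \<D>: "countable \<D>" "\<D> \<subseteq> Pow D" "\<And>X. X \<in> \<D> \<Longrightarrow> \<exists>a b. X = box a b" "\<Union>\<D> = D"
    using open_countable_Union_open_box[OF D] by metis
  have "AE x in lebesgue. \<forall>X\<in>\<D>. x \<in> X \<longrightarrow> h x = 0"
    unfolding AE_ball_countable[OF \<D>(1)]
  proof
    fix X assume X: "X \<in> \<D>"
    then obtain a b where ab: "X = box a b" using \<D>(3) by blast
    then have "box a b \<subseteq> D" using X \<D>(2) by blast
    then show "AE x in lebesgue. x \<in> X \<longrightarrow> h x = 0" unfolding ab by (rule AE_box)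
  qed
  then have "AE x in lebesgue. x \<in> D \<longrightarrow> h x = 0"
    by eventually_elim (use \<D>(4) in blast)
  then show ?thesis using DL by (simp add: AE_restrict_space_iff)
qed

section \<open>Weak gradients\<close>

lemma test_functions_smooth: "\<phi> \<in> test_functions D \<Longrightarrow> smooth \<phi>"
  by (simp add: test_functions_def)

lemma test_functions_smooth_mult:
  assumes "smooth \<psi>" "\<phi> \<in> test_functions D"
  shows "(\<lambda>x. \<psi> x * \<phi> x) \<in> test_functions D"
proof -
  have sub: "closure {x. \<psi> x * \<phi> x \<noteq> 0} \<subseteq> closure {x. \<phi> x \<noteq> 0}" by (rule closure_mono) auto
  then have "compact (closure {x. \<psi> x * \<phi> x \<noteq> 0})"
    unfolding compact_eq_bounded_closed
    using assms bounded_subset[OF compact_imp_bounded sub] by (simp only: test_functions_def closed_closure) blast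
  then show ?thesis using assms sub by (auto simp: test_functions_def intro: smooth_intros)
qed

lemma smooth_linear: "smooth (\<lambda>x. (A *v x) $ i)" for A :: "real^'n^'n"
  unfolding matrix_vector_mult_def by (simp, intro smooth_sum smooth_intros) auto

lemma pderivative_linear: "pderivative j (\<lambda>x. (A *v x) $ i) x = A $ i $ j" for A :: "real^'n^'n"
proof -
  have "((\<lambda>x. (A *v x) $ i) has_derivative (\<lambda>x. (A *v x) $ i)) (at x)"
    by (rule bounded_linear_imp_has_derivative)
       (auto intro: bounded_linear_compose[OF bounded_linear_vec_nth] matrix_vector_mul_bounded_linear)
  from pderivative_eq[OF this, of j] show ?thesis
    by (simp add: matrix_vector_mult_basis column_def)
qed

lemma norm_matrix_le:
  fixes M :: "real^'n^'n"
  assumes "\<And>i j. \<bar>M $ i $ j\<bar> \<le> c" shows "norm M \<le> (real CARD('n))\<^sup>2 * c"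
proof -
  have "norm M \<le> (\<Sum>i\<in>UNIV. norm (M $ i))" unfolding norm_vec_def by (rule L2_set_le_sum) simp
  also have "\<dots> \<le> (\<Sum>i\<in>(UNIV::'n set). \<Sum>j\<in>(UNIV::'n set). c)"
    using assms by (intro sum_mono order_trans[OF norm_le_l1_cart]) auto
  finally show ?thesis by (simp add: power2_eq_square mult.assoc)
qed

lemma L2_pointwise_bound:
  fixes g :: "'a \<Rightarrow> 'b::euclidean_space" and h :: "'a \<Rightarrow> 'c::euclidean_space" and h' :: "'a \<Rightarrow> 'd::euclidean_space"
  assumes [measurable]: "g \<in> borel_measurable M" and h: "h \<in> L2 M" "h' \<in> L2 M"
    and le: "\<And>x. x \<in> space M \<Longrightarrow> norm (g x) \<le> C * (norm (h x) + norm (h' x))"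
  shows "g \<in> L2 M" "(L2_norm M g)\<^sup>2 \<le> 2 * C\<^sup>2 * ((L2_norm M h)\<^sup>2 + (L2_norm M h')\<^sup>2)"
proof -
  have int: "integrable M (\<lambda>x. 2 * C\<^sup>2 * ((norm (h x))\<^sup>2 + (norm (h' x))\<^sup>2))"
    using h by (auto simp: L2_def)
  have sq: "(norm (g x))\<^sup>2 \<le> 2 * C\<^sup>2 * ((norm (h x))\<^sup>2 + (norm (h' x))\<^sup>2)" if "x \<in> space M" for x
  proof -
    have "(norm (g x))\<^sup>2 \<le> (C * (norm (h x) + norm (h' x)))\<^sup>2" using le[OF that] by (intro power_mono) auto
    also have "\<dots> = C\<^sup>2 * (1 * norm (h x) + 1 * norm (h' x))\<^sup>2" by (simp add: power_mult_distrib)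
    also have "\<dots> \<le> C\<^sup>2 * ((1\<^sup>2 + 1\<^sup>2) * ((norm (h x))\<^sup>2 + (norm (h' x))\<^sup>2))"
      by (intro mult_left_mono sum2_power2_le) auto
    finally show ?thesis by (simp add: algebra_simps)
  qed
  have gint: "integrable M (\<lambda>x. (norm (g x))\<^sup>2)"
    by (rule Bochner_Integration.integrable_bound[OF int _ AE_I2]) (use sq in auto)
  then show "g \<in> L2 M" by (simp add: L2_def)
  have "(LINT x|M. (norm (g x))\<^sup>2) \<le> (LINT x|M. 2 * C\<^sup>2 * ((norm (h x))\<^sup>2 + (norm (h' x))\<^sup>2))"
    using gint int sq by (rule integral_mono)
  also have "\<dots> = 2 * C\<^sup>2 * ((LINT x|M. (norm (h x))\<^sup>2) + (LINT x|M. (norm (h' x))\<^sup>2))"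
    using h by (simp add: L2_def)
  finally show "(L2_norm M g)\<^sup>2 \<le> 2 * C\<^sup>2 * ((L2_norm M h)\<^sup>2 + (L2_norm M h')\<^sup>2)"
    by (simp add: L2_norm_def)
qed

lemma borel_measurable_matrix:
  fixes f :: "'a \<Rightarrow> real^'m^'k"
  assumes "\<And>i j. (\<lambda>x. f x $ i $ j) \<in> borel_measurable M"
  shows "f \<in> borel_measurable M"
  using assms by (subst borel_measurable_euclidean_space) (auto simp: Basis_vec_def inner_axis)

section \<open>Weak gradients and the Sobolev space on a bounded open set\<close>

locale bounded_open =
  fixes D :: "(real^'n) set"
  assumes open_D: "open D" and bounded_D: "bounded D"
begin

abbreviation "L \<equiv> lebesgue_on D"

lemma D_lmeasurable: "D \<in> lmeasurable"
  by (rule lmeasurable_open[OF bounded_D open_D])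

sublocale finite_measure L
  by (rule finite_measure_lebesgue_on[OF D_lmeasurable])

lemma continuous_L2:
  assumes "continuous_on UNIV (\<psi> :: real^'n \<Rightarrow> real)" shows "\<psi> \<in> L2 L"
proof -
  have [measurable]: "\<psi> \<in> borel_measurable L"
    using assms D_lmeasurable
    by (intro continuous_imp_measurable_on_sets_lebesgue) (auto intro: continuous_on_subset)
  have "compact (\<psi> ` closure D)"
    using assms bounded_D by (intro compact_continuous_image) (auto intro: continuous_on_subset)
  then obtain B where "\<And>y. y \<in> \<psi> ` closure D \<Longrightarrow> norm y \<le> B"
    using compact_imp_bounded bounded_iff by metis
  then have B: "\<bar>\<psi> x\<bar> \<le> B" if "x \<in> D" for x using that closure_subset by fastforce
  have "integrable L (\<lambda>x. (\<psi> x)\<^sup>2)"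
  proof (rule integrable_const_bound[of _ "B\<^sup>2"])
    show "AE x in L. norm ((\<psi> x)\<^sup>2) \<le> B\<^sup>2"
      using power_mono[OF B, of _ 2] by (intro AE_I2) auto
  qed measurable
  then show ?thesis by (simp add: L2_def)
qed

lemma integrable_mult_smooth:
  fixes g :: "real^'n \<Rightarrow> real"
  assumes "g \<in> L2 L" "smooth \<psi>" shows "integrable L (\<lambda>x. g x * \<psi> x)"
  using integrable_inner_L2[OF assms(1) continuous_L2[OF smooth_continuous[OF assms(2)]]] by simp

lemma L2_nth: "v \<in> L2 L \<Longrightarrow> (\<lambda>x. v x $ i) \<in> L2 L" for v :: "real^'n \<Rightarrow> real^'m"
  by (rule L2_imageI[where T = "\<lambda>z. z $ i"]) (auto intro: bounded_linear.linear bounded_linear_vec_nth)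

lemma L2_nth_nth: "G \<in> L2 L \<Longrightarrow> (\<lambda>x. G x $ i $ j) \<in> L2 L" for G :: "real^'n \<Rightarrow> real^'m^'k"
  by (rule L2_imageI[where T = "\<lambda>z. z $ i $ j"]) (auto simp: linear_iff)

lemma is_weak_grad_add:
  assumes "v \<in> L2 L" "w \<in> L2 L" "is_weak_grad D v G" "is_weak_grad D w H"
  shows "is_weak_grad D (v + w) (G + H)"
  unfolding is_weak_grad_def
proof (intro conjI ballI allI)
  show "G + H \<in> L2 L"
    using assms subspace_add[OF subspace_L2, of G L H] by (auto simp: is_weak_grad_def)
  fix \<phi> i j assume \<phi>: "\<phi> \<in> test_functions D"
  have GH: "G \<in> L2 L" "H \<in> L2 L" using assms by (auto simp: is_weak_grad_def)
  have "integrable L (\<lambda>x. v x $ i * pderivative j \<phi> x)" "integrable L (\<lambda>x. w x $ i * pderivative j \<phi> x)"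
    "integrable L (\<lambda>x. G x $ i $ j * \<phi> x)" "integrable L (\<lambda>x. H x $ i $ j * \<phi> x)"
    using assms GH test_functions_smooth[OF \<phi>]
    by (auto intro!: integrable_mult_smooth L2_nth L2_nth_nth smooth_pderivative)
  then show "(LINT x|L. (v + w) x $ i * pderivative j \<phi> x) = - (LINT x|L. (G + H) x $ i $ j * \<phi> x)"
    using assms(3,4) \<phi> by (simp add: is_weak_grad_def distrib_right)
qed

lemma is_weak_grad_scale:
  assumes "is_weak_grad D v G"
  shows "is_weak_grad D (c *\<^sub>R v) (c *\<^sub>R G)"
  using assms subspace_scale[OF subspace_L2, of G L c]
  by (auto simp: is_weak_grad_def mult.assoc)

text \<open>Both representatives have the same integral against every test function, so the
  fundamental lemma applies to each entry of their difference.\<close>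

lemma is_weak_grad_unique:
  assumes "is_weak_grad D v G" "is_weak_grad D v H"
  shows "AE x in L. G x = H x"
proof -
  have GH: "G \<in> L2 L" "H \<in> L2 L" using assms by (auto simp: is_weak_grad_def)
  have "AE x in L. G x $ i $ j - H x $ i $ j = 0" for i j
  proof (rule integral_test_functions_zero[OF open_D])
    show "integrable L (\<lambda>x. G x $ i $ j - H x $ i $ j)"
      using integrable_mult_smooth[OF L2_nth_nth[OF GH(1)], of "\<lambda>_. 1"]
        integrable_mult_smooth[OF L2_nth_nth[OF GH(2)], of "\<lambda>_. 1"] by (simp add: smooth_intros)
    fix \<phi> assume \<phi>: "\<phi> \<in> test_functions D"
    have "integrable L (\<lambda>x. G x $ i $ j * \<phi> x)" "integrable L (\<lambda>x. H x $ i $ j * \<phi> x)"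
      using GH test_functions_smooth[OF \<phi>] by (auto intro!: integrable_mult_smooth L2_nth_nth)
    moreover have "(LINT x|L. G x $ i $ j * \<phi> x) = (LINT x|L. H x $ i $ j * \<phi> x)"
      using assms \<phi> by (fastforce simp: is_weak_grad_def)
    ultimately show "(LINT x|L. (G x $ i $ j - H x $ i $ j) * \<phi> x) = 0" by (simp add: left_diff_distrib)
  qed
  then have "AE x in L. \<forall>j. G x $ i $ j - H x $ i $ j = 0" for i by (intro AE_all_countable[THEN iffD2]) blast
  then have "AE x in L. \<forall>i j. G x $ i $ j - H x $ i $ j = 0" by (intro AE_all_countable[THEN iffD2]) blast
  then show ?thesis by eventually_elim (simp add: vec_eq_iff)
qed

lemma H1_L2: "v \<in> H1 D \<Longrightarrow> v \<in> L2 L"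
  by (simp add: H1_def)

lemma is_weak_grad_grad: "v \<in> H1 D \<Longrightarrow> is_weak_grad D v (grad D v)"
  unfolding H1_def grad_def by (auto intro: someI[of "is_weak_grad D v"])

lemma H1I: "v \<in> L2 L \<Longrightarrow> is_weak_grad D v G \<Longrightarrow> v \<in> H1 D"
  by (auto simp: H1_def)

lemma grad_L2: "v \<in> H1 D \<Longrightarrow> grad D v \<in> L2 L"
  using is_weak_grad_grad by (simp add: is_weak_grad_def)

lemma grad_eq_AE: "v \<in> L2 L \<Longrightarrow> is_weak_grad D v G \<Longrightarrow> AE x in L. grad D v x = G x"
  using is_weak_grad_unique[OF is_weak_grad_grad[OF H1I]] by blast

lemma subspace_H1: "subspace (H1 D)"
proof (rule subspaceI)
  have "is_weak_grad D 0 0"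
    using subspace_0[OF subspace_L2[of L]] by (auto simp: is_weak_grad_def zero_fun_def)
  then show "0 \<in> H1 D" by (rule H1I[OF subspace_0[OF subspace_L2]])
qed (blast intro: H1I is_weak_grad_add is_weak_grad_scale is_weak_grad_grad H1_L2 subspace_L2
    subspace_add[OF subspace_L2] subspace_scale[OF subspace_L2])+

lemma grad_add: "v \<in> H1 D \<Longrightarrow> w \<in> H1 D \<Longrightarrow> AE x in L. grad D (v + w) x = grad D v x + grad D w x"
  using grad_eq_AE[OF subspace_add[OF subspace_L2] is_weak_grad_add, of v w]
  by (simp add: H1_L2 is_weak_grad_grad)

lemma grad_scale: "v \<in> H1 D \<Longrightarrow> AE x in L. grad D (c *\<^sub>R v) x = c *\<^sub>R grad D v x"
  using grad_eq_AE[OF subspace_scale[OF subspace_L2] is_weak_grad_scale, of v]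
  by (simp add: H1_L2 is_weak_grad_grad)

definition H1_form :: "(real^'n \<Rightarrow> real^'n) \<Rightarrow> (real^'n \<Rightarrow> real^'n) \<Rightarrow> real" where
  "H1_form v w = (LINT x|L. v x \<bullet> w x) + (LINT x|L. grad D v x \<bullet> grad D w x)"

lemma H1_norm_eq: "H1_norm D = form_norm H1_form"
  by (rule ext) (simp add: H1_norm_def form_norm_def H1_form_def L2_norm_def power2_norm_eq_inner
      Bochner_Integration.integral_nonneg)

lemma psd_form_H1: "psd_form (H1 D) H1_form"
proof (rule psd_form.intro[OF subspace_H1])
  interpret P: psd_form "L2 L :: (real^'n \<Rightarrow> real^'n) set" "\<lambda>g h. LINT x|L. g x \<bullet> h x" by (rule psd_form_L2)
  interpret Q: psd_form "L2 L :: (real^'n \<Rightarrow> real^'n^'n) set" "\<lambda>g h. LINT x|L. g x \<bullet> h x" by (rule psd_form_L2)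
  fix u v w :: "real^'n \<Rightarrow> real^'n" and c :: real
  assume u: "u \<in> H1 D" and w: "w \<in> H1 D"
  note gu = grad_L2[OF u] and gw = grad_L2[OF w]
  have [measurable]: "grad D u \<in> borel_measurable L" "grad D w \<in> borel_measurable L"
    using gu gw by (auto simp: L2_def)
  show "H1_form u w = H1_form w u" by (simp add: H1_form_def inner_commute)
  show "0 \<le> H1_form u u" by (simp add: H1_form_def Bochner_Integration.integral_nonneg)
  have cu: "c *\<^sub>R u \<in> H1 D" using subspace_scale[OF subspace_H1 u] .
  have [measurable]: "grad D (c *\<^sub>R u) \<in> borel_measurable L" using grad_L2[OF cu] by (auto simp: L2_def)
  have "(LINT x|L. grad D (c *\<^sub>R u) x \<bullet> grad D w x) = (LINT x|L. (c *\<^sub>R grad D u x) \<bullet> grad D w x)"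
    using grad_scale[OF u, of c] by (intro integral_cong_AE) (auto elim: eventually_mono)
  then show "H1_form (c *\<^sub>R u) w = c * H1_form u w"
    by (simp add: H1_form_def distrib_left)
  assume v: "v \<in> H1 D"
  have uv: "u + v \<in> H1 D" using subspace_add[OF subspace_H1 u v] .
  have [measurable]: "grad D v \<in> borel_measurable L" "grad D (u + v) \<in> borel_measurable L"
    using grad_L2[OF v] grad_L2[OF uv] by (auto simp: L2_def)
  have "(LINT x|L. grad D (u + v) x \<bullet> grad D w x) = (LINT x|L. (grad D u + grad D v) x \<bullet> grad D w x)"
  proof (rule integral_cong_AE)
    show "AE x in L. grad D (u + v) x \<bullet> grad D w x = (grad D u + grad D v) x \<bullet> grad D w x"
      using grad_add[OF u v] by eventually_elim simp
    have "grad D u + grad D v \<in> borel_measurable L" by (simp add: plus_fun_def)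
    then show "(\<lambda>x. (grad D u + grad D v) x \<bullet> grad D w x) \<in> borel_measurable L"
      by (intro borel_measurable_inner) auto
  qed measurable
  then show "H1_form (u + v) w = H1_form u w + H1_form v w"
    unfolding H1_form_def
    by (simp only: P.add_left[OF H1_L2[OF u] H1_L2[OF v] H1_L2[OF w]] Q.add_left[OF gu grad_L2[OF v] gw])
qed

interpretation H1: psd_form "H1 D" H1_form by (rule psd_form_H1)

lemma H1_norm_sq: "v \<in> H1 D \<Longrightarrow> (H1_norm D v)\<^sup>2 = (L2_norm L v)\<^sup>2 + (L2_norm L (grad D v))\<^sup>2"
  by (simp add: H1_norm_def)

lemma grad_bound: "v \<in> H1 D \<Longrightarrow> L2_norm L (grad D v) \<le> 1 * H1_norm D v"
  by (simp add: H1_norm_def L2_norm_def)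

lemma ae_linear_grad:
  assumes S: "subspace S" "S \<subseteq> H1 D"
  shows "ae_linear S H1_form L (grad D) 1"
proof -
  interpret S: psd_form S H1_form by (rule H1.subset[OF S])
  show ?thesis
    using S(2) grad_bound
    by (intro ae_linear.intro psd_form_fun.intro S.psd_form_axioms ae_linear_axioms.intro
        grad_L2 grad_add grad_scale) (auto simp: H1_norm_eq)
qed

text \<open>Covers the symmetric gradient and the divergence at once; \<open>K\<close> bounds the
  operator norm of \<open>T\<close>.\<close>

lemma ae_linear_image_grad:
  fixes T :: "real^'n^'n \<Rightarrow> 'c::euclidean_space"
  assumes S: "subspace S" "S \<subseteq> H1 D" and T: "linear T" "\<And>z. norm (T z) \<le> K * norm z" "0 \<le> K"
  shows "ae_linear S H1_form L (\<lambda>v x. T (grad D v x)) K"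
proof -
  interpret S: ae_linear S H1_form L "grad D" 1 by (rule ae_linear_grad[OF S])
  show ?thesis
  proof
    fix a b c assume a: "a \<in> S"
    show "(\<lambda>x. T (grad D a x)) \<in> L2 L" using S.T_L2[OF a] by (rule L2_imageI[OF T(1)])
    show "AE x in L. T (grad D (c *\<^sub>R a) x) = c *\<^sub>R T (grad D a x)"
      using S.T_scale[OF a, of c] by eventually_elim (simp add: linear_scale[OF T(1)])
    show "L2_norm L (\<lambda>x. T (grad D a x)) \<le> K * form_norm H1_form a"
      using L2_norm_image_le[OF T(1) S.T_L2[OF a] T(2,3)] mult_left_mono[OF S.T_bound[OF a] T(3)] by simp
    assume b: "b \<in> S"
    show "AE x in L. T (grad D (a + b) x) = T (grad D a x) + T (grad D b x)"
      using S.T_add[OF a b] by eventually_elim (simp add: linear_add[OF T(1)])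
  qed
qed

section \<open>Linear vector fields multiplied by a component of a Sobolev function\<close>

definition spin :: "'n \<Rightarrow> real^'n^'n \<Rightarrow> (real^'n \<Rightarrow> real^'n) \<Rightarrow> real^'n \<Rightarrow> real^'n" where
  "spin k A v x = v x $ k *\<^sub>R (A *v x)"

text \<open>The product rule for the field \<open>v\<^sub>k A x\<close>, with \<open>G\<close> in
  the place of the weak gradient of \<open>v\<close>.\<close>

definition spin_grad :: "'n \<Rightarrow> real^'n^'n \<Rightarrow> (real^'n \<Rightarrow> real^'n) \<Rightarrow> (real^'n \<Rightarrow> real^'n^'n) \<Rightarrow> real^'n \<Rightarrow> real^'n^'n" where
  "spin_grad k A v G x = (\<chi> i j. G x $ k $ j * (A *v x) $ i + v x $ k * A $ i $ j)"

text \<open>The bound reaches the closure because it serves twice: in \<open>D\<close> for the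
  Sobolev norm and on the boundary for the trace.\<close>

lemma matrix_vector_bound:
  fixes A :: "real^'n^'n"
  obtains K where "0 \<le> K" "\<And>x. x \<in> closure D \<Longrightarrow> norm (A *v x) \<le> K" "\<And>i j. \<bar>A $ i $ j\<bar> \<le> K"
proof -
  have "compact ((\<lambda>x. A *v x) ` closure D)"
    using bounded_D by (intro compact_continuous_image)
      (auto intro: linear_continuous_on matrix_vector_mul_bounded_linear)
  then obtain K where K: "\<And>y. y \<in> (\<lambda>x. A *v x) ` closure D \<Longrightarrow> norm y \<le> K"
    using compact_imp_bounded bounded_iff by metis
  have A: "\<bar>A $ i $ j\<bar> \<le> norm A" for i j
    using component_le_norm_cart[of "A $ i" j] Finite_Cartesian_Product.norm_nth_le[of A i] by linarith
  show ?thesis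
  proof (rule that[of "max K (norm A)"])
    show "0 \<le> max K (norm A)" by (simp add: le_max_iff_disj)
    show "norm (A *v x) \<le> max K (norm A)" if "x \<in> closure D" for x
      using K that by (simp add: le_max_iff_disj)
    show "\<bar>A $ i $ j\<bar> \<le> max K (norm A)" for i j using A by (simp add: le_max_iff_disj)
  qed
qed

text \<open>The linear factor is moved into the test function: \<open>(A *v x) $ i\<close> times a
  test function is again one, and the weak gradient of \<open>v\<close> is tested with it.\<close>

lemma spin_weak_grad:
  assumes v: "v \<in> L2 L" "is_weak_grad D v G"
    and GL: "spin_grad k A v G \<in> L2 L"
  shows "is_weak_grad D (spin k A v) (spin_grad k A v G)"
  unfolding is_weak_grad_def
proof (intro conjI ballI allI GL)
  fix \<phi> i j assume \<phi>: "\<phi> \<in> test_functions D"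
  let ?\<psi> = "\<lambda>x::real^'n. (A *v x) $ i"
  have G: "G \<in> L2 L" using v by (simp add: is_weak_grad_def)
  note s\<phi> = test_functions_smooth[OF \<phi>]
  have prod: "(\<lambda>x. ?\<psi> x * \<phi> x) \<in> test_functions D" by (rule test_functions_smooth_mult[OF smooth_linear \<phi>])
  have int: "integrable L (\<lambda>x. v x $ k * pderivative j (\<lambda>x. ?\<psi> x * \<phi> x) x)"
    "integrable L (\<lambda>x. v x $ k * (A $ i $ j * \<phi> x))"
    "integrable L (\<lambda>x. G x $ k $ j * (?\<psi> x * \<phi> x))"
    using v G s\<phi> by (auto intro!: integrable_mult_smooth L2_nth L2_nth_nth smooth_pderivative smooth_intros smooth_linear)
  have "(LINT x|L. spin k A v x $ i * pderivative j \<phi> x)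
      = (LINT x|L. v x $ k * pderivative j (\<lambda>x. ?\<psi> x * \<phi> x) x - v x $ k * (A $ i $ j * \<phi> x))"
    unfolding pderivative_smooth_mult[OF smooth_linear s\<phi>] pderivative_linear
    by (intro Bochner_Integration.integral_cong refl) (simp add: spin_def algebra_simps)
  also have "\<dots> = - (LINT x|L. G x $ k $ j * (?\<psi> x * \<phi> x)) - (LINT x|L. v x $ k * (A $ i $ j * \<phi> x))"
    using v(2) prod int by (simp add: is_weak_grad_def)
  also have "\<dots> = - (LINT x|L. G x $ k $ j * (?\<psi> x * \<phi> x) + v x $ k * (A $ i $ j * \<phi> x))"
    using int by simp
  also have "\<dots> = - (LINT x|L. spin_grad k A v G x $ i $ j * \<phi> x)"
    by (simp add: spin_grad_def distrib_right mult.assoc)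
  finally show "(LINT x|L. spin k A v x $ i * pderivative j \<phi> x) = - (LINT x|L. spin_grad k A v G x $ i $ j * \<phi> x)" .
qed

lemma spin_H1:
  obtains C where "\<And>v. v \<in> H1 D \<Longrightarrow> spin k A v \<in> H1 D" "\<And>v. v \<in> H1 D \<Longrightarrow> H1_norm D (spin k A v) \<le> C * H1_norm D v"
    "\<And>v. v \<in> H1 D \<Longrightarrow> AE x in L. grad D (spin k A v) x = spin_grad k A v (grad D v) x"
proof -
  obtain K where K: "0 \<le> K" "\<And>x. x \<in> closure D \<Longrightarrow> norm (A *v x) \<le> K" "\<And>i j. \<bar>A $ i $ j\<bar> \<le> K"
    using matrix_vector_bound by metis
  define C where "C = (real CARD('n))\<^sup>2 * K"
  have n: "1 \<le> (real CARD('n))\<^sup>2" by (simp add: one_le_power Suc_leI)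
  have C: "0 \<le> C" "K \<le> C" using K(1) mult_right_mono[OF n K(1)] by (auto simp: C_def)
  have space: "space L = D" by simp
  have mA [measurable]: "(\<lambda>x. A *v x) \<in> borel_measurable L"
    using D_lmeasurable by (intro continuous_imp_measurable_on_sets_lebesgue)
      (auto intro: linear_continuous_on matrix_vector_mul_bounded_linear)
  have main: "spin k A v \<in> H1 D \<and> H1_norm D (spin k A v) \<le> sqrt (6 * C\<^sup>2) * H1_norm D v \<and>
      (AE x in L. grad D (spin k A v) x = spin_grad k A v (grad D v) x)" if v: "v \<in> H1 D" for v
  proof -
    let ?G = "grad D v" and ?s = "spin k A v"
    let ?sg = "spin_grad k A v ?G"
    note vL = H1_L2[OF v] and G = grad_L2[OF v]
    have [measurable]: "(\<lambda>x. v x $ i) \<in> borel_measurable L" "(\<lambda>x. ?G x $ i $ j) \<in> borel_measurable L" for i j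
      using L2_nth[OF vL] L2_nth_nth[OF G] by (auto simp: L2_def)
    have [measurable]: "(\<lambda>x. (A *v x) $ i) \<in> borel_measurable L" for i
      using continuous_L2[OF smooth_continuous[OF smooth_linear]] by (auto simp: L2_def)
    have s_meas: "?s \<in> borel_measurable L" unfolding spin_def by measurable
    have s_le: "norm (?s x) \<le> C * (norm (v x) + norm (v x))" if "x \<in> space L" for x
    proof -
      have x: "x \<in> closure D" using that closure_subset by auto
      have "norm (?s x) = \<bar>v x $ k\<bar> * norm (A *v x)" by (simp add: spin_def)
      also have "\<dots> \<le> norm (v x) * C"
        using K(2)[OF x] C component_le_norm_cart[of "v x" k] by (intro mult_mono) auto
      also have "\<dots> \<le> C * (norm (v x) + norm (v x))" using C by (simp add: distrib_left)
      finally show ?thesis .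
    qed
    note sL = L2_pointwise_bound[OF s_meas vL vL s_le]
    have sg_meas: "?sg \<in> borel_measurable L" unfolding spin_grad_def by (rule borel_measurable_matrix) simp
    have sg_le: "norm (?sg x) \<le> C * (norm (?G x) + norm (v x))" if "x \<in> space L" for x
    proof -
      have x: "x \<in> closure D" using that closure_subset by auto
      have "\<bar>?sg x $ i $ j\<bar> \<le> K * (norm (?G x) + norm (v x))" for i j
      proof -
        have "\<bar>?sg x $ i $ j\<bar> \<le> \<bar>?G x $ k $ j\<bar> * \<bar>(A *v x) $ i\<bar> + \<bar>v x $ k\<bar> * \<bar>A $ i $ j\<bar>"
          by (simp add: spin_grad_def abs_mult[symmetric])
        also have "\<dots> \<le> norm (?G x) * K + norm (v x) * K"
          using K component_le_norm_cart[of "v x" k] component_le_norm_cart[of "?G x $ k" j] Finite_Cartesian_Product.norm_nth_le[of "?G x" k]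
            component_le_norm_cart[of "A *v x" i] K(2)[OF x]
          by (intro add_mono mult_mono) auto
        finally show ?thesis by (simp add: algebra_simps)
      qed
      then show ?thesis unfolding C_def mult.assoc by (rule norm_matrix_le)
    qed
    note sgL = L2_pointwise_bound[OF sg_meas G vL sg_le]
    note wg = spin_weak_grad[OF vL is_weak_grad_grad[OF v] sgL(1)]
    have sH: "?s \<in> H1 D" using sL(1) wg by (rule H1I)
    have ae: "AE x in L. grad D ?s x = ?sg x" by (rule grad_eq_AE[OF sL(1) wg])
    have "(H1_norm D ?s)\<^sup>2 = (L2_norm L ?s)\<^sup>2 + (L2_norm L ?sg)\<^sup>2"
      using L2_norm_cong[OF ae grad_L2[OF sH] sgL(1)] by (simp add: H1_norm_sq[OF sH])
    also have "\<dots> \<le> 2 * C\<^sup>2 * ((L2_norm L v)\<^sup>2 + (L2_norm L v)\<^sup>2) + 2 * C\<^sup>2 * ((L2_norm L ?G)\<^sup>2 + (L2_norm L v)\<^sup>2)"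
      using sL(2) sgL(2) by (rule add_mono)
    \<comment> \<open>The square of the norm of \<open>v\<close> is counted three times, twice for
      the field and once for its gradient, each time with the factor
      \<open>2 * C\<^sup>2\<close>.\<close>
    also have "\<dots> \<le> 6 * C\<^sup>2 * (H1_norm D v)\<^sup>2"
      by (simp add: H1_norm_sq[OF v] algebra_simps)
    finally have "H1_norm D ?s \<le> sqrt (6 * C\<^sup>2 * (H1_norm D v)\<^sup>2)" by (rule real_le_rsqrt)
    also have "\<dots> = sqrt (6 * C\<^sup>2) * H1_norm D v" by (simp add: real_sqrt_mult H1_norm_def)
    finally show ?thesis using sH ae by blast
  qed
  then show ?thesis using that[of "sqrt (6 * C\<^sup>2)"] by blast
qed

end

section \<open>The trace and Korn's inequality\<close>

lemma sets_hausdorff_measure: "sets (hausdorff_measure k :: 'a::metric_space measure) = sets borel"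
  unfolding hausdorff_measure_def using sets.sets_measure_of_eq[of "borel :: 'a measure"] by simp

text \<open>Pointwise domination by two convergent boundary defects. Linear combinations use it with
  two different sequences, \<open>spin\<close> with the same sequence twice.\<close>

lemma trace_defect_tendsto_0:
  fixes \<sigma> :: "(real^'n) measure" and \<phi> \<phi>' \<Phi> :: "nat \<Rightarrow> real^'n \<Rightarrow> real^'n"
  assumes [measurable]: "\<And>n. \<phi> n \<in> borel_measurable \<sigma>" "\<And>n. \<phi>' n \<in> borel_measurable \<sigma>"
    "g \<in> borel_measurable \<sigma>" "g' \<in> borel_measurable \<sigma>" "F \<in> sets \<sigma>"
    and lim: "(\<lambda>n. \<integral>\<^sup>+x\<in>F. ennreal ((norm (\<phi> n x - g x))\<^sup>2) \<partial>\<sigma>) \<longlonglongrightarrow> 0"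
      "(\<lambda>n. \<integral>\<^sup>+x\<in>F. ennreal ((norm (\<phi>' n x - g' x))\<^sup>2) \<partial>\<sigma>) \<longlonglongrightarrow> 0"
    and c: "0 \<le> c" and le: "\<And>n x. x \<in> F \<Longrightarrow>
      (norm (\<Phi> n x - \<gamma> x))\<^sup>2 \<le> c * ((norm (\<phi> n x - g x))\<^sup>2 + (norm (\<phi>' n x - g' x))\<^sup>2)"
  shows "(\<lambda>n. \<integral>\<^sup>+x\<in>F. ennreal ((norm (\<Phi> n x - \<gamma> x))\<^sup>2) \<partial>\<sigma>) \<longlonglongrightarrow> 0"
proof -
  let ?a = "\<lambda>n. \<integral>\<^sup>+x\<in>F. ennreal ((norm (\<phi> n x - g x))\<^sup>2) \<partial>\<sigma>"
    and ?b = "\<lambda>n. \<integral>\<^sup>+x\<in>F. ennreal ((norm (\<phi>' n x - g' x))\<^sup>2) \<partial>\<sigma>"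
  have bound: "(\<integral>\<^sup>+x\<in>F. ennreal ((norm (\<Phi> n x - \<gamma> x))\<^sup>2) \<partial>\<sigma>) \<le> ennreal c * (?a n + ?b n)" for n
  proof -
    have "(\<integral>\<^sup>+x\<in>F. ennreal ((norm (\<Phi> n x - \<gamma> x))\<^sup>2) \<partial>\<sigma>)
      \<le> (\<integral>\<^sup>+x. ennreal c * (ennreal ((norm (\<phi> n x - g x))\<^sup>2) * indicator F x
          + ennreal ((norm (\<phi>' n x - g' x))\<^sup>2) * indicator F x) \<partial>\<sigma>)"
      using le c by (intro nn_integral_mono)
        (auto simp: indicator_def ennreal_mult[symmetric] ennreal_plus[symmetric] simp del: ennreal_plus intro!: ennreal_leI)
    also have "\<dots> = ennreal c * (?a n + ?b n)"
      by (subst nn_integral_cmult, measurable) (subst nn_integral_add, measurable)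
    finally show ?thesis .
  qed
  have "(\<lambda>n. ennreal c * (?a n + ?b n)) \<longlonglongrightarrow> ennreal c * (0 + 0)"
    by (intro ennreal_tendsto_cmult tendsto_add lim) simp
  then have lim0: "(\<lambda>n. ennreal c * (?a n + ?b n)) \<longlonglongrightarrow> 0" by simp
  show ?thesis
    by (rule tendsto_sandwich[OF _ _ tendsto_const lim0])
       (rule always_eventually, rule allI, rule zero_le bound)+
qed

lemma smooth_components_measurable:
  fixes \<phi> :: "real^'n \<Rightarrow> real^'n"
  assumes "\<And>i. smooth (\<lambda>x. \<phi> x $ i)" shows "\<phi> \<in> borel_measurable borel"
proof -
  have "(\<lambda>x. \<phi> x $ i) \<in> borel_measurable borel" for i
    using smooth_continuous[OF assms] by (rule borel_measurable_continuous_onI)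
  then show ?thesis
    by (subst borel_measurable_euclidean_space) (auto simp: Basis_vec_def inner_axis)
qed

lemma has_traceD:
  fixes D :: "(real^'n) set"
  assumes "has_trace D v g"
  obtains \<phi> where "\<And>n i. smooth (\<lambda>x. \<phi> n x $ i)" "\<And>n::nat. \<phi> n \<in> H1 D"
    "(\<lambda>n. H1_norm D (\<phi> n - v)) \<longlonglongrightarrow> 0" "\<And>n. \<phi> n \<in> borel_measurable (hausdorff_measure (CARD('n) - 1))"
    "g \<in> borel_measurable (hausdorff_measure (CARD('n) - 1))"
    "(\<lambda>n. \<integral>\<^sup>+x\<in>frontier D. ennreal ((norm (\<phi> n x - g x))\<^sup>2) \<partial>hausdorff_measure (CARD('n) - 1)) \<longlonglongrightarrow> 0"
proof -
  obtain \<phi> where \<phi>: "\<And>n i. smooth (\<lambda>x. \<phi> n x $ i)" "\<And>n::nat. \<phi> n \<in> H1 D"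
    "(\<lambda>n. H1_norm D (\<phi> n - v)) \<longlonglongrightarrow> 0" 
    "(\<lambda>n. \<integral>\<^sup>+x\<in>frontier D. ennreal ((norm (\<phi> n x - g x))\<^sup>2) \<partial>hausdorff_measure (CARD('n) - 1)) \<longlonglongrightarrow> 0"
    using assms by (auto simp: has_trace_def)
  have "f \<in> borel_measurable (hausdorff_measure (CARD('n) - 1))" if "f \<in> borel_measurable borel" for f :: "real^'n \<Rightarrow> real^'n"
    using that by (simp add: measurable_cong_sets[OF sets_hausdorff_measure refl])
  note meas = this
  have "g \<in> borel_measurable borel" using assms unfolding has_trace_def by (rule conjunct1)
  then show ?thesis
    by (rule that[OF \<phi>(1,2,3) meas[OF smooth_components_measurable[OF \<phi>(1)]] meas \<phi>(4)])
qed

context bounded_open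
begin

interpretation H1: psd_form "H1 D" H1_form by (rule psd_form_H1)

abbreviation "\<sigma> \<equiv> hausdorff_measure (CARD('n) - 1) :: (real^'n) measure"

lemma frontier_sets: "frontier D \<in> sets \<sigma>"
  by (simp add: sets_hausdorff_measure)

text \<open>Sum and multiple are treated together, so that smooth approximants and their boundary
  limit are combined only once.\<close>

lemma H1_E0_combination:
  assumes v: "v \<in> H1_E0 D DD" and w: "w \<in> H1_E0 D DD" shows "c *\<^sub>R v + w \<in> H1_E0 D DD"
proof -
  have H: "v \<in> H1 D" "w \<in> H1 D" using v w by (auto simp: H1_E0_def)
  obtain g where g: "has_trace D v g" "AE x in \<sigma>. x \<in> DD \<longrightarrow> g x = 0"
    using v by (auto simp: H1_E0_def)
  obtain h where h: "has_trace D w h" "AE x in \<sigma>. x \<in> DD \<longrightarrow> h x = 0"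
    using w by (auto simp: H1_E0_def)
  obtain \<phi> where \<phi>: "\<And>n i. smooth (\<lambda>x. \<phi> n x $ i)" "\<And>n::nat. \<phi> n \<in> H1 D"
    "(\<lambda>n. H1_norm D (\<phi> n - v)) \<longlonglongrightarrow> 0" "\<And>n. \<phi> n \<in> borel_measurable \<sigma>" "g \<in> borel_measurable \<sigma>"
    "(\<lambda>n. \<integral>\<^sup>+x\<in>frontier D. ennreal ((norm (\<phi> n x - g x))\<^sup>2) \<partial>\<sigma>) \<longlonglongrightarrow> 0"
    using has_traceD[OF g(1)] by blast
  obtain \<psi> where \<psi>: "\<And>n i. smooth (\<lambda>x. \<psi> n x $ i)" "\<And>n::nat. \<psi> n \<in> H1 D"
    "(\<lambda>n. H1_norm D (\<psi> n - w)) \<longlonglongrightarrow> 0" "\<And>n. \<psi> n \<in> borel_measurable \<sigma>" "h \<in> borel_measurable \<sigma>"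
    "(\<lambda>n. \<integral>\<^sup>+x\<in>frontier D. ennreal ((norm (\<psi> n x - h x))\<^sup>2) \<partial>\<sigma>) \<longlonglongrightarrow> 0"
    using has_traceD[OF h(1)] by blast
  have "has_trace D (c *\<^sub>R v + w) (c *\<^sub>R g + h)"
    unfolding has_trace_def
  proof (intro conjI exI[of _ "\<lambda>n. c *\<^sub>R \<phi> n + \<psi> n"] allI)
    show "c *\<^sub>R g + h \<in> borel_measurable borel"
      using g(1) h(1) by (auto simp: has_trace_def plus_fun_def scaleR_fun_def)
    fix n show "smooth (\<lambda>x. (c *\<^sub>R \<phi> n + \<psi> n) x $ i)" for i
      using smooth_intros(3)[OF smooth_intros(4)[OF smooth_intros(1) \<phi>(1)] \<psi>(1)] by simp
    show "c *\<^sub>R \<phi> n + \<psi> n \<in> H1 D" using \<phi> \<psi> by (intro H1.closed)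
  next
    show "(\<lambda>n. H1_norm D (c *\<^sub>R \<phi> n + \<psi> n - (c *\<^sub>R v + w))) \<longlonglongrightarrow> 0"
    proof (rule Lim_null_comparison)
      show "\<forall>\<^sub>F n in sequentially. norm (H1_norm D (c *\<^sub>R \<phi> n + \<psi> n - (c *\<^sub>R v + w)))
          \<le> \<bar>c\<bar> * H1_norm D (\<phi> n - v) + H1_norm D (\<psi> n - w)"
      proof (intro always_eventually allI)
        fix n
        have d: "\<phi> n - v \<in> H1 D" "\<psi> n - w \<in> H1 D" using \<phi> \<psi> H by (auto intro: H1.closed)
        have cd: "c *\<^sub>R (\<phi> n - v) \<in> H1 D" by (rule H1.closed(3)[OF d(1)])
        have "c *\<^sub>R \<phi> n + \<psi> n - (c *\<^sub>R v + w) = c *\<^sub>R (\<phi> n - v) + (\<psi> n - w)"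
          by (simp add: fun_eq_iff scaleR_diff_right)
        then show "norm (H1_norm D (c *\<^sub>R \<phi> n + \<psi> n - (c *\<^sub>R v + w)))
          \<le> \<bar>c\<bar> * H1_norm D (\<phi> n - v) + H1_norm D (\<psi> n - w)"
          using H1.form_norm_triangle[OF cd d(2)] H1.form_norm_nonneg[OF H1.closed(2)[OF cd d(2)]]
          by (simp only: H1_norm_eq real_norm_def abs_of_nonneg H1.form_norm_scale[OF d(1)])
      qed
      show "(\<lambda>n. \<bar>c\<bar> * H1_norm D (\<phi> n - v) + H1_norm D (\<psi> n - w)) \<longlonglongrightarrow> 0"
        using tendsto_add[OF tendsto_mult_right_zero[OF \<phi>(3)] \<psi>(3)] by simp
    qed
    show "(\<lambda>n. \<integral>\<^sup>+x\<in>frontier D. ennreal ((norm ((c *\<^sub>R \<phi> n + \<psi> n) x - (c *\<^sub>R g + h) x))\<^sup>2) \<partial>\<sigma>) \<longlonglongrightarrow> 0"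
    proof (rule trace_defect_tendsto_0[OF \<phi>(4) \<psi>(4) \<phi>(5) \<psi>(5) frontier_sets \<phi>(6) \<psi>(6), of "c\<^sup>2 + 1"])
      fix n x
      let ?a = "\<phi> n x - g x" and ?b = "\<psi> n x - h x"
      have "(norm (c *\<^sub>R ?a + ?b))\<^sup>2 \<le> (\<bar>c\<bar> * norm ?a + 1 * norm ?b)\<^sup>2"
        using norm_triangle_ineq[of "c *\<^sub>R ?a" ?b] by (intro power_mono) auto
      also note sum2_power2_le
      finally show "(norm ((c *\<^sub>R \<phi> n + \<psi> n) x - (c *\<^sub>R g + h) x))\<^sup>2 \<le> (c\<^sup>2 + 1) * ((norm ?a)\<^sup>2 + (norm ?b)\<^sup>2)"
        by (simp add: scaleR_diff_right algebra_simps)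
    qed simp
  qed
  moreover have "AE x in \<sigma>. x \<in> DD \<longrightarrow> (c *\<^sub>R g + h) x = 0" using g(2) h(2) by eventually_elim simp
  ultimately show ?thesis using H H1.closed by (auto simp: H1_E0_def)
qed

lemma subspace_H1_E0: "subspace (H1_E0 D DD)"
proof (rule subspaceI)
  have "has_trace D 0 (\<lambda>_. 0)"
    unfolding has_trace_def H1_norm_eq
    by (rule conjI, simp, rule exI[of _ "\<lambda>_. 0"])
       (simp add: smooth_intros H1.closed form_norm_def H1.zero_left H1.closed[unfolded zero_fun_def])
  then show zero: "0 \<in> H1_E0 D DD" by (auto simp: H1_E0_def H1.closed)
  fix v w c assume v: "v \<in> H1_E0 D DD"
  show "c *\<^sub>R v \<in> H1_E0 D DD" using H1_E0_combination[OF v zero, of c] by simp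
  assume "w \<in> H1_E0 D DD"
  then show "v + w \<in> H1_E0 D DD" using H1_E0_combination[OF v, of w 1] by simp
qed

text \<open>\<open>spin\<close> can be applied to the smooth approximants themselves: it keeps them
  smooth and is continuous both in the Sobolev norm and on the boundary. The resulting trace is
  \<open>spin k A g\<close>, which vanishes wherever \<open>g\<close> does.\<close>

lemma spin_H1_E0:
  assumes v: "v \<in> H1_E0 D DD" shows "spin k A v \<in> H1_E0 D DD"
proof -
  have H: "v \<in> H1 D" using v by (auto simp: H1_E0_def)
  obtain g where g: "has_trace D v g" "AE x in \<sigma>. x \<in> DD \<longrightarrow> g x = 0"
    using v by (auto simp: H1_E0_def)
  obtain \<phi> where \<phi>: "\<And>n i. smooth (\<lambda>x. \<phi> n x $ i)" "\<And>n::nat. \<phi> n \<in> H1 D"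
    "(\<lambda>n. H1_norm D (\<phi> n - v)) \<longlonglongrightarrow> 0" "\<And>n. \<phi> n \<in> borel_measurable \<sigma>" "g \<in> borel_measurable \<sigma>"
    "(\<lambda>n. \<integral>\<^sup>+x\<in>frontier D. ennreal ((norm (\<phi> n x - g x))\<^sup>2) \<partial>\<sigma>) \<longlonglongrightarrow> 0"
    using has_traceD[OF g(1)] by blast
  obtain C where C: "\<And>v. v \<in> H1 D \<Longrightarrow> spin k A v \<in> H1 D" "\<And>v. v \<in> H1 D \<Longrightarrow> H1_norm D (spin k A v) \<le> C * H1_norm D v"
    using spin_H1[of k A] by metis
  obtain K where K: "0 \<le> K" "\<And>x. x \<in> closure D \<Longrightarrow> norm (A *v x) \<le> K"
    using matrix_vector_bound by metis
  have diff: "spin k A u - spin k A w = spin k A (u - w)" for u w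
    by (auto simp: spin_def fun_eq_iff scaleR_diff_left)
  have "has_trace D (spin k A v) (spin k A g)"
    unfolding has_trace_def
  proof (intro conjI exI[of _ "\<lambda>n. spin k A (\<phi> n)"] allI)
    have [measurable]: "g \<in> borel_measurable borel" using g(1) by (auto simp: has_trace_def)
    have [measurable]: "(\<lambda>x. A *v x) \<in> borel_measurable borel"
      by (intro borel_measurable_continuous_onI linear_continuous_on matrix_vector_mul_bounded_linear)
    have [measurable]: "(\<lambda>x. g x $ k) \<in> borel_measurable borel"
      by (rule measurable_compose[OF _ borel_measurable_continuous_onI]) (auto intro: continuous_intros)
    show "spin k A g \<in> borel_measurable borel" unfolding spin_def by measurable
    fix n show "smooth (\<lambda>x. spin k A (\<phi> n) x $ i)" for i
      using smooth_intros(4)[OF \<phi>(1) smooth_linear] by (simp add: spin_def)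
    show "spin k A (\<phi> n) \<in> H1 D" using \<phi> C by blast
  next
    show "(\<lambda>n. H1_norm D (spin k A (\<phi> n) - spin k A v)) \<longlonglongrightarrow> 0"
    proof (rule Lim_null_comparison)
      show "\<forall>\<^sub>F n in sequentially. norm (H1_norm D (spin k A (\<phi> n) - spin k A v)) \<le> C * H1_norm D (\<phi> n - v)"
        unfolding diff using C(2)[OF H1.closed(4)[OF \<phi>(2) H]] by (simp add: H1_norm_def)
      show "(\<lambda>n. C * H1_norm D (\<phi> n - v)) \<longlonglongrightarrow> 0"
        using tendsto_mult_right_zero[OF \<phi>(3)] by simp
    qed
    show "(\<lambda>n. \<integral>\<^sup>+x\<in>frontier D. ennreal ((norm (spin k A (\<phi> n) x - spin k A g x))\<^sup>2) \<partial>\<sigma>) \<longlonglongrightarrow> 0"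
    proof (rule trace_defect_tendsto_0[OF \<phi>(4) \<phi>(4) \<phi>(5) \<phi>(5) frontier_sets \<phi>(6) \<phi>(6), of "K\<^sup>2"])
      fix n x assume "x \<in> frontier D"
      then have x: "x \<in> closure D" by (simp add: frontier_def)
      have "norm (spin k A (\<phi> n) x - spin k A g x) = \<bar>(\<phi> n x - g x) $ k\<bar> * norm (A *v x)"
        by (simp add: spin_def flip: scaleR_diff_left)
      also have "\<dots> \<le> norm (\<phi> n x - g x) * K"
        using K(1) K(2)[OF x] component_le_norm_cart[of "\<phi> n x - g x" k] by (intro mult_mono) auto
      finally have "(norm (spin k A (\<phi> n) x - spin k A g x))\<^sup>2 \<le> (norm (\<phi> n x - g x) * K)\<^sup>2"
        by (intro power_mono) auto
      also have "\<dots> = K\<^sup>2 * (norm (\<phi> n x - g x))\<^sup>2" by (simp add: power_mult_distrib mult.commute)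
      also have "\<dots> \<le> K\<^sup>2 * ((norm (\<phi> n x - g x))\<^sup>2 + (norm (\<phi> n x - g x))\<^sup>2)"
        by (intro mult_left_mono) auto
      finally show "(norm (spin k A (\<phi> n) x - spin k A g x))\<^sup>2
          \<le> K\<^sup>2 * ((norm (\<phi> n x - g x))\<^sup>2 + (norm (\<phi> n x - g x))\<^sup>2)" .
    qed simp
  qed
  moreover have "AE x in \<sigma>. x \<in> DD \<longrightarrow> spin k A g x = 0"
    using g(2) by eventually_elim (simp add: spin_def)
  ultimately show ?thesis using C(1)[OF H] by (auto simp: H1_E0_def)
qed

text \<open>If \<open>v\<close> has zero gradient and vanishing trace, so does the infinitesimal rotation \<open>A x\<close> modulated
  by a component of \<open>v\<close>. Its symmetric gradient vanishes but its gradient is \<open>v\<^sub>k A\<close>, so that Korn's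
  inequality forces \<open>v\<^sub>k = 0\<close>; neither the trace theorem nor the connectedness of \<open>D\<close> is needed.\<close>
lemma zero_gradient_imp_zero:
  assumes n: "2 \<le> CARD('n)" and korn: "korn_constant D DD C"
    and v: "v \<in> H1_E0 D DD" and grad0: "AE x in L. grad D v x = 0"
  shows "zero_ae D v"
proof -
  have H: "v \<in> H1 D" using v by (auto simp: H1_E0_def)
  \<comment> \<open>Two distinct coordinates are what a nonzero skew matrix takes, hence the
    dimension of at least 2.\<close>
  obtain p q :: 'n where pq: "p \<noteq> q"
    using n by (metis card_2_iff' UNIV_I card_le_Suc0_iff_eq finite_class.finite_UNIV not_less_eq_eq numeral_2_eq_2)
  define A :: "real^'n^'n" where "A = (\<chi> i j. if i = p \<and> j = q then 1 else if i = q \<and> j = p then -1 else 0)"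
  have skew: "transpose A = - A" using pq by (auto simp: A_def transpose_def vec_eq_iff)
  have "A $ p $ q = 1" by (simp add: A_def)
  then have A0: "A \<noteq> 0" by auto
  have "AE x in L. v x $ k = 0" for k
  proof -
    obtain K where s: "spin k A v \<in> H1 D" "AE x in L. grad D (spin k A v) x = spin_grad k A v (grad D v) x"
      using spin_H1[of k A] H by metis
    have g: "AE x in L. grad D (spin k A v) x = v x $ k *\<^sub>R A"
      using s(2) grad0 by eventually_elim (auto simp: spin_grad_def vec_eq_iff)
    have "transpose (r *\<^sub>R A) = r *\<^sub>R transpose A" for r
      by (simp add: transpose_def vec_eq_iff)
    then have t: "transpose (r *\<^sub>R A) = - (r *\<^sub>R A)" for r by (simp add: skew)
    have e: "AE x in L. symgrad D (spin k A v) x \<bullet> symgrad D (spin k A v) x = 0"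
      using g
    proof eventually_elim
      fix x assume "grad D (spin k A v) x = v x $ k *\<^sub>R A"
      then show "symgrad D (spin k A v) x \<bullet> symgrad D (spin k A v) x = 0"
        unfolding symgrad_def by (simp only: t) simp
    qed
    have e0: "(LINT x|L. symgrad D (spin k A v) x \<bullet> symgrad D (spin k A v) x) = 0"
      using integral_eq_zero_AE[OF e] .
    have "C * (L2_norm L (grad D (spin k A v)))\<^sup>2 \<le> 0" "0 < C"
      using korn spin_H1_E0[OF v, of k A] e0 unfolding korn_constant_def by auto
    then have "(L2_norm L (grad D (spin k A v)))\<^sup>2 = 0"
      by (metis mult_le_0_iff not_less zero_le_power2 antisym less_eq_real_def)
    then have "(LINT x|L. (norm (grad D (spin k A v) x))\<^sup>2) = 0"
      by (simp add: L2_norm_def)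
    then have "AE x in L. (norm (grad D (spin k A v) x))\<^sup>2 = 0"
      using grad_L2[OF s(1)] by (subst (asm) integral_nonneg_eq_0_iff_AE) (auto simp: L2_def)
    then show ?thesis using g by eventually_elim (use A0 in auto)
  qed
  then have "AE x in L. \<forall>k. v x $ k = 0" by (intro AE_all_countable[THEN iffD2]) blast
  then show ?thesis unfolding zero_ae_def by eventually_elim (simp add: vec_eq_iff)
qed

end

section \<open>Legendre polynomials\<close>

abbreviation uniform1 :: "real measure" where
  "uniform1 \<equiv> uniform_measure (restrict_space lborel {-1..1}) {-1..1}"

lemma emeasure_restrict_interval: "emeasure (restrict_space lborel {-1..1}) {-1..1::real} = ennreal 2"
  by (subst emeasure_restrict_space) auto

lemma prob_space_uniform1: "prob_space uniform1"
  by (rule prob_space_uniform_measure) (auto simp: emeasure_restrict_interval)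

lemma space_uniform1: "space uniform1 = {-1..1}"
  by (simp add: uniform_measure_def)

lemma continuous_measurable_uniform1: "continuous_on UNIV f \<Longrightarrow> (f :: real \<Rightarrow> real) \<in> borel_measurable uniform1"
  by (simp add: uniform_measure_def measurable_restrict_space1 borel_measurable_continuous_onI)

lemma integrable_uniform1:
  assumes "continuous_on UNIV (f :: real \<Rightarrow> real)" shows "integrable uniform1 f"
proof -
  interpret prob_space uniform1 by (rule prob_space_uniform1)
  have "compact (f ` {-1..1})" using assms by (intro compact_continuous_image) (auto intro: continuous_on_subset)
  then obtain B where "\<And>y. y \<in> f ` {-1..1} \<Longrightarrow> norm y \<le> B"
    using compact_imp_bounded bounded_iff by metis
  then show ?thesis
    using continuous_measurable_uniform1[OF assms]
    by (intro integrable_const_bound[of _ B] AE_I2) (auto simp: space_uniform1)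
qed

lemma integral_uniform1_deriv:
  assumes "\<And>t. (F has_real_derivative f t) (at t)" "continuous_on UNIV f"
  shows "(LINT t|uniform1. f t) = (F 1 - F (-1)) / 2"
proof -
  have [measurable]: "f \<in> borel_measurable borel" using assms(2) by (rule borel_measurable_continuous_onI)
  have "uniform1 = density (restrict_space lborel {-1..1}) (\<lambda>x. ennreal (indicator {-1..1} x / 2))"
    unfolding uniform_measure_def emeasure_restrict_interval
    by (intro arg_cong[of _ _ "density _"] ext)
       (auto simp: indicator_def divide_ennreal[of 1 2, simplified])
  then have "(LINT t|uniform1. f t) = (LINT t|restrict_space lborel {-1..1}. indicator {-1..1} t / 2 * f t)"
    by (simp only:) (subst integral_density, auto intro!: measurable_restrict_space1)
  also have "\<dots> = (LINT t|lborel. (f t * indicator {-1..1} t) / 2)"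
    by (subst integral_restrict_space) (auto intro!: Bochner_Integration.integral_cong simp: indicator_def)
  also have "\<dots> = (F 1 - F (-1)) / 2"
    by (simp, rule integral_FTC_Icc_real)
       (use assms in \<open>auto intro: continuous_on_subset continuous_on_interior simp: continuous_on_eq_continuous_at\<close>)
  finally show ?thesis .
qed

lemma integral_uniform1_pderiv:
  "(LINT t|uniform1. poly (pderiv p) t) = (poly p 1 - poly p (-1)) / 2"
  by (rule integral_uniform1_deriv) (auto intro: poly_DERIV continuous_intros)

lemma integral_by_parts_uniform1:
  assumes "poly p 1 = 0" "poly p (-1) = 0"
  shows "(LINT t|uniform1. poly (pderiv p * r) t) = - (LINT t|uniform1. poly (p * pderiv r) t)"
proof -
  have "(LINT t|uniform1. poly (pderiv p * r) t) + (LINT t|uniform1. poly (p * pderiv r) t)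
      = (LINT t|uniform1. poly (pderiv (p * r)) t)"
    by (subst Bochner_Integration.integral_add[symmetric])
       (auto intro!: integrable_uniform1 continuous_intros Bochner_Integration.integral_cong simp: pderiv_mult)
  also have "\<dots> = 0" using assms by (simp add: integral_uniform1_pderiv)
  finally show ?thesis by linarith
qed

text \<open>Each differentiation lowers the order of vanishing by at most one. The exponent
  \<open>k\<close> is free because the induction needs one more power before the derivative than
  after it.\<close>

lemma power_dvd_pderiv_power:
  fixes q :: "real poly"
  shows "j + k \<le> n \<Longrightarrow> q ^ k dvd (pderiv ^^ j) (q ^ n)"
proof (induction j arbitrary: k)
  case 0
  then show ?case by (simp add: le_imp_power_dvd)
next
  case (Suc j)
  then have "q ^ Suc k dvd (pderiv ^^ j) (q ^ n)" by (intro Suc.IH) simp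
  then obtain s where "(pderiv ^^ j) (q ^ n) = q ^ Suc k * s" by (auto elim: dvdE)
  then have "(pderiv ^^ Suc j) (q ^ n) = q ^ Suc k * pderiv s + s * (smult (of_nat (Suc k)) (q ^ k) * pderiv q)"
    by (simp only: funpow.simps comp_def pderiv_mult pderiv_power_Suc)
  also have "\<dots> = q ^ k * (q * pderiv s + smult (of_nat (Suc k)) (s * pderiv q))"
    by (simp add: algebra_simps)
  finally show ?case by (rule dvdI)
qed

text \<open>All orders \<open>j\<close> of the derivative in Rodrigues' formula are kept, since
  repeated integration by parts passes through them.\<close>

abbreviation rodrigues :: "nat \<Rightarrow> nat \<Rightarrow> real poly" where
  "rodrigues n j \<equiv> (pderiv ^^ j) ([:-1, 0, 1:] ^ n)"

lemma rodrigues_boundary: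
  assumes "j < n" shows "poly (rodrigues n j) 1 = 0" "poly (rodrigues n j) (-1) = 0"
  using power_dvd_pderiv_power[of j 1 n "[:-1, 0, 1:]"] assms by (auto elim!: dvdE)

lemma degree_pderiv_funpow: "degree ((pderiv ^^ j) p) = degree p - j" for p :: "real poly"
  by (induction j) (auto simp: degree_pderiv)

text \<open>Integration by parts moves the \<open>j\<close> derivatives onto \<open>r\<close>, which
  has degree below \<open>j\<close>. The boundary terms vanish because derivatives of order below
  \<open>n\<close> are zero at both end points.\<close>

lemma rodrigues_orthogonal:
  "j \<le> n \<Longrightarrow> degree r < j \<Longrightarrow> (LINT t|uniform1. poly (rodrigues n j * r) t) = 0"
proof (induction j arbitrary: r)
  case (Suc j)
  have "(LINT t|uniform1. poly (rodrigues n (Suc j) * r) t) = - (LINT t|uniform1. poly (rodrigues n j * pderiv r) t)"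
    using Suc.prems rodrigues_boundary[of j n] integral_by_parts_uniform1[of "rodrigues n j" r] by simp
  also have "\<dots> = 0"
  proof (cases "degree r = 0")
    case True
    then have "pderiv r = 0" by (simp add: pderiv_eq_0_iff)
    then show ?thesis by simp
  next
    case False
    then show ?thesis using Suc by (simp add: degree_pderiv)
  qed
  finally show ?case .
qed simp

lemma legendre_continuous: "continuous_on UNIV (legendre n)"
  unfolding legendre_def by (intro continuous_intros) simp

lemma legendre_0: "legendre 0 t = 1"
  by (simp add: legendre_def)

text \<open>By symmetry the first index may be taken smaller; its polynomial then has too low a
  degree for \<open>rodrigues_orthogonal\<close>.\<close>

lemma legendre_orthogonal:
  assumes "m \<noteq> n" shows "(LINT t|uniform1. legendre m t * legendre n t) = 0"
proof -
  have less: "(LINT t|uniform1. legendre m t * legendre n t) = 0" if "m < n" for m n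
  proof -
    have "degree (rodrigues m m) < n"
      using degree_power_le[of "[:-1, 0, 1 :: real:]" m] that by (simp add: degree_pderiv_funpow)
    then have "(LINT t|uniform1. poly (rodrigues n n * rodrigues m m) t) = 0"
      by (intro rodrigues_orthogonal) auto
    moreover have "legendre m t * legendre n t = sqrt (2 * real m + 1) * sqrt (2 * real n + 1)
        / (2 ^ m * fact m * (2 ^ n * fact n)) * poly (rodrigues n n * rodrigues m m) t" for t
      by (simp add: legendre_def)
    ultimately show ?thesis by (simp only: integral_mult_right_zero mult_zero_right)
  qed
  show ?thesis using less[of m n] less[of n m] assms by (cases "m < n") (auto simp: mult.commute)
qed

section \<open>Multivariate Legendre polynomials on the parameter domain\<close>

interpretation uniform1: product_prob_space "\<lambda>_::nat. uniform1" UNIV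
  by (rule product_prob_spaceI) (rule prob_space_uniform1)

lemma prob_space_param: "prob_space param"
  unfolding param_def by (rule prob_space_PiM) (rule prob_space_uniform1)

lemma space_param: "space param = {y. \<forall>i. y i \<in> {-1..1}}"
  by (auto simp: param_def space_PiM space_uniform1)

text \<open>Extra factors are 1, so two multi-indices can be written over the same finite set of
  coordinates.\<close>

lemma psi_eq_prod:
  assumes "finite J" "{i. \<mu> i \<noteq> 0} \<subseteq> J" shows "psi \<mu> y = (\<Prod>i\<in>J. legendre (\<mu> i) (y i))"
  unfolding psi_def using assms by (intro prod.mono_neutral_left) (auto simp: legendre_0)

lemma psi_measurable: "psi \<mu> \<in> borel_measurable param"
proof -
  have "(\<lambda>y. legendre (\<mu> i) (y i)) \<in> borel_measurable param" for i
    unfolding param_def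
    by (rule measurable_compose[OF measurable_component_singleton]) (auto intro: continuous_measurable_uniform1 legendre_continuous)
  then show ?thesis unfolding psi_def by (intro borel_measurable_prod)
qed

lemma psi_bounded: "\<exists>B. \<forall>y\<in>space param. \<bar>psi \<mu> y\<bar> \<le> B"
proof -
  have "\<exists>B. \<forall>t\<in>{-1..1}. \<bar>legendre n t\<bar> \<le> B" for n
  proof -
    have "compact (legendre n ` {-1..1})"
      by (intro compact_continuous_image) (auto intro: continuous_on_subset[OF legendre_continuous])
    then obtain B where "\<And>z. z \<in> legendre n ` {-1..1} \<Longrightarrow> norm z \<le> B"
      using compact_imp_bounded bounded_iff by metis
    then have "\<forall>t\<in>{-1..1}. \<bar>legendre n t\<bar> \<le> B" by simp
    then show ?thesis ..
  qed
  then obtain B where B: "\<And>n t. t \<in> {-1..1} \<Longrightarrow> \<bar>legendre n t\<bar> \<le> B n" by metis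
  have "\<bar>psi \<mu> y\<bar> \<le> (\<Prod>i\<in>{i. \<mu> i \<noteq> 0}. B (\<mu> i))" if "y \<in> space param" for y
    unfolding psi_def abs_prod using that B by (intro prod_mono) (auto simp: space_param)
  then show ?thesis by blast
qed

text \<open>Only the finitely many coordinates in \<open>J\<close> matter, so the infinite product
  measure is replaced by its marginal on \<open>J\<close>. There the integral factorises, and the
  factor of a coordinate at which the indices differ is zero.\<close>

lemma psi_orthogonal:
  assumes "\<mu> \<in> multi_indices" "\<xi> \<in> multi_indices" "\<mu> \<noteq> \<xi>"
  shows "(LINT y|param. psi \<mu> y * psi \<xi> y) = 0"
proof -
  define J where "J = {i. \<mu> i \<noteq> 0} \<union> {i. \<xi> i \<noteq> 0}"
  have J: "finite J" "{i. \<mu> i \<noteq> 0} \<subseteq> J" "{i. \<xi> i \<noteq> 0} \<subseteq> J"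
    using assms by (auto simp: J_def multi_indices_def)
  obtain i where "\<mu> i \<noteq> \<xi> i" using assms(3) by blast
  then have i: "i \<in> J" "\<mu> i \<noteq> \<xi> i" by (auto simp: J_def)
  let ?f = "\<lambda>i t. legendre (\<mu> i) t * legendre (\<xi> i) t"
  have cont: "continuous_on UNIV (?f i)" for i by (intro continuous_intros legendre_continuous)
  have meas: "(\<lambda>y. \<Prod>i\<in>J. ?f i (y i)) \<in> borel_measurable (PiM J (\<lambda>_. uniform1))"
    by (intro borel_measurable_prod measurable_compose[OF measurable_component_singleton]
        continuous_measurable_uniform1 cont)
  have "(LINT y|param. psi \<mu> y * psi \<xi> y) = (LINT y|param. (\<Prod>i\<in>J. ?f i (restrict y J i)))"
    by (intro Bochner_Integration.integral_cong refl)
       (simp add: psi_eq_prod[OF J(1,2)] psi_eq_prod[OF J(1,3)] prod.distrib)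
  also have "\<dots> = (LINT y|distr param (PiM J (\<lambda>_. uniform1)) (\<lambda>y. restrict y J). (\<Prod>i\<in>J. ?f i (y i)))"
    unfolding param_def by (rule integral_distr[OF measurable_restrict_subset meas, symmetric]) simp
  also have "\<dots> = (LINT y|PiM J (\<lambda>_. uniform1). (\<Prod>i\<in>J. ?f i (y i)))"
    unfolding param_def using J(1) by (subst uniform1.distr_PiM_restrict_finite) auto
  also have "\<dots> = (\<Prod>i\<in>J. (LINT t|uniform1. ?f i t))"
    using J(1) by (intro uniform1.product_integral_prod integrable_uniform1 cont)
  also have "\<dots> = 0"
    using J(1) i legendre_orthogonal[OF i(2)] by (intro prod_zero) auto
  finally show ?thesis .
qed

section \<open>Error estimators\<close>

lemma le_of_power2_le_mult: "x\<^sup>2 \<le> x * y \<Longrightarrow> 0 \<le> x \<Longrightarrow> 0 \<le> y \<Longrightarrow> x \<le> y" for x y :: real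
  by (cases "x = 0") (auto simp: power2_eq_square)

context psd_form
begin

text \<open>The elements orthogonal to a fixed one form a subspace; this is applied once in each
  argument.\<close>

lemma span_orthogonal:
  assumes "X \<subseteq> S" "Y \<subseteq> S" "\<And>x y. x \<in> X \<Longrightarrow> y \<in> Y \<Longrightarrow> B x y = 0"
    and x: "x \<in> span X" and y: "y \<in> span Y"
  shows "B x y = 0"
proof -
  have sub: "subspace {x \<in> S. B z x = 0}" if "z \<in> S" for z
    using that sym[OF that] by (auto intro!: subspaceI simp: closed add_right scale_right zero_left)
  have yS: "y \<in> S" using span_minimal[OF assms(2) subspace] y by blast
  have "B x' y = 0" if "x' \<in> X" for x'
    using span_minimal[OF _ sub[of x'], of Y] assms y that by blast
  then have "X \<subseteq> {x \<in> S. B y x = 0}" using assms(1) sym[OF yS] by auto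
  then have "x \<in> S" "B y x = 0" using span_minimal[OF _ sub[OF yS], of X] x by auto
  then show ?thesis using sym[OF yS] by simp
qed

text \<open>\<open>A1\<close> plays the Galerkin space, \<open>A2\<close> and \<open>A3\<close> the
  spatial and the parametric enrichment. As \<open>A2\<close> and \<open>A3\<close> are orthogonal,
  \<open>e2 + e3\<close> is the projection of \<open>e\<close> onto their sum, hence not larger than
  \<open>e\<close>. For the converse \<open>es\<close> is tested with its own decomposition, whose
  part in \<open>A1\<close> the residual does not see.\<close>

lemma estimator_bounds:
  assumes sub: "A1 \<subseteq> S" "A2 \<subseteq> S" "A3 \<subseteq> S"
    and e: "represents B S R e" and es: "represents B (A1 + A2 + A3) R es"
    and e2: "represents B A2 R e2" and e3: "represents B A3 R e3"
    and galerkin: "\<And>v. v \<in> A1 \<Longrightarrow> R v = 0"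
    and orth: "\<And>v z. v \<in> A1 \<Longrightarrow> z \<in> A3 \<Longrightarrow> B v z = 0" "\<And>v z. v \<in> A2 \<Longrightarrow> z \<in> A3 \<Longrightarrow> B v z = 0"
    and cbs: "0 \<le> \<gamma>" "\<And>v w. v \<in> A1 \<Longrightarrow> w \<in> A2 \<Longrightarrow> \<bar>B v w\<bar> \<le> \<gamma> * form_norm B v * form_norm B w"
    and \<gamma>: "\<gamma> < 1"
  shows "es \<in> S" and "B es es \<le> B e e" and "B e2 e2 + B e3 e3 \<le> B e e"
    and "(1 - \<gamma>\<^sup>2) * B es es \<le> B e2 e2 + B e3 e3"
proof -
  have eS: "e \<in> S" and Re: "\<And>v. v \<in> S \<Longrightarrow> R v = B e v" using e by (auto simp: represents_def)
  obtain v w z where vwz: "v \<in> A1" "w \<in> A2" "z \<in> A3" and es_eq: "es = v + w + z"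
    using es by (auto simp: represents_def elim!: set_plus_elim)
  have Re2: "\<And>v. v \<in> A2 \<Longrightarrow> R v = B e2 v" and Re3: "\<And>v. v \<in> A3 \<Longrightarrow> R v = B e3 v"
    and eA: "e2 \<in> A2" "e3 \<in> A3" using e2 e3 by (auto simp: represents_def)
  have mem: "v \<in> S" "w \<in> S" "z \<in> S" "e2 \<in> S" "e3 \<in> S" using vwz eA sub by auto
  show esS: "es \<in> S" unfolding es_eq using mem by (intro closed)
  have Res: "R es = B es es" using es by (auto simp: represents_def)
  have esB: "B e es = B es es" using Re[OF esS] Res by simp
  have "(B es es)\<^sup>2 \<le> B es es * B e e"
    using Cauchy_Schwarz_sq[OF eS esS] esB by (simp add: mult.commute)
  then show "B es es \<le> B e e" by (rule le_of_power2_le_mult[OF _ nonneg[OF esS] nonneg[OF eS]])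
  define s where "s = B e2 e2 + B e3 e3"
  have s0: "0 \<le> s" using nonneg mem by (simp add: s_def)
  have "B e (e2 + e3) = s"
    using add_right[OF mem(4,5) eS] Re[OF mem(4)] Re[OF mem(5)] Re2[OF eA(1)] Re3[OF eA(2)] by (simp add: s_def)
  moreover have "B (e2 + e3) (e2 + e3) = s"
    using mem orth(2)[OF eA] sym[of e2 e3] by (simp add: add_left add_right closed s_def)
  ultimately have "s\<^sup>2 \<le> s * B e e"
    using Cauchy_Schwarz_sq[OF eS closed(2)[OF mem(4,5)]] by (simp add: mult.commute)
  then show "B e2 e2 + B e3 e3 \<le> B e e"
    unfolding s_def[symmetric] by (rule le_of_power2_le_mult[OF _ s0 nonneg[OF eS]])
  let ?X = "form_norm B v" and ?Y = "form_norm B w" and ?Z = "form_norm B z"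
  let ?c = "1 - \<gamma>\<^sup>2"
  have c: "0 < ?c" using cbs(1) \<gamma> by (simp add: power_less_one_iff abs_square_less_1)
  have low: "?c * (?Y\<^sup>2 + ?Z\<^sup>2) \<le> B es es"
  proof -
    have vz: "B v z = 0" "B w z = 0" "B z v = 0" "B z w = 0"
      using orth(1)[OF vwz(1,3)] orth(2)[OF vwz(2,3)] sym[OF mem(1,3)] sym[OF mem(2,3)] by auto
    have "B es es = ?X\<^sup>2 + 2 * B v w + ?Y\<^sup>2 + ?Z\<^sup>2"
      unfolding es_eq using mem vz sym[of v w] by (simp add: add_left add_right closed form_norm_sq)
    moreover have "- (\<gamma> * ?X * ?Y) \<le> B v w" using cbs(2)[OF vwz(1,2)] by linarith
    \<comment> \<open>Completing the square in \<open>?X\<close>: whatever the part \<open>v\<close>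
      in \<open>A1\<close> is, the fraction \<open>?c\<close> of the square of \<open>?Y\<close>
      survives.\<close>
    moreover have "0 \<le> (?X - \<gamma> * ?Y)\<^sup>2" by simp
    moreover have "0 \<le> \<gamma>\<^sup>2 * ?Z\<^sup>2" by simp
    ultimately show ?thesis by (simp add: power2_eq_square algebra_simps)
  qed
  have "B es es = B e2 w + B e3 z"
    using add_right[OF mem(1,2) eS] add_right[OF closed(2)[OF mem(1,2)] mem(3) eS] esB
      Re[OF mem(1)] Re[OF mem(2)] Re[OF mem(3)] Re2[OF vwz(2)] Re3[OF vwz(3)] galerkin[OF vwz(1)]
    by (simp add: es_eq)
  also have "\<dots> \<le> form_norm B e2 * ?Y + form_norm B e3 * ?Z"
    using Cauchy_Schwarz[OF mem(4,2)] Cauchy_Schwarz[OF mem(5,3)] by linarith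
  finally have "(B es es)\<^sup>2 \<le> (form_norm B e2 * ?Y + form_norm B e3 * ?Z)\<^sup>2"
    using nonneg[OF esS] by (intro power_mono)
  also have "\<dots> \<le> ((form_norm B e2)\<^sup>2 + (form_norm B e3)\<^sup>2) * (?Y\<^sup>2 + ?Z\<^sup>2)" by (rule sum2_power2_le)
  also have "\<dots> = s * (?Y\<^sup>2 + ?Z\<^sup>2)" using mem by (simp add: form_norm_sq s_def)
  finally have "?c * (B es es)\<^sup>2 \<le> s * (?c * (?Y\<^sup>2 + ?Z\<^sup>2))"
    using c by (simp add: mult.left_commute)
  also have "\<dots> \<le> s * B es es" using low s0 by (rule mult_left_mono)
  \<comment> \<open>A second factor \<open>?c\<close> makes the left-hand side the square of
    \<open>?c * B es es\<close>, as \<open>le_of_power2_le_mult\<close> wants it.\<close>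
  finally have "?c * (?c * (B es es)\<^sup>2) \<le> ?c * (s * B es es)" using c by (intro mult_left_mono) auto
  then have "(?c * B es es)\<^sup>2 \<le> (?c * B es es) * s" by (simp add: power2_eq_square mult_ac)
  then show "?c * B es es \<le> B e2 e2 + B e3 e3"
    unfolding s_def[symmetric]
    by (rule le_of_power2_le_mult[OF _ mult_nonneg_nonneg[OF less_imp_le[OF c] nonneg[OF esS]] s0])
qed

end

section \<open>Matrix inequalities for the symmetric part and the trace\<close>

lemma norm_transpose: "norm (transpose A) = norm A" for A :: "real^'n^'n"
proof -
  have "transpose A \<bullet> transpose A = A \<bullet> A"
    unfolding inner_vec_def transpose_def by (simp, rule sum.swap)
  then show ?thesis by (simp add: norm_eq_sqrt_inner)
qed

lemma norm_sym_le: "norm ((1/2) *\<^sub>R (A + transpose A)) \<le> 1 * norm A" for A :: "real^'n^'n"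
  using norm_triangle_ineq[of A "transpose A"] by (simp add: norm_transpose)

lemma linear_sym: "linear (\<lambda>A::real^'n^'n. (1/2) *\<^sub>R (A + transpose A))"
  by (rule linearI) (auto simp: transpose_def vec_eq_iff algebra_simps)

lemma linear_trace: "linear (trace :: real^'n^'n \<Rightarrow> real)"
  by (rule linearI) (auto simp: trace_def sum.distrib sum_distrib_left)

text \<open>The trace is the Frobenius product with the identity matrix. The norm of that matrix is
  the origin of the square root of the dimension in \<open>C6\<close>.\<close>

lemma norm_trace_le: "norm (trace A) \<le> sqrt (real CARD('n)) * norm A" for A :: "real^'n^'n"
proof -
  have "(if j = i then 1 else 0) * c = (if j = i then c else (0::real))" for i j :: 'n and c by simp
  then have tr: "trace A = mat 1 \<bullet> A" for A :: "real^'n^'n"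
    by (simp add: inner_vec_def mat_def trace_def)
  have "norm (mat 1 :: real^'n^'n) = sqrt (real CARD('n))"
    using tr[of "mat 1"] by (simp add: norm_eq_sqrt_inner trace_def mat_def)
  then show ?thesis using Cauchy_Schwarz_ineq2[of "mat 1" A] by (simp add: tr)
qed

section \<open>Cauchy-Schwarz and definiteness over the parameter domain\<close>

abbreviation unit_pairing :: "'y measure \<Rightarrow> 'x measure \<Rightarrow> ('y \<Rightarrow> 'x \<Rightarrow> 'b::euclidean_space) \<Rightarrow> ('y \<Rightarrow> 'x \<Rightarrow> 'b) \<Rightarrow> real" where
  "unit_pairing M L \<equiv> pairing M L (\<lambda>_ _. 1)"

text \<open>The spatial norm is a scalar function of the parameter, to which Cauchy-Schwarz over the
  parameter domain can be applied.\<close>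

lemma L2_fields_norm_L2:
  assumes "g \<in> L2_fields M L" shows "(\<lambda>y. L2_norm L (g y)) \<in> L2 M"
    and "(L2_norm M (\<lambda>y. L2_norm L (g y)))\<^sup>2 = unit_pairing M L g g"
proof -
  interpret P: psd_form_fun "L2 L :: ('b \<Rightarrow> 'c) set" "\<lambda>g h. LINT x|L. g x \<bullet> h x"
    by (intro psd_form_fun.intro psd_form_L2)
  have "(\<lambda>y. L2_norm L (g y)) \<in> borel_measurable M"
    using assms P.strongly_measurable_norm[of M g] by (auto simp: L2_Bochner_iff L2_norm_eq')
  then show "(\<lambda>y. L2_norm L (g y)) \<in> L2 M" using assms by (auto simp: L2_def L2_Bochner_iff)
  show "(L2_norm M (\<lambda>y. L2_norm L (g y)))\<^sup>2 = unit_pairing M L g g"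
    by (simp add: L2_norm_def[of M] Bochner_Integration.integral_nonneg pairing_def)
       (simp add: L2_norm_def Bochner_Integration.integral_nonneg power2_norm_eq_inner)
qed

text \<open>A bound at each parameter is integrated, and Cauchy-Schwarz for the two spatial norms as
  functions of the parameter recombines them with the same constant \<gamma>.\<close>

lemma pairing_abs_le_pointwise:
  assumes W: "weight M L (\<lambda>_ _. 1) 1" and g: "g \<in> L2_fields M L" and h: "h \<in> L2_fields M L" and "0 \<le> \<gamma>"
    and le: "\<And>y. y \<in> space M \<Longrightarrow> \<bar>LINT x|L. g y x \<bullet> h y x\<bar> \<le> \<gamma> * L2_norm L (g y) * L2_norm L (h y)"
  shows "\<bar>unit_pairing M L g h\<bar> \<le> \<gamma> * sqrt (unit_pairing M L g g) * sqrt (unit_pairing M L h h)"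
proof -
  interpret W: weight M L "\<lambda>_ _. 1" 1 by (rule W)
  note g2 = L2_fields_norm_L2[OF g] and h2 = L2_fields_norm_L2[OF h]
  have int: "integrable M (\<lambda>y. LINT x|L. g y x \<bullet> h y x)" using W.integrable_inner_integral[OF g h] by simp
  have int2: "integrable M (\<lambda>y. L2_norm L (g y) * L2_norm L (h y))"
    using integrable_inner_L2[OF g2(1) h2(1)] by simp
  have nn: "0 \<le> L2_norm L k" for k :: "'b \<Rightarrow> 'c" by (simp add: L2_norm_def Bochner_Integration.integral_nonneg)
  have "\<bar>unit_pairing M L g h\<bar> \<le> (LINT y|M. \<bar>LINT x|L. g y x \<bullet> h y x\<bar>)"
    unfolding pairing_def by simp
  also have "\<dots> \<le> (LINT y|M. \<gamma> * (L2_norm L (g y) * L2_norm L (h y)))"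
    using int int2 le by (intro integral_mono) (auto simp: mult.assoc)
  also have "\<dots> = \<gamma> * (LINT y|M. norm (L2_norm L (g y)) * norm (L2_norm L (h y)))" using nn by simp
  also have "\<dots> \<le> \<gamma> * (L2_norm M (\<lambda>y. L2_norm L (g y)) * L2_norm M (\<lambda>y. L2_norm L (h y)))"
    using \<open>0 \<le> \<gamma>\<close> by (intro mult_left_mono integral_norm_mult_le g2 h2)
  also have "\<dots> = \<gamma> * (sqrt (unit_pairing M L g g) * sqrt (unit_pairing M L h h))"
    by (simp add: g2(2)[symmetric] h2(2)[symmetric])
       (simp add: L2_norm_def Bochner_Integration.integral_nonneg)
  finally show ?thesis by simp
qed

lemma unit_pairing_zeroD:
  assumes W: "weight M L (\<lambda>_ _. 1) 1" and g: "g \<in> L2_fields M L" and zero: "unit_pairing M L g g = 0"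
  shows "AE y in M. AE x in L. g y x = 0"
proof -
  interpret W: weight M L "\<lambda>_ _. 1" 1 by (rule W)
  have "(LINT y|M. LINT x|L. g y x \<bullet> g y x) = 0" using zero by (simp add: pairing_def)
  moreover have "integrable M (\<lambda>y. LINT x|L. g y x \<bullet> g y x)" using W.integrable_inner_integral[OF g g] by simp
  ultimately have "AE y in M. (LINT x|L. g y x \<bullet> g y x) = 0"
    by (subst (asm) integral_nonneg_eq_0_iff_AE) (auto intro!: AE_I2 Bochner_Integration.integral_nonneg)
  with AE_space[of M] show ?thesis
  proof eventually_elim
    fix y assume y: "y \<in> space M" and z: "(LINT x|L. g y x \<bullet> g y x) = 0"
    have "g y \<in> L2 L" using g y by (rule L2_Bochner_mem)
    then have "AE x in L. g y x \<bullet> g y x = 0"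
      using z integrable_inner_L2[of "g y" L "g y"] by (subst (asm) integral_nonneg_eq_0_iff_AE) auto
    then show "AE x in L. g y x = 0" by simp
  qed
qed

section \<open>Tensor products of spatial and polynomial spaces\<close>

lemma tensor_pointwise:
  assumes "subspace V" "w \<in> tensor V S" shows "w y \<in> V"
  using assms(2) unfolding tensor_def
proof (induction rule: span_induct_alt)
  case base
  then show ?case using subspace_0[OF assms(1)] by (simp add: zero_fun_def)
next
  case (step c x w)
  then obtain s v where "x = (\<lambda>y z. s y *\<^sub>R v z)" "v \<in> V" by blast
  then have "x y = s y *\<^sub>R v" by auto
  then have "(c *\<^sub>R x + w) y = c *\<^sub>R s y *\<^sub>R v + w y" by simp
  then show ?case using assms(1) step \<open>v \<in> V\<close> by (simp only: subspace_add subspace_scale)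
qed

lemma S_space_L2: "s \<in> S_space \<Lambda> \<Longrightarrow> s \<in> borel_measurable param \<and> integrable param (\<lambda>y. (s y)\<^sup>2)"
proof -
  interpret prob_space param by (rule prob_space_param)
  have psi: "psi \<mu> \<in> L2 param" for \<mu>
  proof -
    obtain B where B: "\<And>y. y \<in> space param \<Longrightarrow> \<bar>psi \<mu> y\<bar> \<le> B" using psi_bounded by blast
    have "integrable param (\<lambda>y. (psi \<mu> y)\<^sup>2)"
      using psi_measurable[of \<mu>] power_mono[OF B, of _ 2]
      by (intro integrable_const_bound[of _ "B\<^sup>2"] AE_I2) auto
    then show ?thesis using psi_measurable by (simp add: L2_def)
  qed
  have "S_space \<Lambda> \<subseteq> L2 param" unfolding S_space_def by (rule span_minimal[OF _ subspace_L2]) (use psi in auto)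
  then show "s \<in> S_space \<Lambda> \<Longrightarrow> s \<in> borel_measurable param \<and> integrable param (\<lambda>y. (s y)\<^sup>2)"
    by (auto simp: L2_def)
qed

lemma S_space_orthogonal:
  assumes idx: "\<Lambda> \<subseteq> multi_indices" "Q \<subseteq> multi_indices" "\<Lambda> \<inter> Q = {}"
    and s: "s \<in> S_space \<Lambda>" and t: "t \<in> S_space Q"
  shows "(LINT y|param. s y * t y) = 0"
proof -
  interpret P: psd_form "L2 param :: ((nat \<Rightarrow> real) \<Rightarrow> real) set" "\<lambda>g h. LINT x|param. g x \<bullet> h x" by (rule psd_form_L2)
  have L2: "S_space A \<subseteq> L2 param" for A using S_space_L2 by (auto simp: L2_def)
  have psi: "psi \<mu> \<in> L2 param" for \<mu> using L2[of "{\<mu>}"] by (auto simp: S_space_def span_base)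
  have "(LINT y|param. s y \<bullet> t y) = 0"
  proof (rule P.span_orthogonal[OF _ _ _ s[unfolded S_space_def] t[unfolded S_space_def]])
    fix x y assume "x \<in> psi ` \<Lambda>" "y \<in> psi ` Q"
    then obtain \<mu> \<xi> where "x = psi \<mu>" "y = psi \<xi>" "\<mu> \<in> \<Lambda>" "\<xi> \<in> Q" by blast
    moreover from this have "\<mu> \<noteq> \<xi>" using idx by blast
    ultimately show "(LINT z|param. x z \<bullet> y z) = 0" using idx psi_orthogonal[of \<mu> \<xi>] by auto
  qed (use psi in auto)
  then show ?thesis by simp
qed

lemma (in psd_form_fun) tensor_subset:
  assumes "V \<subseteq> S" shows "tensor V (S_space \<Lambda>) \<subseteq> L2_Bochner param S (form_norm B)"
  unfolding tensor_def
proof (rule span_minimal[OF _ subspace_L2_Bochner], clarify)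
  fix v s assume "v \<in> V" "s \<in> S_space \<Lambda>"
  then have "(\<lambda>y. s y *\<^sub>R v) \<in> L2_Bochner param S (form_norm B)"
    using S_space_L2 assms by (intro L2_Bochner_product) auto
  then show "(\<lambda>y x. s y *\<^sub>R v x) \<in> L2_Bochner param S (form_norm B)" by (simp add: scaleR_fun_def)
qed

lemma scaled_cbs:
  fixes k :: real
  assumes "\<bar>x\<bar> \<le> c * sqrt y * sqrt z" "0 \<le> k"
  shows "\<bar>k * x\<bar> \<le> c * sqrt (k * y) * sqrt (k * z)"
proof -
  have "\<bar>k * x\<bar> = k * \<bar>x\<bar>" using assms(2) by (simp add: abs_mult)
  also have "\<dots> \<le> k * (c * sqrt y * sqrt z)" using assms by (rule mult_left_mono)
  also have "\<dots> = c * (k * (sqrt y * sqrt z))" by (simp only: mult_ac)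
  also have "\<dots> = c * sqrt (k * y) * sqrt (k * z)"
    by (simp only: mult_sqrt_split[OF assms(2)] real_sqrt_mult mult.assoc)
  finally show ?thesis .
qed

context ae_linear
begin

text \<open>By bilinearity only products of a parameter function and a spatial function matter. For
  these the integral factorises, and its parameter factor is zero whatever the spatial functions
  are.\<close>

lemma tensor_orthogonal:
  assumes W: "weight param L (\<lambda>_ _. 1) 1"
    and idx: "\<Lambda> \<subseteq> multi_indices" "Q \<subseteq> multi_indices" "\<Lambda> \<inter> Q = {}"
    and V: "V1 \<subseteq> S" "V2 \<subseteq> S"
    and u: "u \<in> tensor V1 (S_space \<Lambda>)" and w: "w \<in> tensor V2 (S_space Q)"
  shows "unit_pairing param L (\<lambda>y. T (u y)) (\<lambda>y. T (w y)) = 0"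
proof -
  interpret W: weight param L "\<lambda>_ _. 1" 1 by (rule W)
  interpret F: psd_form "L2_Bochner param S (form_norm B)" "\<lambda>u v. unit_pairing param L (\<lambda>y. T (u y)) (\<lambda>y. T (v y))"
    by (rule psd_form_pairing_T[OF W])
  note sub = P.tensor_subset[OF V(1), of \<Lambda>] P.tensor_subset[OF V(2), of Q]
  have gen: "unit_pairing param L (\<lambda>y. T (\<lambda>x. s y *\<^sub>R v x)) (\<lambda>y. T (\<lambda>x. t y *\<^sub>R v' x)) = 0"
    if v: "v \<in> V1" "v' \<in> V2" and s: "s \<in> S_space \<Lambda>" "t \<in> S_space Q" for v v' s t
  proof -
    have S: "v \<in> S" "v' \<in> S" using v V by auto
    note Tv = T_L2[OF S(1)] T_L2[OF S(2)]
    have "(LINT x|L. T (\<lambda>x. s y *\<^sub>R v x) x \<bullet> T (\<lambda>x. t y *\<^sub>R v' x) x) = s y * t y * (LINT x|L. T v x \<bullet> T v' x)" for y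
    proof -
      have [measurable]: "T (s y *\<^sub>R v) \<in> borel_measurable L" "T (t y *\<^sub>R v') \<in> borel_measurable L"
        "T v \<in> borel_measurable L" "T v' \<in> borel_measurable L"
        using Tv T_L2[OF P.closed(3)[OF S(1)]] T_L2[OF P.closed(3)[OF S(2)]] by (auto simp: L2_def)
      have "(LINT x|L. T (s y *\<^sub>R v) x \<bullet> T (t y *\<^sub>R v') x) = (LINT x|L. s y * t y * (T v x \<bullet> T v' x))"
      proof (rule integral_cong_AE)
        show "AE x in L. T (s y *\<^sub>R v) x \<bullet> T (t y *\<^sub>R v') x = s y * t y * (T v x \<bullet> T v' x)"
          using T_scale[OF S(1), of "s y"] T_scale[OF S(2), of "t y"] by eventually_elim simp
      qed measurable
      then show ?thesis by (simp add: scaleR_fun_def)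
    qed
    then have "unit_pairing param L (\<lambda>y. T (\<lambda>x. s y *\<^sub>R v x)) (\<lambda>y. T (\<lambda>x. t y *\<^sub>R v' x))
        = (LINT y|param. s y * t y) * (LINT x|L. T v x \<bullet> T v' x)"
      by (simp add: pairing_def)
    then show ?thesis using S_space_orthogonal[OF idx s] by simp
  qed
  show ?thesis
  proof (rule F.span_orthogonal[OF _ _ _ u[unfolded tensor_def] w[unfolded tensor_def]])
    show "{(\<lambda>y x. s y *\<^sub>R v x) |v s. v \<in> V1 \<and> s \<in> S_space \<Lambda>} \<subseteq> L2_Bochner param S (form_norm B)"
      "{(\<lambda>y x. s y *\<^sub>R v x) |v s. v \<in> V2 \<and> s \<in> S_space Q} \<subseteq> L2_Bochner param S (form_norm B)"
      by (rule order_trans[OF span_superset sub(1)[unfolded tensor_def]],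
          rule order_trans[OF span_superset sub(2)[unfolded tensor_def]])
    fix x y
    assume "x \<in> {(\<lambda>y x. s y *\<^sub>R v x) |v s. v \<in> V1 \<and> s \<in> S_space \<Lambda>}"
      and "y \<in> {(\<lambda>y x. s y *\<^sub>R v x) |v s. v \<in> V2 \<and> s \<in> S_space Q}"
    then obtain v s v' t where xy: "x = (\<lambda>y x. s y *\<^sub>R v x)" "y = (\<lambda>y x. t y *\<^sub>R v' x)"
      and m: "v \<in> V1" "v' \<in> V2" "s \<in> S_space \<Lambda>" "t \<in> S_space Q" by auto
    show "unit_pairing param L (\<lambda>z. T (x z)) (\<lambda>z. T (y z)) = 0"
      unfolding xy by (rule gen[OF m])
  qed
qed

text \<open>At a fixed parameter the two fields lie in \<open>V1\<close> and \<open>V2\<close>, so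
  the deterministic inequality applies there.\<close>

lemma tensor_cbs:
  assumes W: "weight param L (\<lambda>_ _. 1) 1" and "0 \<le> \<gamma>"
    and V: "subspace V1" "subspace V2" "V1 \<subseteq> S" "V2 \<subseteq> S"
    and cbs: "\<And>v w. v \<in> V1 \<Longrightarrow> w \<in> V2 \<Longrightarrow>
      \<bar>LINT x|L. T v x \<bullet> T w x\<bar> \<le> \<gamma> * L2_norm L (T v) * L2_norm L (T w)"
    and u: "u \<in> tensor V1 (S_space \<Lambda>)" and w: "w \<in> tensor V2 (S_space Q)"
  shows "\<bar>unit_pairing param L (\<lambda>y. T (u y)) (\<lambda>y. T (w y))\<bar>
    \<le> \<gamma> * sqrt (unit_pairing param L (\<lambda>y. T (u y)) (\<lambda>y. T (u y))) * sqrt (unit_pairing param L (\<lambda>y. T (w y)) (\<lambda>y. T (w y)))"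
proof -
  have um: "u \<in> L2_Bochner param S (form_norm B)" and wm: "w \<in> L2_Bochner param S (form_norm B)"
    using subsetD[OF P.tensor_subset[OF V(3)] u] subsetD[OF P.tensor_subset[OF V(4)] w] .
  show ?thesis
    by (rule pairing_abs_le_pointwise[OF W T_fields[OF um] T_fields[OF wm] \<open>0 \<le> \<gamma>\<close>
          cbs[OF tensor_pointwise[OF V(1) u] tensor_pointwise[OF V(2) w]]])
qed

text \<open>Serves twice, with the gradient as \<open>T\<close> for the displacement and with the
  identity for the pressure. \<open>F\<close> and \<open>X\<close> enter through equations so that
  the conclusions speak of the forms and spaces of the problem themselves.\<close>

lemma tensor_estimator:
  assumes F: "F = (\<lambda>u v. k * unit_pairing param L (\<lambda>y. T (u y)) (\<lambda>y. T (v y)))"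
    and X: "X = L2_Bochner param S (form_norm B)"
    and W: "weight param L (\<lambda>_ _. 1) 1" and k: "0 \<le> k"
    and idx: "\<Lambda> \<subseteq> multi_indices" "Q \<subseteq> multi_indices" "\<Lambda> \<inter> Q = {}"
    and V: "subspace V" "V \<subseteq> S" "subspace V'" "V' \<subseteq> S"
    and cbs: "0 \<le> \<gamma>" "\<gamma> < 1" "\<And>v w. v \<in> V \<Longrightarrow> w \<in> V' \<Longrightarrow>
      \<bar>LINT x|L. T v x \<bullet> T w x\<bar> \<le> \<gamma> * L2_norm L (T v) * L2_norm L (T w)"
    and galerkin: "\<And>v. v \<in> tensor V (S_space \<Lambda>) \<Longrightarrow> R v = 0"
    and e: "represents F X R e"
    and es: "represents F (tensor V (S_space \<Lambda>) + tensor V' (S_space \<Lambda>) + tensor V (S_space Q)) R es"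
    and e2: "represents F (tensor V' (S_space \<Lambda>)) R e2" and e3: "represents F (tensor V (S_space Q)) R e3"
  shows "es \<in> X" and "F es es \<le> F e e" and "F e2 e2 + F e3 e3 \<le> F e e"
    and "(1 - \<gamma>\<^sup>2) * F es es \<le> F e2 e2 + F e3 e3"
proof -
  interpret F: psd_form X F
    unfolding F X by (rule psd_form.scaled[OF psd_form_pairing_T[OF W] k])
  have sub: "tensor V0 (S_space A) \<subseteq> X" if "V0 \<subseteq> S" for V0 A unfolding X by (rule P.tensor_subset[OF that])
  have orth: "F v z = 0" if "v \<in> tensor V0 (S_space \<Lambda>)" "z \<in> tensor V (S_space Q)" "V0 \<subseteq> S" for v z V0
    unfolding F using tensor_orthogonal[OF W idx that(3) V(2) that(1,2)] by simp
  have cbs': "\<bar>F v w\<bar> \<le> \<gamma> * form_norm F v * form_norm F w"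
    if "v \<in> tensor V (S_space \<Lambda>)" "w \<in> tensor V' (S_space \<Lambda>)" for v w
    unfolding F form_norm_def
    by (rule scaled_cbs[OF tensor_cbs[OF W cbs(1) V(1,3,2,4) cbs(3) that] k])
  note est = F.estimator_bounds[OF sub[OF V(2)] sub[OF V(4)] sub[OF V(2)]
      e es e2 e3 galerkin orth[OF _ _ V(2)] orth[OF _ _ V(4)] cbs(1) cbs' cbs(2)]
  show "es \<in> X" "F es es \<le> F e e" "F e2 e2 + F e3 e3 \<le> F e e" "(1 - \<gamma>\<^sup>2) * F es es \<le> F e2 e2 + F e3 e3"
    by (rule est; assumption)+
qed

end

section \<open>The elasticity forms\<close>

locale elasticity = bounded_open D for D :: "(real^'n) set" +
  fixes DD :: "(real^'n) set" and E :: "real^'n \<Rightarrow> (nat \<Rightarrow> real) \<Rightarrow> real" and \<alpha> \<beta> Emin Emax CK :: real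
  assumes D_nonempty: "D \<noteq> {}" and pos: "0 < \<alpha>" "0 < \<beta>" "0 < Emin"
    and E_meas: "(\<lambda>(x, y). E x y) \<in> borel_measurable (lebesgue_on D \<Otimes>\<^sub>M param)"
    and E_AE: "AE (x, y) in lebesgue_on D \<Otimes>\<^sub>M param. Emin \<le> E x y \<and> E x y \<le> Emax"
    and korn: "korn_constant D DD CK"
begin

sublocale param: prob_space param
  by (rule prob_space_param)

text \<open>The bounds come with the spatial variable first, whereas the forms integrate over the
  parameter outermost; measurability of the set where they hold allows the exchange.\<close>

lemma E_AE_sections: "AE y in param. AE x in L. Emin \<le> E x y \<and> E x y \<le> Emax"
proof -
  interpret pair_sigma_finite L param ..
  have "AE x in L. AE y in param. Emin \<le> E x y \<and> E x y \<le> Emax"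
    using AE_pair[OF E_AE] by simp
  moreover have "{z \<in> space (L \<Otimes>\<^sub>M param). Emin \<le> E (fst z) (snd z) \<and> E (fst z) (snd z) \<le> Emax} \<in> sets (L \<Otimes>\<^sub>M param)"
    using E_meas by (simp add: case_prod_beta')
  ultimately show ?thesis using AE_commute[of "\<lambda>x y. Emin \<le> E x y \<and> E x y \<le> Emax"] by simp
qed

text \<open>The bounds on \<open>E\<close> hold only almost everywhere, so comparing them takes a
  set of positive measure: a nonempty open \<open>D\<close> is not negligible.\<close>

lemma Emin_le_Emax: "Emin \<le> Emax"
proof (rule ccontr)
  assume less: "\<not> Emin \<le> Emax"
  have "AE y in param. AE x in L. False"
    using E_AE_sections
  proof eventually_elim
    case (elim y)
    then show ?case by eventually_elim (use less in linarith)
  qed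
  then have "AE x in L. False" by simp
  then have "emeasure L (space L) = 0" by (auto simp: AE_iff_null dest: null_setsD1)
  then have "emeasure lebesgue D = 0"
    using D_lmeasurable by (simp add: emeasure_restrict_space)
  then have "negligible D" using D_lmeasurable by (simp add: negligible_iff_null_sets null_sets_def fmeasurableD)
  then show False using open_not_negligible[OF open_D D_nonempty] by blast
qed

lemma weight_1: "weight param L (\<lambda>_ _. 1) 1"
  by unfold_locales auto

lemma weight_E: "weight param L E Emax"
  using E_AE_sections pos(3) by unfold_locales (use E_meas in \<open>auto elim!: eventually_mono\<close>)

lemma H1_E0_subset: "H1_E0 D DD \<subseteq> H1 D"
  by (auto simp: H1_E0_def)

lemma ae_linear_symgrad: "ae_linear (H1_E0 D DD) H1_form L (symgrad D) 1"
  using ae_linear_image_grad[OF subspace_H1_E0 H1_E0_subset linear_sym norm_sym_le] 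
  by (simp add: symgrad_def[abs_def])

lemma ae_linear_divergence: "ae_linear (H1_E0 D DD) H1_form L (divergence D) (sqrt (real CARD('n)))"
  using ae_linear_image_grad[OF subspace_H1_E0 H1_E0_subset linear_trace norm_trace_le] 
  by (simp add: divergence_def[abs_def])

text \<open>Lets the pressure spaces share the lemmas made for gradients.\<close>

lemma ae_linear_id: "ae_linear (L2 L :: (real^'n \<Rightarrow> real) set) (\<lambda>g h. LINT x|L. g x \<bullet> h x) L (\<lambda>q. q) 1"
  by (intro ae_linear.intro psd_form_fun.intro psd_form_L2 ae_linear_axioms.intro) (auto simp: L2_norm_eq)

sublocale G: ae_linear "H1_E0 D DD" H1_form L "grad D" 1
  by (rule ae_linear_grad[OF subspace_H1_E0 H1_E0_subset])

sublocale Sym: ae_linear "H1_E0 D DD" H1_form L "symgrad D" 1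
  by (rule ae_linear_symgrad)

sublocale Div: ae_linear "H1_E0 D DD" H1_form L "divergence D" "sqrt (real CARD('n))"
  by (rule ae_linear_divergence)

sublocale Id: ae_linear "L2 L :: (real^'n \<Rightarrow> real) set" "\<lambda>g h. LINT x|L. g x \<bullet> h x" L "\<lambda>q. q" 1
  by (rule ae_linear_id)

section \<open>The forms of the elasticity problem as pairings\<close>

lemma VV_eq: "VV D DD = L2_Bochner param (H1_E0 D DD) (form_norm H1_form)"
  by (simp add: VV_def H1_norm_eq)

lemma WW_eq: "WW D = L2_Bochner param (L2 L) (form_norm (\<lambda>g h. LINT x|L. g x \<bullet> h x))"
  by (simp add: WW_def L2_norm_eq')

abbreviation "\<kappa> \<equiv> 1 / (\<alpha> * \<beta>)"
abbreviation "m \<equiv> unit_pairing param L :: 'n sfield \<Rightarrow> 'n sfield \<Rightarrow> real"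

lemma a_form_eq: "a_form D \<alpha> E = (\<lambda>u v. \<alpha> * pairing param L E (\<lambda>y. symgrad D (u y)) (\<lambda>y. symgrad D (v y)))"
  by (intro ext) (simp add: a_form_def pairing_def)

lemma a0_form_eq: "a0_form D \<alpha> = (\<lambda>u v. \<alpha> * unit_pairing param L (\<lambda>y. grad D (u y)) (\<lambda>y. grad D (v y)))"
  by (intro ext) (simp add: a0_form_def pairing_def)

lemma b_form_eq: "b_form D v q = - m (\<lambda>y. divergence D (v y)) q"
  by (simp add: b_form_def pairing_def mult.commute)

lemma c_form_eq: "c_form D \<alpha> \<beta> p q = \<kappa> * m p q"
  by (simp add: c_form_def pairing_def)

lemma d_form_eq: "d_form D \<alpha> \<beta> E p q = \<kappa> * pairing param L E p q"
  by (simp add: d_form_def pairing_def mult.assoc)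

lemma d0_form_eq: "d0_form D \<alpha> \<beta> = (\<lambda>p q. \<kappa> * m p q)"
  by (intro ext) (simp add: d0_form_def pairing_def)

lemma cbar_form_eq: "cbar_form D \<alpha> \<beta> p q = (1 / \<alpha> + \<kappa>) * m p q"
  by (simp add: cbar_form_def pairing_def)

lemma gradW_norm_eq: "gradW_norm D v = sqrt (unit_pairing param L (\<lambda>y. grad D (v y)) (\<lambda>y. grad D (v y)))"
  by (simp add: gradW_norm_def pairing_def power2_norm_eq_inner)

lemma W_norm_eq: "W_norm D q = form_norm m q"
  by (simp add: W_norm_def form_norm_def pairing_def power2_eq_square)

lemma psd_m: "psd_form (WW D) m"
  unfolding WW_def by (rule weight.psd_form_pairing[OF weight_1])

lemma psd_d: "psd_form (WW D) (pairing param L E)"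
  unfolding WW_def by (rule weight.psd_form_pairing[OF weight_E])

lemma psd_a: "psd_form (VV D DD) (a_form D \<alpha> E)"
  unfolding a_form_eq VV_eq
  using psd_form.scaled[OF Sym.psd_form_pairing_T[OF weight_E]] pos by simp

lemma psd_a0: "psd_form (VV D DD) (a0_form D \<alpha>)"
  unfolding a0_form_eq VV_eq
  using psd_form.scaled[OF G.psd_form_pairing_T[OF weight_1]] pos by simp

lemma psd_d0: "psd_form (WW D) (d0_form D \<alpha> \<beta>)"
  unfolding d0_form_eq by (rule psd_form.scaled[OF psd_m]) (use pos in simp)

lemma div_fields: "v \<in> VV D DD \<Longrightarrow> (\<lambda>y. divergence D (v y)) \<in> WW D"
  unfolding WW_def VV_eq by (rule Div.T_fields)

lemma form_norm_a0: "form_norm (a0_form D \<alpha>) v = sqrt \<alpha> * gradW_norm D v"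
  unfolding a0_form_eq by (simp add: form_norm_def gradW_norm_eq real_sqrt_mult)

lemma divergence_bound:
  assumes v: "v \<in> VV D DD"
  shows "form_norm m (\<lambda>y. divergence D (v y)) \<le> sqrt (real CARD('n)) * gradW_norm D v"
proof -
  have "1 * m (\<lambda>y. divergence D (v y)) (\<lambda>y. divergence D (v y))
      \<le> real CARD('n) * unit_pairing param L (\<lambda>y. grad D (v y)) (\<lambda>y. grad D (v y))"
  proof (rule pairing_mono[OF weight_1 weight_1])
    show "(\<lambda>y. divergence D (v y)) \<in> L2_fields param L" "(\<lambda>y. grad D (v y)) \<in> L2_fields param L"
      using v unfolding VV_eq by (rule Div.T_fields, rule G.T_fields)
    have "divergence D w x \<bullet> divergence D w x \<le> real CARD('n) * (grad D w x \<bullet> grad D w x)" for w x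
      using power_mono[OF norm_trace_le[of "grad D w x"], of 2]
      by (simp add: divergence_def power_mult_distrib power2_norm_eq_inner flip: power2_eq_square)
    then show "AE y in param. AE x in L. 1 * (1 * (divergence D (v y) x \<bullet> divergence D (v y) x))
        \<le> real CARD('n) * (1 * (grad D (v y) x \<bullet> grad D (v y) x))" by simp
  qed
  then show ?thesis
    by (simp add: form_norm_def gradW_norm_eq flip: real_sqrt_mult)
qed

lemma korn_fields:
  assumes v: "v \<in> VV D DD"
  shows "CK * unit_pairing param L (\<lambda>y. grad D (v y)) (\<lambda>y. grad D (v y))
    \<le> unit_pairing param L (\<lambda>y. symgrad D (v y)) (\<lambda>y. symgrad D (v y))"
proof -
  interpret W: weight param L "\<lambda>_ _. 1" 1 by (rule weight_1)
  have F: "(\<lambda>y. grad D (v y)) \<in> L2_fields param L" "(\<lambda>y. symgrad D (v y)) \<in> L2_fields param L"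
    using v unfolding VV_eq by (rule G.T_fields, rule Sym.T_fields)
  have int: "integrable param (\<lambda>y. LINT x|L. grad D (v y) x \<bullet> grad D (v y) x)"
    "integrable param (\<lambda>y. LINT x|L. symgrad D (v y) x \<bullet> symgrad D (v y) x)"
    using W.integrable_inner_integral[OF F(1) F(1)] W.integrable_inner_integral[OF F(2) F(2)] by simp_all
  have "(LINT y|param. CK * (LINT x|L. grad D (v y) x \<bullet> grad D (v y) x))
      \<le> (LINT y|param. LINT x|L. symgrad D (v y) x \<bullet> symgrad D (v y) x)"
  proof (rule integral_mono)
    fix y assume "y \<in> space param"
    then have "v y \<in> H1_E0 D DD" using v unfolding VV_eq by (rule L2_Bochner_mem[rotated])
    then have "CK * (L2_norm L (grad D (v y)))\<^sup>2 \<le> (LINT x|L. symgrad D (v y) x \<bullet> symgrad D (v y) x)"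
      using korn unfolding korn_constant_def by blast
    moreover have "(L2_norm L (grad D (v y)))\<^sup>2 = (LINT x|L. grad D (v y) x \<bullet> grad D (v y) x)"
      by (simp add: L2_norm_def power2_norm_eq_inner Bochner_Integration.integral_nonneg)
    ultimately show "CK * (LINT x|L. grad D (v y) x \<bullet> grad D (v y) x) \<le> (LINT x|L. symgrad D (v y) x \<bullet> symgrad D (v y) x)"
      by simp
  qed (use int in auto)
  then show ?thesis by (simp add: pairing_def)
qed

lemma E_pairing_bounds:
  fixes g :: "(nat \<Rightarrow> real) \<Rightarrow> real^'n \<Rightarrow> 'b::euclidean_space"
  assumes g: "g \<in> L2_fields param L"
  shows "Emin * unit_pairing param L g g \<le> pairing param L E g g"
    and "pairing param L E g g \<le> Emax * unit_pairing param L g g"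
proof -
  have "Emin * unit_pairing param L g g \<le> 1 * pairing param L E g g"
  proof (rule pairing_mono[OF weight_1 weight_E g g])
    show "AE y in param. AE x in L. Emin * (1 * (g y x \<bullet> g y x)) \<le> 1 * (E x y * (g y x \<bullet> g y x))"
      using E_AE_sections
    proof eventually_elim
      case (elim y)
      then show ?case by eventually_elim (auto intro: mult_right_mono)
    qed
  qed
  then show "Emin * unit_pairing param L g g \<le> pairing param L E g g" by simp
  have "1 * pairing param L E g g \<le> Emax * unit_pairing param L g g"
  proof (rule pairing_mono[OF weight_E weight_1 g g])
    show "AE y in param. AE x in L. 1 * (E x y * (g y x \<bullet> g y x)) \<le> Emax * (1 * (g y x \<bullet> g y x))"
      using E_AE_sections
    proof eventually_elim
      case (elim y)
      then show ?case by eventually_elim (auto intro: mult_right_mono)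
    qed
  qed
  then show "pairing param L E g g \<le> Emax * unit_pairing param L g g" by simp
qed

lemma symgrad_le_grad:
  assumes v: "v \<in> VV D DD"
  shows "unit_pairing param L (\<lambda>y. symgrad D (v y)) (\<lambda>y. symgrad D (v y))
    \<le> unit_pairing param L (\<lambda>y. grad D (v y)) (\<lambda>y. grad D (v y))"
proof -
  have "1 * unit_pairing param L (\<lambda>y. symgrad D (v y)) (\<lambda>y. symgrad D (v y))
    \<le> 1 * unit_pairing param L (\<lambda>y. grad D (v y)) (\<lambda>y. grad D (v y))"
  proof (rule pairing_mono[OF weight_1 weight_1])
    show "(\<lambda>y. symgrad D (v y)) \<in> L2_fields param L" "(\<lambda>y. grad D (v y)) \<in> L2_fields param L"
      using v unfolding VV_eq by (rule Sym.T_fields, rule G.T_fields)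
    have "symgrad D w x \<bullet> symgrad D w x \<le> grad D w x \<bullet> grad D w x" for w x
    proof -
      have "(norm (symgrad D w x))\<^sup>2 \<le> (norm (grad D w x))\<^sup>2"
        using norm_sym_le[of "grad D w x"] unfolding symgrad_def by (intro power_mono) auto
      then show ?thesis by (simp only: power2_norm_eq_inner)
    qed
    then show "AE y in param. AE x in L. 1 * (1 * (symgrad D (v y) x \<bullet> symgrad D (v y) x))
        \<le> 1 * (1 * (grad D (v y) x \<bullet> grad D (v y) x))" by simp
  qed
  then show ?thesis by simp
qed

sublocale saddle_point "VV D DD" "a_form D \<alpha> E" "a0_form D \<alpha>" "WW D" m "pairing param L E" "b_form D"
  \<alpha> \<kappa> Emin Emax CK "sqrt (real CARD('n))"
proof (intro saddle_point.intro psd_a psd_a0 psd_m psd_d saddle_point_axioms.intro)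
  interpret M: psd_form "WW D" m by (rule psd_m)
  fix v v' :: "'n vfield" and q :: "'n sfield" and r :: real
  show "0 < \<alpha>" "0 < \<kappa>" "0 < Emin" "Emin \<le> Emax" "0 < CK" "CK \<le> 1" "1 \<le> sqrt (real CARD('n))"
    using pos Emin_le_Emax korn by (auto simp: korn_constant_def Suc_leI)
  {
    assume q: "q \<in> WW D"
    show "Emin * m q q \<le> pairing param L E q q" "pairing param L E q q \<le> Emax * m q q"
      using E_pairing_bounds q unfolding WW_def by auto
  }
  assume v: "v \<in> VV D DD"
  note sF = Sym.T_fields[OF v[unfolded VV_eq]]
  show "Emin * CK * a0_form D \<alpha> v v \<le> a_form D \<alpha> E v v"
  proof -
    have "Emin * (CK * unit_pairing param L (\<lambda>y. grad D (v y)) (\<lambda>y. grad D (v y)))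
        \<le> Emin * unit_pairing param L (\<lambda>y. symgrad D (v y)) (\<lambda>y. symgrad D (v y))"
      using korn_fields[OF v] pos by (intro mult_left_mono) auto
    also note E_pairing_bounds(1)[OF sF]
    finally have "\<alpha> * (Emin * (CK * unit_pairing param L (\<lambda>y. grad D (v y)) (\<lambda>y. grad D (v y))))
        \<le> \<alpha> * pairing param L E (\<lambda>y. symgrad D (v y)) (\<lambda>y. symgrad D (v y))"
      using pos by (intro mult_left_mono) auto
    then show ?thesis by (simp only: a0_form_eq a_form_eq mult_ac)
  qed
  show "a_form D \<alpha> E v v \<le> Emax * a0_form D \<alpha> v v"
  proof -
    note E_pairing_bounds(2)[OF sF]
    also have "Emax * unit_pairing param L (\<lambda>y. symgrad D (v y)) (\<lambda>y. symgrad D (v y))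
      \<le> Emax * unit_pairing param L (\<lambda>y. grad D (v y)) (\<lambda>y. grad D (v y))"
      using symgrad_le_grad[OF v] pos Emin_le_Emax by (intro mult_left_mono) auto
    finally have "\<alpha> * pairing param L E (\<lambda>y. symgrad D (v y)) (\<lambda>y. symgrad D (v y))
      \<le> \<alpha> * (Emax * unit_pairing param L (\<lambda>y. grad D (v y)) (\<lambda>y. grad D (v y)))"
      using pos by (intro mult_left_mono) auto
    then show ?thesis by (simp only: a0_form_eq a_form_eq mult_ac)
  qed
  assume q: "q \<in> WW D"
  note qF = q[unfolded WW_def]
  show "b_form D (r *\<^sub>R v) q = r * b_form D v q"
    unfolding b_form_eq using Div.pairing_T_left(2)[OF weight_1 qF v[unfolded VV_eq] v[unfolded VV_eq]] by simp
  show "b_form D v (r *\<^sub>R q) = r * b_form D v q"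
    unfolding b_form_eq using M.scale_right[OF q div_fields[OF v]] by simp
  show "\<bar>b_form D v q\<bar> * sqrt \<alpha> \<le> sqrt (real CARD('n)) * form_norm (a0_form D \<alpha>) v * form_norm m q"
  proof -
    have "\<bar>b_form D v q\<bar> \<le> form_norm m (\<lambda>y. divergence D (v y)) * form_norm m q"
      unfolding b_form_eq using M.Cauchy_Schwarz[OF div_fields[OF v] q] by simp
    also have "\<dots> \<le> sqrt (real CARD('n)) * gradW_norm D v * form_norm m q"
      using divergence_bound[OF v] M.form_norm_nonneg[OF q] by (rule mult_right_mono)
    finally have "\<bar>b_form D v q\<bar> * sqrt \<alpha> \<le> sqrt (real CARD('n)) * gradW_norm D v * form_norm m q * sqrt \<alpha>"
      using pos by (intro mult_right_mono) auto
    then show ?thesis by (simp add: form_norm_a0 mult_ac)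
  qed
  assume v': "v' \<in> VV D DD"
  show "b_form D (v + v') q = b_form D v q + b_form D v' q"
    unfolding b_form_eq using Div.pairing_T_left(1)[OF weight_1 qF v[unfolded VV_eq] v'[unfolded VV_eq]] by simp
qed

lemma triple_norm_eq:
  assumes "v \<in> VV D DD" "q \<in> WW D" "q' \<in> WW D"
  shows "triple_norm D \<alpha> \<beta> v q q' = sqrt (energy v q q')"
proof -
  have "\<alpha> * (gradW_norm D v)\<^sup>2 = a0_form D \<alpha> v v"
    using A0.form_norm_sq[OF assms(1)] pos by (simp add: form_norm_a0 power_mult_distrib)
  then show ?thesis
    using assms by (simp add: triple_norm_def energy_def W_norm_eq M.form_norm_sq)
qed

text \<open>Since \<theta> is below 1 there is a gap under the supremum, so some admissible field
  exceeds \<theta> times the lower bound. It is rescaled to the norm of \<open>q\<close>; for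
  \<open>q\<close> of norm zero the zero field will do.\<close>

lemma inf_sup_witness:
  assumes inf_sup: "inf_sup_constant D DD C" and q: "q \<in> WW D" and \<theta>: "0 < \<theta>" "\<theta> < 1"
  shows "\<exists>w\<in>VV D DD. form_norm (a0_form D \<alpha>) w = form_norm m q \<and> \<theta> * C * (form_norm m q)\<^sup>2 \<le> b_form D w q * sqrt \<alpha>"
proof (cases "form_norm m q = 0")
  case True
  have "b_form D 0 q = 0" using b_scale_left[OF A0.closed(1) q, of 0] by simp
  moreover have "form_norm (a0_form D \<alpha>) 0 = 0"
    using A0.zero_left[OF A0.closed(1)] by (simp add: form_norm_def)
  ultimately show ?thesis using True A0.closed(1) by (intro bexI[of _ 0]) auto
next
  case False
  let ?n = "form_norm m q"
  have n: "0 < ?n" using False M.form_norm_nonneg[OF q] by simp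
  have C: "0 < C" using inf_sup by (simp add: inf_sup_constant_def)
  have "ereal (\<theta> * C * ?n) < ereal (C * W_norm D q)" using n C \<theta> by (simp add: W_norm_eq)
  also have "\<dots> \<le> (SUP v\<in>{v \<in> VV D DD. \<not> zero_field D v}. ereal (b_form D v q / gradW_norm D v))"
    using inf_sup q by (simp add: inf_sup_constant_def)
  finally obtain v where v: "v \<in> VV D DD" and bv: "\<theta> * C * ?n < b_form D v q / gradW_norm D v"
    by (auto simp: less_SUP_iff)
  \<comment> \<open>Division by zero yields 0, so a positive quotient forces a nonzero
    denominator.\<close>
  have "0 < \<theta> * C * ?n" using \<theta> C n by simp
  then have "gradW_norm D v \<noteq> 0" using bv by auto
  moreover have "0 \<le> gradW_norm D v" using A0.form_norm_nonneg[OF v] pos by (simp add: form_norm_a0 zero_le_mult_iff)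
  ultimately have G: "0 < gradW_norm D v" by simp
  \<comment> \<open>Scales \<open>v\<close> to the norm of \<open>q\<close>; the square root of
    \<alpha> converts \<open>gradW_norm\<close> into the norm of \<open>a0\<close>.\<close>
  define c where "c = ?n / (sqrt \<alpha> * gradW_norm D v)"
  have c: "0 \<le> c" using n G pos by (simp add: c_def)
  show ?thesis
  proof (intro bexI[of _ "c *\<^sub>R v"] conjI A0.closed(3) v)
    show "form_norm (a0_form D \<alpha>) (c *\<^sub>R v) = ?n"
      using A0.form_norm_scale[OF v, of c] c G pos n by (simp add: form_norm_a0 c_def)
    have "\<theta> * C * ?n\<^sup>2 = ?n * (\<theta> * C * ?n)" by (simp add: power2_eq_square)
    also have "\<dots> \<le> ?n * (b_form D v q / gradW_norm D v)" using bv n by (intro mult_left_mono) auto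
    also have "\<dots> = b_form D (c *\<^sub>R v) q * sqrt \<alpha>"
      using pos by (simp add: b_scale_left[OF v q] c_def)
    finally show "\<theta> * C * ?n\<^sup>2 \<le> b_form D (c *\<^sub>R v) q * sqrt \<alpha>" .
  qed
qed

lemma b_form_diff_left: "v \<in> VV D DD \<Longrightarrow> v' \<in> VV D DD \<Longrightarrow> q \<in> WW D \<Longrightarrow> b_form D (v - v') q = b_form D v q - b_form D v' q"
  using b_add_left[of v "(-1) *\<^sub>R v'" q] b_scale_left[of v' q "-1"] A0.closed(3)[of v' "-1"] by simp

lemma b_form_diff_right: "v \<in> VV D DD \<Longrightarrow> q \<in> WW D \<Longrightarrow> q' \<in> WW D \<Longrightarrow> b_form D v (q - q') = b_form D v q - b_form D v q'"
  by (simp add: b_form_eq M.diff_right div_fields)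

lemma e0p_field_eq: "e0p_field D \<alpha> \<beta> uh pth = inverse (1 / \<alpha> + \<kappa>) *\<^sub>R ((\<lambda>y. divergence D (uh y)) + \<kappa> *\<^sub>R pth)"
  by (simp add: fun_eq_iff e0p_field_def)

lemma e0p_field_mem: "uh \<in> VV D DD \<Longrightarrow> pth \<in> WW D \<Longrightarrow> e0p_field D \<alpha> \<beta> uh pth \<in> WW D"
  unfolding e0p_field_eq by (intro M.closed div_fields)

text \<open>The middle residual needs no Riesz problem: it already is the pairing with a known
  square integrable function, which \<open>e0p_field\<close> is up to the factor of
  \<open>cbar_form\<close>.\<close>

lemma error_equations:
  assumes weak: "weak_solution D \<alpha> \<beta> E f (VV D DD) (WW D) u p pt"
    and h: "uh \<in> VV D DD" "ph \<in> WW D" "pth \<in> WW D"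
    and ru: "represents (a0_form D \<alpha>) (VV D DD) (res_u D \<alpha> E f uh ph) e0u"
    and rp: "represents (d0_form D \<alpha> \<beta>) (WW D) (res_pt D \<alpha> \<beta> E ph pth) e0pt"
  shows "v \<in> VV D DD \<Longrightarrow> a_form D \<alpha> E (u - uh) v + b_form D v (p - ph) = a0_form D \<alpha> e0u v"
    and "q \<in> WW D \<Longrightarrow> b_form D (u - uh) q - \<kappa> * m (pt - pth) q = (1 / \<alpha> + \<kappa>) * m (e0p_field D \<alpha> \<beta> uh pth) q"
    and "q \<in> WW D \<Longrightarrow> - \<kappa> * m (p - ph) q + \<kappa> * pairing param L E (pt - pth) q = \<kappa> * m e0pt q"
proof -
  have mem: "u \<in> VV D DD" "p \<in> WW D" "pt \<in> WW D" using weak by (auto simp: weak_solution_def)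
  {
    assume v: "v \<in> VV D DD"
    have "a_form D \<alpha> E u v + b_form D v p = f_form D f v" using weak v by (auto simp: weak_solution_def)
    moreover have "a0_form D \<alpha> e0u v = f_form D f v - a_form D \<alpha> E uh v - b_form D v ph"
      using ru v by (auto simp: represents_def res_u_def)
    ultimately show "a_form D \<alpha> E (u - uh) v + b_form D v (p - ph) = a0_form D \<alpha> e0u v"
      using A.diff_left[OF mem(1) h(1) v] b_form_diff_right[OF v mem(2) h(2)] by simp
  next
    assume q: "q \<in> WW D"
    have "b_form D u q = \<kappa> * m pt q" using weak q by (auto simp: weak_solution_def c_form_eq)
    moreover have "(1 / \<alpha> + \<kappa>) * m (e0p_field D \<alpha> \<beta> uh pth) q = m (\<lambda>y. divergence D (uh y)) q + \<kappa> * m pth q"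
    proof -
      have k: "1 / \<alpha> + \<kappa> \<noteq> 0" using pos by (simp add: add_pos_pos less_imp_neq[symmetric])
      have "m (e0p_field D \<alpha> \<beta> uh pth) q = inverse (1 / \<alpha> + \<kappa>) * (m (\<lambda>y. divergence D (uh y)) q + \<kappa> * m pth q)"
        unfolding e0p_field_eq using div_fields[OF h(1)] h(3) q M.closed
        by (simp only: M.scale_left M.add_left)
      then show ?thesis using k by (simp only: mult.assoc[symmetric] right_inverse[OF k] mult_1_left)
    qed
    ultimately show "b_form D (u - uh) q - \<kappa> * m (pt - pth) q = (1 / \<alpha> + \<kappa>) * m (e0p_field D \<alpha> \<beta> uh pth) q"
      using b_form_diff_left[OF mem(1) h(1) q] M.diff_left[OF mem(3) h(3) q]
      by (simp add: b_form_eq[of uh] right_diff_distrib)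
  next
    assume q: "q \<in> WW D"
    have "- (\<kappa> * m p q) + \<kappa> * pairing param L E pt q = 0"
      using weak q by (auto simp: weak_solution_def c_form_eq d_form_eq)
    moreover have "\<kappa> * m e0pt q = \<kappa> * m ph q - \<kappa> * pairing param L E pth q"
      using rp q by (auto simp: represents_def res_pt_def d0_form_eq c_form_eq d_form_eq)
    ultimately show "- \<kappa> * m (p - ph) q + \<kappa> * pairing param L E (pt - pth) q = \<kappa> * m e0pt q"
      using M.diff_left[OF mem(2) h(2) q] D.diff_left[OF mem(3) h(3) q]
      by (simp add: right_diff_distrib)
  }
qed

lemma a0_form_zeroD:
  assumes n: "2 \<le> CARD('n)" and v: "v \<in> VV D DD" and zero: "a0_form D \<alpha> v v = 0"
  shows "zero_field D v"
proof -
  have "unit_pairing param L (\<lambda>y. grad D (v y)) (\<lambda>y. grad D (v y)) = 0"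
    using zero pos by (simp add: a0_form_eq)
  from unit_pairing_zeroD[OF weight_1 G.T_fields[OF v[unfolded VV_eq]] this]
  have "AE y in param. AE x in L. grad D (v y) x = 0" .
  with AE_space[of param] show ?thesis unfolding zero_field_def
  proof eventually_elim
    case (elim y)
    have "v y \<in> H1_E0 D DD" using L2_Bochner_mem[OF v[unfolded VV_eq] elim(1)] .
    then show ?case using elim(2) by (rule zero_gradient_imp_zero[OF n korn])
  qed
qed

lemma d0_form_zeroD:
  assumes q: "q \<in> WW D" and zero: "d0_form D \<alpha> \<beta> q q = 0" shows "zero_field D q"
proof -
  have "m q q = 0" using zero pos by (simp add: d0_form_eq)
  from unit_pairing_zeroD[OF weight_1 q[unfolded WW_def] this] show ?thesis
    by (simp add: zero_field_def zero_ae_def)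
qed

end

section \<open>The saturation constant\<close>

lemma power2_le_of_saturation:
  fixes x y \<Theta> :: real
  assumes "x \<le> 1 / sqrt (1 - \<Theta>\<^sup>2) * y" "0 \<le> x" "\<Theta>\<^sup>2 < 1"
  shows "x\<^sup>2 \<le> y\<^sup>2 / (1 - \<Theta>\<^sup>2)"
proof -
  have "x\<^sup>2 \<le> (1 / sqrt (1 - \<Theta>\<^sup>2) * y)\<^sup>2" using assms by (intro power_mono)
  then show ?thesis using assms(3) by (simp add: power_mult_distrib power_divide)
qed

lemma saturation_exists:
  fixes x1 y1 x2 y2 :: real
  assumes "0 < x1" "x1 \<le> y1" "0 < x2" "x2 \<le> y2"
  shows "\<exists>\<Theta>. 0 \<le> \<Theta> \<and> \<Theta> < 1 \<and> y1 \<le> 1 / sqrt (1 - \<Theta>\<^sup>2) * x1 \<and> y2 \<le> 1 / sqrt (1 - \<Theta>\<^sup>2) * x2"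
proof -
  \<comment> \<open>\<open>r\<close> is the worse of the two ratios. The witness is
    \<open>sqrt (1 - r\<^sup>2)\<close>, for which \<open>1 / sqrt (1 - \<Theta>\<^sup>2)\<close> is
    \<open>1 / r\<close>; it lies below 1 because \<open>r\<close> is positive.\<close>
  define r where "r = min (x1 / y1) (x2 / y2)"
  have r: "0 < r" "r \<le> 1" "r \<le> x1 / y1" "r \<le> x2 / y2"
    using assms by (auto simp: r_def min_le_iff_disj)
  have sq: "sqrt (1 - (sqrt (1 - r\<^sup>2))\<^sup>2) = r" using r by (simp add: power_le_one)
  have "y1 \<le> 1 / r * x1" "y2 \<le> 1 / r * x2" using r assms by (auto simp: field_simps)
  then show ?thesis
    using r by (intro exI[of _ "sqrt (1 - r\<^sup>2)"]) (unfold sq, auto simp: power_le_one)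
qed

context elasticity
begin

lemma tensor_VV: "V \<subseteq> H1_E0 D DD \<Longrightarrow> tensor V (S_space \<Lambda>) \<subseteq> VV D DD"
  unfolding VV_eq by (rule G.P.tensor_subset)

lemma tensor_WW: "W \<subseteq> L2 L \<Longrightarrow> tensor W (S_space \<Lambda>) \<subseteq> WW D"
  unfolding WW_eq by (rule Id.P.tensor_subset)

end

theorem theorem4p4:
  fixes D DD DN :: "(real^'n) set"
    and e0 :: "real^'n \<Rightarrow> real" and e :: "nat \<Rightarrow> real^'n \<Rightarrow> real"
    and Emin Emax e0min e0max \<nu> CK CD \<gamma>1 \<gamma>2 :: real
    and f :: "real^'n \<Rightarrow> real^'n"
    and u uh e0u e0u_star eu_t eu_Q :: "'n vfield"
    and p pt ph pth e0pt e0pt_star ept_t ept_Q :: "'n sfield"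
    and Vh Vt :: "(real^'n \<Rightarrow> real^'n) set" and Wh Wt :: "(real^'n \<Rightarrow> real) set"
    and \<Lambda> Q :: "(nat \<Rightarrow> nat) set"
    and \<alpha> \<beta> \<gamma> C1 C2 C6 C7 \<eta>1 \<eta>2 \<eta>3 \<eta> err :: real
    and E :: "real^'n \<Rightarrow> (nat \<Rightarrow> real) \<Rightarrow> real"
    and VhL VtL VhQ :: "'n vfield set" and WhL WtL WhQ :: "'n sfield set"
    and a0 :: "'n vfield \<Rightarrow> 'n vfield \<Rightarrow> real" and cb d0 :: "'n sfield \<Rightarrow> 'n sfield \<Rightarrow> real"
    and Ru :: "'n vfield \<Rightarrow> real" and Rpt :: "'n sfield \<Rightarrow> real"
    and sat :: "real \<Rightarrow> bool"
  defines "\<alpha> \<equiv> 1 / (1 + \<nu>)"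
    and "\<beta> \<equiv> \<nu> / (1 - 2 * \<nu>)"
    and "E \<equiv> modulus e0 e"
    and "VhL \<equiv> tensor Vh (S_space \<Lambda>)" and "WhL \<equiv> tensor Wh (S_space \<Lambda>)"
    and "VtL \<equiv> tensor Vt (S_space \<Lambda>)" and "WtL \<equiv> tensor Wt (S_space \<Lambda>)"
    and "VhQ \<equiv> tensor Vh (S_space Q)" and "WhQ \<equiv> tensor Wh (S_space Q)"
    and "a0 \<equiv> a0_form D \<alpha>" and "cb \<equiv> cbar_form D \<alpha> \<beta>" and "d0 \<equiv> d0_form D \<alpha> \<beta>"
    and "Ru \<equiv> res_u D \<alpha> E f uh ph" and "Rpt \<equiv> res_pt D \<alpha> \<beta> E ph pth"
    and "\<gamma> \<equiv> max \<gamma>1 \<gamma>2"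
    and "C1 \<equiv> 1/2 * Min {CK, CD\<^sup>2 / Emax\<^sup>2, 1 / Emax\<^sup>2}"
    and "C2 \<equiv> sqrt (2 * (Emax\<^sup>2 + CD\<^sup>2 + 1)) / Emax"
    and "C6 \<equiv> inverse (sqrt 3 * max (Emax + sqrt (real CARD('n))) (1 + sqrt (real CARD('n))))"
    and "C7 \<equiv> C2 / (C1 * Emin)"
    and "\<eta>1 \<equiv> sqrt ((form_norm a0 eu_t)\<^sup>2 + (form_norm a0 eu_Q)\<^sup>2)"
    and "\<eta>2 \<equiv> form_norm cb (e0p_field D \<alpha> \<beta> uh pth)"
    and "\<eta>3 \<equiv> sqrt ((form_norm d0 ept_t)\<^sup>2 + (form_norm d0 ept_Q)\<^sup>2)"
    and "\<eta> \<equiv> sqrt (\<eta>1\<^sup>2 + \<eta>2\<^sup>2 + \<eta>3\<^sup>2)"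
    and "err \<equiv> triple_norm D \<alpha> \<beta> (u - uh) (p - ph) (pt - pth)"
    and "sat \<equiv> \<lambda>\<Theta>.
           form_norm a0 e0u_star \<le> form_norm a0 e0u \<and>
           form_norm a0 e0u \<le> 1 / sqrt (1 - \<Theta>\<^sup>2) * form_norm a0 e0u_star \<and>
           form_norm d0 e0pt_star \<le> form_norm d0 e0pt \<and>
           form_norm d0 e0pt \<le> 1 / sqrt (1 - \<Theta>\<^sup>2) * form_norm d0 e0pt_star"
  assumes dim: "CARD('n) \<in> {2, 3}"
    and domain: "lipschitz_polyhedral_domain D"
    and bdry: "frontier D = DD \<union> DN" "DD \<inter> DN = {}" "DD \<noteq> {}" "DN \<noteq> {}"
    and e0_Linf: "e0 \<in> Linf (lebesgue_on D)"
    and ek_Linf: "\<And>k. e k \<in> Linf (lebesgue_on D)"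
    and E_Linf: "(\<lambda>(x, y). E x y) \<in> Linf (lebesgue_on D \<Otimes>\<^sub>M param)"
    and E_bounds: "0 < Emin" "AE (x, y) in lebesgue_on D \<Otimes>\<^sub>M param. Emin \<le> E x y \<and> E x y \<le> Emax"
    and e0_bounds: "0 < e0min" "AE x in lebesgue_on D. e0min \<le> e0 x \<and> e0 x \<le> e0max"
    and ek_sum: "ereal (1 / e0min) * (\<Sum>k. Linf_norm (lebesgue_on D) (e k)) < 1"
    and poisson: "0 < \<nu>" "\<nu> < 1/2"
    and load: "f \<in> L2 (lebesgue_on D)"
    and korn: "korn_constant D DD CK"
    and inf_sup: "inf_sup_constant D DD CD"
    and Vh: "fin_dim_subspace Vh" "Vh \<subseteq> H1_E0 D DD"
    and Wh: "fin_dim_subspace Wh" "Wh \<subseteq> L2 (lebesgue_on D)"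
    and stable_h: "inf_sup_stable D Vh Wh"
    and Vt: "fin_dim_subspace Vt" "Vt \<subseteq> H1_E0 D DD" "trivial_inter D Vh Vt"
    and Wt: "fin_dim_subspace Wt" "Wt \<subseteq> L2 (lebesgue_on D)" "trivial_inter D Wh Wt"
    and stable_star: "inf_sup_stable D (Vh + Vt) (Wh + Wt)"
    and cbs1: "0 \<le> \<gamma>1" "\<gamma>1 < 1"
      "\<And>v w. v \<in> Vh \<Longrightarrow> w \<in> Vt \<Longrightarrow>
         \<bar>LINT x|lebesgue_on D. grad D v x \<bullet> grad D w x\<bar>
           \<le> \<gamma>1 * L2_norm (lebesgue_on D) (grad D v) * L2_norm (lebesgue_on D) (grad D w)"
    and cbs2: "0 \<le> \<gamma>2" "\<gamma>2 < 1"
      "\<And>q r. q \<in> Wh \<Longrightarrow> r \<in> Wt \<Longrightarrow>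
         \<bar>LINT x|lebesgue_on D. q x * r x\<bar>
           \<le> \<gamma>2 * L2_norm (lebesgue_on D) q * L2_norm (lebesgue_on D) r"
    and index_sets: "\<Lambda> \<subseteq> multi_indices" "finite \<Lambda>" "Q \<subseteq> multi_indices" "finite Q" "\<Lambda> \<inter> Q = {}"
    and weak: "weak_solution D \<alpha> \<beta> E f (VV D DD) (WW D) u p pt"
    and galerkin: "weak_solution D \<alpha> \<beta> E f VhL WhL uh ph pth"
    and riesz_u: "represents a0 (VV D DD) Ru e0u" "represents a0 (VhL + VtL + VhQ) Ru e0u_star"
    and riesz_pt: "represents d0 (WW D) Rpt e0pt" "represents d0 (WhL + WtL + WhQ) Rpt e0pt_star"
    and estimator_u: "represents a0 VtL Ru eu_t" "represents a0 VhQ Ru eu_Q"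
    and estimator_pt: "represents d0 WtL Rpt ept_t" "represents d0 WhQ Rpt ept_Q"
    and nonzero: "\<not> zero_field D e0u" "\<not> zero_field D e0pt"
      "\<not> zero_field D e0u_star" "\<not> zero_field D e0pt_star"
  shows "(\<exists>\<Theta>. 0 \<le> \<Theta> \<and> \<Theta> < 1 \<and> sat \<Theta>) \<and>
    (\<forall>\<Theta>. 0 \<le> \<Theta> \<and> \<Theta> < 1 \<and> sat \<Theta> \<longrightarrow>
       C6 * \<eta> \<le> err \<and> err \<le> C7 / (sqrt (1 - \<gamma>\<^sup>2) * sqrt (1 - \<Theta>\<^sup>2)) * \<eta>)"
proof -
  have \<alpha>\<beta>: "0 < \<alpha>" "0 < \<beta>" using poisson by (auto simp: \<alpha>_def \<beta>_def)
  interpret elasticity D DD E \<alpha> \<beta> Emin Emax CK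
    using domain \<alpha>\<beta> E_Linf E_bounds korn
    by unfold_locales (auto simp: lipschitz_polyhedral_domain_def Linf_def)
  have sub: "subspace Vh" "subspace Vt" "subspace Wh" "subspace Wt"
    using Vh(1) Vt(1) Wh(1) Wt(1) by (auto simp: fin_dim_subspace_def)
  note idx = index_sets(1,3,5)
  have h: "uh \<in> VV D DD" "ph \<in> WW D" "pth \<in> WW D"
    using galerkin tensor_VV[OF Vh(2)] tensor_WW[OF Wh(2)]
    by (auto simp: weak_solution_def VhL_def WhL_def)
  have gal_u: "Ru v = 0" if "v \<in> tensor Vh (S_space \<Lambda>)" for v
    using galerkin that by (auto simp: weak_solution_def VhL_def Ru_def res_u_def)
  have gal_p: "Rpt q = 0" if "q \<in> tensor Wh (S_space \<Lambda>)" for q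
    using galerkin that by (auto simp: weak_solution_def WhL_def Rpt_def res_pt_def)
  note est_u = G.tensor_estimator[OF a0_form_eq VV_eq weight_1 less_imp_le[OF pos(1)] idx
      sub(1) Vh(2) sub(2) Vt(2) cbs1 gal_u
      riesz_u(1)[unfolded a0_def] riesz_u(2)[unfolded a0_def VhL_def VtL_def VhQ_def]
      estimator_u(1)[unfolded a0_def VtL_def] estimator_u(2)[unfolded a0_def VhQ_def], folded a0_def]
  have \<kappa>: "0 \<le> \<kappa>" using pos by simp
  have cbs2': "\<bar>LINT x|L. q x \<bullet> r x\<bar> \<le> \<gamma>2 * L2_norm L q * L2_norm L r" if "q \<in> Wh" "r \<in> Wt" for q r
    using cbs2(3)[OF that] by simp
  note est_p = Id.tensor_estimator[OF d0_form_eq WW_eq weight_1 \<kappa> idx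
      sub(3) Wh(2) sub(4) Wt(2) cbs2(1,2) cbs2' gal_p
      riesz_pt(1)[unfolded d0_def] riesz_pt(2)[unfolded d0_def WhL_def WtL_def WhQ_def]
      estimator_pt(1)[unfolded d0_def WtL_def] estimator_pt(2)[unfolded d0_def WhQ_def], folded d0_def]
  interpret D0: psd_form "WW D" d0 unfolding d0_def by (rule psd_d0)
  interpret B0: psd_form "VV D DD" a0 unfolding a0_def by (rule psd_a0)
  have mem: "e0u \<in> VV D DD" "e0pt \<in> WW D" "eu_t \<in> VV D DD" "eu_Q \<in> VV D DD" "ept_t \<in> WW D" "ept_Q \<in> WW D"
    using riesz_u(1) riesz_pt(1) estimator_u estimator_pt
      subsetD[OF tensor_VV[OF Vh(2)]] subsetD[OF tensor_VV[OF Vt(2)]]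
      subsetD[OF tensor_WW[OF Wh(2)]] subsetD[OF tensor_WW[OF Wt(2)]]
    unfolding represents_def VtL_def VhQ_def WtL_def WhQ_def by blast+
  have n: "2 \<le> CARD('n)" using dim by auto
  \<comment> \<open>Definiteness turns the assumption that the projected representers are nonzero
    into positive norms, as \<open>saturation_exists\<close> requires.\<close>
  have star: "0 < form_norm a0 e0u_star" "0 < form_norm d0 e0pt_star"
    using nonzero(3,4) a0_form_zeroD[OF n est_u(1), folded a0_def] d0_form_zeroD[OF est_p(1), folded d0_def]
      B0.nonneg[OF est_u(1)] D0.nonneg[OF est_p(1)]
    by (auto simp: form_norm_def less_le)
  have star_le: "form_norm a0 e0u_star \<le> form_norm a0 e0u" "form_norm d0 e0pt_star \<le> form_norm d0 e0pt"
    using est_u(2) est_p(2) by (auto simp: form_norm_def)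
  have ex: "\<exists>\<Theta>. 0 \<le> \<Theta> \<and> \<Theta> < 1 \<and> sat \<Theta>"
    using saturation_exists[OF star(1) star_le(1) star(2) star_le(2)] star_le unfolding sat_def by blast

  let ?e0p = "e0p_field D \<alpha> \<beta> uh pth"
  have e0p: "?e0p \<in> WW D" by (rule e0p_field_mem[OF h(1,3)])
  have sol: "u \<in> VV D DD" "p \<in> WW D" "pt \<in> WW D" using weak by (auto simp: weak_solution_def)
  have err_mem: "u - uh \<in> VV D DD" "p - ph \<in> WW D" "pt - pth \<in> WW D"
    using sol h by (auto intro: A0.closed(4) M.closed(4))
  note eqs = error_equations[OF weak h riesz_u(1)[unfolded a0_def Ru_def] riesz_pt(1)[unfolded d0_def Rpt_def]]
  define \<epsilon> where "\<epsilon> = energy (u - uh) (p - ph) (pt - pth)"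
  define \<rho> where "\<rho> = energy e0u ?e0p e0pt"
  define s1 where "s1 = a0 eu_t eu_t + a0 eu_Q eu_Q"
  define s2 where "s2 = cb ?e0p ?e0p"
  define s3 where "s3 = d0 ept_t ept_t + d0 ept_Q ept_Q"
  have err: "err = sqrt \<epsilon>" unfolding err_def \<epsilon>_def by (rule triple_norm_eq[OF err_mem])
  have \<epsilon>0: "0 \<le> \<epsilon>" unfolding \<epsilon>_def by (rule energy_nonneg[OF err_mem])
  have \<rho>: "\<rho> = a0 e0u e0u + s2 + d0 e0pt e0pt"
    by (simp add: \<rho>_def energy_def a0_def s2_def cb_def cbar_form_eq d0_def d0_form_eq)
  have s0: "0 \<le> s1" "0 \<le> s2" "0 \<le> s3"
    using mem B0.nonneg D0.nonneg M.nonneg[OF e0p] \<alpha>\<beta>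
    by (auto simp: s1_def s2_def s3_def cb_def cbar_form_eq)
  have \<eta>: "\<eta> = sqrt (s1 + s2 + s3)"
    using s0 mem unfolding \<eta>_def \<eta>1_def \<eta>2_def \<eta>3_def
    by (simp add: B0.form_norm_sq D0.form_norm_sq s1_def[symmetric] s3_def[symmetric])
       (simp add: form_norm_def s2_def)
  have lower: "C6 * \<eta> \<le> err"
  proof -
    let ?K = "max (Emax + sqrt (real CARD('n))) (1 + sqrt (real CARD('n)))"
    have K: "0 < ?K" using real_sqrt_ge_zero[of "real CARD('n)"] by (simp add: less_max_iff_disj add_pos_nonneg)
    \<comment> \<open>\<open>s2\<close> is the exact contribution of the middle representer, so only
      the other two are compared.\<close>
    have "s1 + s2 + s3 \<le> \<rho>" using est_u(3) est_p(3) unfolding \<rho> s1_def s3_def by linarith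
    also have "\<dots> \<le> 3 * ?K\<^sup>2 * \<epsilon>"
      unfolding \<rho>_def \<epsilon>_def by (rule residual_le_error[OF err_mem(1) mem(1) err_mem(2,3) e0p mem(2) eqs])
    finally have "\<eta> \<le> sqrt (3 * ?K\<^sup>2 * \<epsilon>)" unfolding \<eta> by (rule real_sqrt_le_mono)
    also have "\<dots> = sqrt 3 * ?K * err" using K by (simp add: err real_sqrt_mult)
    finally show ?thesis using K unfolding C6_def by (simp add: inverse_eq_divide pos_divide_le_eq mult.commute)
  qed
  have CD: "0 < CD" using inf_sup by (simp add: inf_sup_constant_def)
  have upper: "err \<le> C7 / (sqrt (1 - \<gamma>\<^sup>2) * sqrt (1 - \<Theta>\<^sup>2)) * \<eta>" if \<Theta>: "0 \<le> \<Theta>" "\<Theta> < 1" "sat \<Theta>" for \<Theta>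
  proof -
    let ?g = "1 - \<gamma>\<^sup>2" and ?t = "1 - \<Theta>\<^sup>2"
    have \<gamma>: "0 \<le> \<gamma>" "\<gamma> < 1" "\<gamma>1\<^sup>2 \<le> \<gamma>\<^sup>2" "\<gamma>2\<^sup>2 \<le> \<gamma>\<^sup>2"
      using cbs1(1,2) cbs2(1,2) by (auto simp: \<gamma>_def intro!: power_mono)
    have g: "0 < ?g" "?g \<le> 1" and t: "0 < ?t" "?t \<le> 1"
      using \<gamma>(1,2) \<Theta>(1,2) by (auto simp: abs_square_less_1)
    have tg: "0 < ?t * ?g" "?t * ?g \<le> 1" using g t by (auto intro: mult_le_one)
    \<comment> \<open>Saturation followed by the CBS estimate, stated once for the displacement with
      \<open>c = \<gamma>1\<close> and the pressure with \<open>c = \<gamma>2\<close>.\<close>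
    have bound: "x * (?t * ?g) \<le> s" if "x \<le> y / ?t" "(1 - c\<^sup>2) * y \<le> s" "c\<^sup>2 \<le> \<gamma>\<^sup>2" "0 \<le> y" for x y s c :: real
    proof -
      have "x * ?t \<le> y" using that(1) t by (simp add: pos_le_divide_eq)
      then have "x * ?t * ?g \<le> y * ?g" using g by (intro mult_right_mono) auto
      also have "\<dots> \<le> y * (1 - c\<^sup>2)" using that by (intro mult_left_mono) auto
      finally show ?thesis using that(2) by (simp add: mult_ac)
    qed
    have "a0 e0u e0u \<le> a0 e0u_star e0u_star / ?t" "d0 e0pt e0pt \<le> d0 e0pt_star e0pt_star / ?t"
      using power2_le_of_saturation[of "form_norm a0 e0u" \<Theta> "form_norm a0 e0u_star"]
        power2_le_of_saturation[of "form_norm d0 e0pt" \<Theta> "form_norm d0 e0pt_star"]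
        \<Theta>(3) t B0.form_norm_nonneg[OF mem(1)] D0.form_norm_nonneg[OF mem(2)]
      by (auto simp: sat_def B0.form_norm_sq D0.form_norm_sq mem est_u(1) est_p(1))
    then have "a0 e0u e0u * (?t * ?g) \<le> s1" "d0 e0pt e0pt * (?t * ?g) \<le> s3"
      using bound[OF _ est_u(4)] bound[OF _ est_p(4)] \<gamma> B0.nonneg[OF est_u(1)] D0.nonneg[OF est_p(1)]
      by (auto simp: s1_def s3_def)
    \<comment> \<open>Neither saturation nor the CBS inequality touches the middle term; it takes on
      the factor, at most 1, to match the others.\<close>
    moreover have "s2 * (?t * ?g) \<le> s2" using mult_left_mono[OF tg(2) s0(2)] by simp
    ultimately have "\<rho> * (?t * ?g) \<le> s1 + s2 + s3" unfolding \<rho> distrib_right by linarith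
    then have "\<rho> \<le> (s1 + s2 + s3) / (?t * ?g)" using tg by (simp add: pos_le_divide_eq)
    then have "sqrt \<rho> \<le> \<eta> / (sqrt ?t * sqrt ?g)"
      using real_sqrt_le_mono by (fastforce simp: \<eta> real_sqrt_divide real_sqrt_mult)
    moreover have C7: "0 \<le> C7"
    proof -
      have "0 < C1" using constants CD by (auto simp: C1_def)
      moreover have "0 \<le> C2" using constants by (auto simp: C2_def)
      ultimately show ?thesis using pos by (simp add: C7_def)
    qed
    ultimately have "C7 * sqrt \<rho> \<le> C7 * (\<eta> / (sqrt ?t * sqrt ?g))" by (intro mult_left_mono)
    moreover have "err \<le> C7 * sqrt \<rho>"
      unfolding err \<epsilon>_def \<rho>_def C7_def C1_def C2_def
      by (rule error_le_residual[OF err_mem(1) mem(1) err_mem(2,3) e0p mem(2) eqs CD inf_sup_witness[OF inf_sup]])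
    ultimately show ?thesis by (simp add: mult_ac)
  qed
  from ex lower upper show ?thesis by blast
qed

end
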